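(* Let $Z(s)=\dfrac{a_2s^2+a_1s+a_0}{b_2s^2+b_1s+b_0}\in\mathcal{Z}_b$. Then $Z(s)$ is realizable as a two-reactive five-element bridge network if and only if one of the following two conditions holds: (1) $\mathcal{R}>0$, and at least one of the three quantities $\mathcal{R}-4a_0b_2(a_1b_1+2\mathcal{B})$, $\mathcal{R}-4a_2b_0(a_1b_1-2\mathcal{B})$, $\mathcal{R}-4a_0a_2b_0b_2$ is nonnegative; (2) $\mathcal{R}<0$, and at least one of the following (i), (ii), (iii) holds: (i) $Z(s)$ is regular; (ii) $\mathcal{B}<0$, $\mathcal{R}-4a_0b_2(a_1b_1+2\mathcal{B})\le 0$, the signs of $\mathcal{D}_b$, $\mathcal{E}_a$ and $\mathcal{R}-2a_0b_2\mathcal{B}$ are not all the same, and, if $\mathcal{R}-2a_0b_2\mathcal{B}=0$, then $\mathcal{D}_b\mathcal{E}_a<0$; (iii) $\mathcal{B}>0$, $\mathcal{R}-4a_2b_0(a_1b_1-2\mathcal{B})\le 0$, the signs of $\mathcal{D}_a$, $\mathcal{E}_b$ and $\mathcal{R}+2a_2b_0\mathcal{B}$ are not all the same, and, if $\mathcal{R}+2a_2b_0\mathcal{B}=0$, then $\mathcal{D}_a\mathcal{E}_b<0$.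
   Context: Notation. For $Z(s)=\frac{a_2s^2+a_1s+a_0}{b_2s^2+b_1s+b_0}$ with real coefficients put $\mathcal{A}=a_0b_1-a_1b_0$, $\mathcal{B}=a_0b_2-a_2b_0$, $\mathcal{C}=a_1b_2-a_2b_1$, $\mathcal{D}_a=a_1\mathcal{A}-a_0\mathcal{B}$, $\mathcal{D}_b=-b_1\mathcal{A}+b_0\mathcal{B}$, $\mathcal{E}_a=a_2\mathcal{B}-a_1\mathcal{C}$, $\mathcal{E}_b=-b_2\mathcal{B}+b_1\mathcal{C}$, $\mathcal{R}=\mathcal{A}\mathcal{C}-\mathcal{B}^2$, $\Gamma_a=\mathcal{R}+b_0b_2(a_1^2-4a_0a_2)$, $\Gamma_b=\mathcal{R}+a_0a_2(b_1^2-4b_0b_2)$. The class $\mathcal{Z}_b$ is the set of biquadratic functions $Z(s)$ of this form with $a_2,a_1,a_0,b_2,b_1,b_0>0$ for which none of the following holds: $\mathcal{R}=0$; $\mathcal{B}=0$; $\mathcal{B}>0$ and $\mathcal{D}_a\mathcal{E}_b=0$; $\mathcal{B}<0$ and $\mathcal{D}_b\mathcal{E}_a=0$; $\Gamma_a\Gamma_b=0$. (This excludes exactly the functions with positive coefficients that are realizable with at most four elements.) A real-rational $H(s)$ is positive-real if it is analytic and $\Re H(s)\ge 0$ for $\Re s>0$. A positive-real $H$ is regular if the smallest value of $\Re(H(j\omega))$, or the smallest value of $\Re(H^{-1}(j\omega))$, over $\omega\in\mathbb{R}\cup\{\infty\}$ is attained at $\omega=0$ or $\omega=\infty$. Networks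 are one-port networks with two terminals $a,a'$ made of resistors (impedance $R$), capacitors (impedance $1/(sC)$) and inductors (impedance $sL$), all element values being positive and finite. A network realizes $Z(s)$ if its driving-point impedance between $a$ and $a'$ equals $Z(s)$. A five-element bridge network has vertices $a,a',p,q$ and exactly one element on each of the five edges $ap$, $pa'$, $aq$, $qa'$, $pq$. Capacitors and inductors are called reactive elements; a two-reactive five-element bridge network has exactly two reactive elements and three resistors. *)

theory Defs
  imports "HOL-Analysis.Analysis" "HOL-Computational_Algebra.Polynomial"
begin

text \<open>A biquadratic function is represented by its six coefficients. All conditions below are
  invariant under a common scaling of the coefficients, and \<open>\<R> Z \<noteq> 0\<close> makes the
  coefficients unique up to such a scaling.\<close>

datatype biquadratic =
  Biquadratic (a\<^sub>2: real) (a\<^sub>1: real) (a\<^sub>0: real) (b\<^sub>2: real) (b\<^sub>1: real) (b\<^sub>0: real)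

definition biquad_fun :: "biquadratic \<Rightarrow> complex \<Rightarrow> complex" where
  "biquad_fun Z s =
     (of_real (a\<^sub>2 Z) * s^2 + of_real (a\<^sub>1 Z) * s + of_real (a\<^sub>0 Z)) /
     (of_real (b\<^sub>2 Z) * s^2 + of_real (b\<^sub>1 Z) * s + of_real (b\<^sub>0 Z))"

definition \<A> :: "biquadratic \<Rightarrow> real" where
  "\<A> Z = a\<^sub>0 Z * b\<^sub>1 Z - a\<^sub>1 Z * b\<^sub>0 Z"

definition \<B> :: "biquadratic \<Rightarrow> real" where
  "\<B> Z = a\<^sub>0 Z * b\<^sub>2 Z - a\<^sub>2 Z * b\<^sub>0 Z"

definition \<C> :: "biquadratic \<Rightarrow> real" where
  "\<C> Z = a\<^sub>1 Z * b\<^sub>2 Z - a\<^sub>2 Z * b\<^sub>1 Z"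

definition \<D>\<^sub>a :: "biquadratic \<Rightarrow> real" where
  "\<D>\<^sub>a Z = a\<^sub>1 Z * \<A> Z - a\<^sub>0 Z * \<B> Z"

definition \<D>\<^sub>b :: "biquadratic \<Rightarrow> real" where
  "\<D>\<^sub>b Z = - b\<^sub>1 Z * \<A> Z + b\<^sub>0 Z * \<B> Z"

definition \<E>\<^sub>a :: "biquadratic \<Rightarrow> real" where
  "\<E>\<^sub>a Z = a\<^sub>2 Z * \<B> Z - a\<^sub>1 Z * \<C> Z"

definition \<E>\<^sub>b :: "biquadratic \<Rightarrow> real" where
  "\<E>\<^sub>b Z = - b\<^sub>2 Z * \<B> Z + b\<^sub>1 Z * \<C> Z"

definition \<R> :: "biquadratic \<Rightarrow> real" where
  "\<R> Z = \<A> Z * \<C> Z - (\<B> Z)^2"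

definition \<Gamma>\<^sub>a :: "biquadratic \<Rightarrow> real" where
  "\<Gamma>\<^sub>a Z = \<R> Z + b\<^sub>0 Z * b\<^sub>2 Z * ((a\<^sub>1 Z)^2 - 4 * a\<^sub>0 Z * a\<^sub>2 Z)"

definition \<Gamma>\<^sub>b :: "biquadratic \<Rightarrow> real" where
  "\<Gamma>\<^sub>b Z = \<R> Z + a\<^sub>0 Z * a\<^sub>2 Z * ((b\<^sub>1 Z)^2 - 4 * b\<^sub>0 Z * b\<^sub>2 Z)"

definition \<Z>\<^sub>b :: "biquadratic set" where
  "\<Z>\<^sub>b = {Z. a\<^sub>2 Z > 0 \<and> a\<^sub>1 Z > 0 \<and> a\<^sub>0 Z > 0 \<and> b\<^sub>2 Z > 0 \<and> b\<^sub>1 Z > 0 \<and> b\<^sub>0 Z > 0 \<and>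
     \<not> \<R> Z = 0 \<and>
     \<not> \<B> Z = 0 \<and>
     \<not> (\<B> Z > 0 \<and> \<D>\<^sub>a Z * \<E>\<^sub>b Z = 0) \<and>
     \<not> (\<B> Z < 0 \<and> \<D>\<^sub>b Z * \<E>\<^sub>a Z = 0) \<and>
     \<not> \<Gamma>\<^sub>a Z * \<Gamma>\<^sub>b Z = 0}"

text \<open>The values of \<open>H\<close> at zeros of the chosen denominator are left unspecified, so that the
  notion does not depend on the convention \<open>x / 0 = 0\<close>.\<close>

definition real_rational :: "(complex \<Rightarrow> complex) \<Rightarrow> bool" where
  "real_rational H \<longleftrightarrow> (\<exists>p q :: real poly. q \<noteq> 0 \<and>
     (\<forall>s. poly (map_poly of_real q) s \<noteq> 0 \<longrightarrow>
       H s = poly (map_poly of_real p) s / poly (map_poly of_real q) s))"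

definition positive_real :: "(complex \<Rightarrow> complex) \<Rightarrow> bool" where
  "positive_real H \<longleftrightarrow> real_rational H \<and>
     H analytic_on {s. Re s > 0} \<and> (\<forall>s. Re s > 0 \<longrightarrow> Re (H s) \<ge> 0)"

text \<open>The real part of \<open>H\<close> at the points \<open>j\<omega>\<close> is taken by continuity. At regular points of \<open>H\<close> this
  is just the value. The poles of a positive-real function on the imaginary axis and at infinity
  are simple with positive residue (respectively positive leading coefficient), so they contribute
  nothing to the real part on the axis, which extends continuously across them.\<close>

definition Re_axis :: "(complex \<Rightarrow> complex) \<Rightarrow> real \<Rightarrow> real" where
  "Re_axis H \<omega> = Lim (at \<omega>) (\<lambda>t. Re (H (\<i> * of_real t)))"

definition Re_axis_infinity :: "(complex \<Rightarrow> complex) \<Rightarrow> real" where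
  "Re_axis_infinity H = Lim at_infinity (\<lambda>t::real. Re (H (\<i> * of_real t)))"

definition min_at_zero_or_infinity :: "(complex \<Rightarrow> complex) \<Rightarrow> bool" where
  "min_at_zero_or_infinity H \<longleftrightarrow>
     (\<exists>m \<in> {Re_axis H 0, Re_axis_infinity H}.
        (\<forall>\<omega>. m \<le> Re_axis H \<omega>) \<and> m \<le> Re_axis_infinity H)"

definition regular :: "(complex \<Rightarrow> complex) \<Rightarrow> bool" where
  "regular H \<longleftrightarrow> positive_real H \<and>
     (min_at_zero_or_infinity H \<or> min_at_zero_or_infinity (\<lambda>s. inverse (H s)))"

datatype element =
    Resistor (element_value: real)
  | Capacitor (element_value: real)
  | Inductor (element_value: real)

fun impedance :: "element \<Rightarrow> complex \<Rightarrow> complex" where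
  "impedance (Resistor R) s = of_real R"
| "impedance (Capacitor C) s = 1 / (s * of_real C)"
| "impedance (Inductor L) s = s * of_real L"

fun reactive :: "element \<Rightarrow> bool" where
  "reactive (Resistor R) = False"
| "reactive (Capacitor C) = True"
| "reactive (Inductor L) = True"

text \<open>A network is a list of edges \<open>(x, y, e)\<close>: the element \<open>e\<close> joins the vertices \<open>x\<close> and \<open>y\<close>.
  The orientation from \<open>x\<close> to \<open>y\<close> is only a reference direction for the current.\<close>

type_synonym 'v network = "('v \<times> 'v \<times> element) list"

definition edge_src :: "'v network \<Rightarrow> nat \<Rightarrow> 'v" where
  "edge_src N k = fst (N ! k)"

definition edge_dst :: "'v network \<Rightarrow> nat \<Rightarrow> 'v" where
  "edge_dst N k = fst (snd (N ! k))"

definition edge_element :: "'v network \<Rightarrow> nat \<Rightarrow> element" where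
  "edge_element N k = snd (snd (N ! k))"

text \<open>Vertex potentials \<open>v\<close> and edge currents \<open>i\<close> satisfy Ohm's law on every edge and Kirchhoff's
  current law at every vertex at the complex frequency \<open>s\<close>, when a current \<open>c\<close> enters the network
  at the terminal \<open>x\<close> and leaves it at the terminal \<open>y\<close>. Kirchhoff's voltage law is implied by the
  use of potentials.\<close>

definition network_state ::
  "'v network \<Rightarrow> 'v \<Rightarrow> 'v \<Rightarrow> complex \<Rightarrow> complex \<Rightarrow> ('v \<Rightarrow> complex) \<Rightarrow> (nat \<Rightarrow> complex) \<Rightarrow> bool" where
  "network_state N x y s c v i \<longleftrightarrow>
     (\<forall>k < length N. v (edge_src N k) - v (edge_dst N k) = impedance (edge_element N k) s * i k) \<and>
     (\<forall>u. (\<Sum>k | k < length N \<and> edge_src N k = u. i k) - (\<Sum>k | k < length N \<and> edge_dst N k = u. i k)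
        = (if u = x then c else 0) - (if u = y then c else 0))"

definition driving_point_impedance ::
  "'v network \<Rightarrow> 'v \<Rightarrow> 'v \<Rightarrow> complex \<Rightarrow> complex \<Rightarrow> bool" where
  "driving_point_impedance N x y s z \<longleftrightarrow>
     (\<exists>v i. network_state N x y s 1 v i) \<and>
     (\<forall>c v i. network_state N x y s c v i \<longrightarrow> v x - v y = z * c)"

text \<open>For positive element values the driving-point impedance exists at every \<open>s\<close> in the open right
  half-plane, and rational functions agreeing there are equal.\<close>

definition realizes :: "'v network \<Rightarrow> 'v \<Rightarrow> 'v \<Rightarrow> (complex \<Rightarrow> complex) \<Rightarrow> bool" where
  "realizes N x y H \<longleftrightarrow>
     (\<forall>k < length N. element_value (edge_element N k) > 0) \<and>
     (\<forall>s. Re s > 0 \<longrightarrow> driving_point_impedance N x y s (H s))"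

text \<open>The terminals of the bridge are \<open>VA\<close> and \<open>VA'\<close>.\<close>

datatype bridge_vertex = VA | VA' | VP | VQ

definition five_element_bridge :: "bridge_vertex network \<Rightarrow> bool" where
  "five_element_bridge N \<longleftrightarrow> (\<exists>e1 e2 e3 e4 e5.
     N = [(VA, VP, e1), (VP, VA', e2), (VA, VQ, e3), (VQ, VA', e4), (VP, VQ, e5)])"

definition two_reactive :: "'v network \<Rightarrow> bool" where
  "two_reactive N \<longleftrightarrow> card {k. k < length N \<and> reactive (edge_element N k)} = 2"

definition realizable_two_reactive_bridge :: "(complex \<Rightarrow> complex) \<Rightarrow> bool" where
  "realizable_two_reactive_bridge H \<longleftrightarrow>
     (\<exists>N. five_element_bridge N \<and> two_reactive N \<and> realizes N VA VA' H)"

definition same_sign3 :: "real \<Rightarrow> real \<Rightarrow> real \<Rightarrow> bool" where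
  "same_sign3 x y z \<longleftrightarrow> sgn x = sgn y \<and> sgn y = sgn z"

end

theory Submission
  imports Defs
begin

text \<open>
  Up to symmetry there are only a few ways to place two reactive elements in a bridge, and in each of
  them the invariants of the impedance turn into perfect squares, or into signed sums, of the element
  values. These identities give the necessary inequalities, and read as equations for the element
  values they also show how to solve for them.

  The symmetries are the exchange of the two inner vertices, the exchange of the terminals, the
  frequency inversion \<open>Z(1/s)\<close>, which exchanges inductors and capacitors and changes the sign of \<open>\<B>\<close>,
  and \<open>1/Z(1/s)\<close>, which comes from the planar dual of the bridge and keeps the kind of every element.
  By frequency inversion \<open>\<B> < 0\<close> may be assumed. After discarding the placements that make a
  coefficient of \<open>Z\<close> vanish, five forms remain: two inductors or an inductor and a capacitor, either in
  opposite arms or in an arm and the diagonal, and an inductor in series with a capacitor along one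
  branch (\<open>bridge_realizable_iff\<close>).

  Two inductors give \<open>\<R> \<ge> 0\<close>, since \<open>\<R>\<close> is a positive multiple of a square. So is
  \<open>\<R> - 4 a\<^sub>0 b\<^sub>2 (a\<^sub>1 b\<^sub>1 + 2 \<B>)\<close> for opposite arms, and \<open>\<R> - 4 a\<^sub>0 a\<^sub>2 b\<^sub>0 b\<^sub>2\<close> for an arm and the diagonal.
  An inductor and a capacitor give \<open>\<R> \<le> 0\<close>. If they lie in opposite arms or along one branch, then
  \<open>\<D>\<^sub>b > 0\<close> or \<open>\<E>\<^sub>a > 0\<close>, which is regularity (\<open>regular_biquad_iff\<close>). If they lie in an arm and the
  diagonal, then \<open>\<R> - 4 a\<^sub>0 b\<^sub>2 (a\<^sub>1 b\<^sub>1 + 2 \<B>)\<close> is a negative multiple of a square, and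
  \<open>\<R> - 2 a\<^sub>0 b\<^sub>2 \<B> = - b\<^sub>2 r \<D>\<^sub>b - (a\<^sub>0 / r) \<E>\<^sub>a\<close>, where \<open>r\<close> is the resistance of the arm opposite to the
  inductor; this is what a realization without regularity must satisfy.

  Conversely, in terms of \<open>l = Z(0)\<close>, \<open>h = Z(\<infinity>)\<close> and \<open>t = b\<^sub>0 b\<^sub>2\<close>, elimination leaves in each form one
  quadratic equation for one parameter (a resistance or a ratio of resistances), and the inequalities
  supply a root in the interval in which all other element values come out positive. For an
  inductor and a capacitor in an arm and the diagonal the equation for \<open>r\<close> above is the quadratic one, and
  its discriminant is \<open>\<R> (\<R> - 4 a\<^sub>0 b\<^sub>2 (a\<^sub>1 b\<^sub>1 + 2 \<B>))\<close>. Regular functions with \<open>\<R> < 0\<close> are covered by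
  the two other forms with an inductor and a capacitor; which of them works depends on the signs of \<open>\<Gamma>\<^sub>a\<close> and \<open>\<Gamma>\<^sub>b\<close> (\<open>regular_sufficient\<close>).
\<close>

section \<open>The driving-point impedance of a bridge\<close>

text \<open>The impedance of the bridge is \<open>bridge_num / bridge_den\<close>, where \<open>z1, \<dots>, z5\<close> are the impedances of
  the edges \<open>ap\<close>, \<open>pa'\<close>, \<open>aq\<close>, \<open>qa'\<close>, \<open>pq\<close>. This is Kirchhoff's tree formula multiplied by the product
  of all impedances: the terms of the denominator are the complements of the spanning trees, those of
  the numerator the complements of the two-component forests that separate the terminals.\<close>

definition bridge_num :: "complex \<Rightarrow> complex \<Rightarrow> complex \<Rightarrow> complex \<Rightarrow> complex \<Rightarrow> complex" where
  "bridge_num z1 z2 z3 z4 z5 = z5 * (z1 + z2) * (z3 + z4) + z1 * z2 * (z3 + z4) + z3 * z4 * (z1 + z2)"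

definition bridge_den :: "complex \<Rightarrow> complex \<Rightarrow> complex \<Rightarrow> complex \<Rightarrow> complex \<Rightarrow> complex" where
  "bridge_den z1 z2 z3 z4 z5 = z5 * (z1 + z2 + z3 + z4) + (z1 + z3) * (z2 + z4)"

lemma Re_inverse_pos: "Re (inverse z) > 0" if "Re z > 0"
proof -
  have "0 < (Re z)\<^sup>2 + (Im z)\<^sup>2" using that by (simp add: sum_power2_gt_zero_iff)
  then show ?thesis using that by simp
qed

text \<open>Divided by \<open>z1 + z2 + z3 + z4\<close> the denominator is \<open>z5\<close> in series with a parallel connection, and
  such combinations keep the real part positive.\<close>

lemma bridge_den_nonzero:
  assumes "Re z1 > 0" "Re z2 > 0" "Re z3 > 0" "Re z4 > 0" "Re z5 > 0"
  shows "bridge_den z1 z2 z3 z4 z5 \<noteq> 0"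
proof
  assume 0: "bridge_den z1 z2 z3 z4 z5 = 0"
  define u w where "u = z1 + z3" and "w = z2 + z4"
  have u: "Re u > 0" and w: "Re w > 0" using assms by (auto simp: u_def w_def)
  have nz: "u \<noteq> 0" "w \<noteq> 0" "u + w \<noteq> 0" using u w
    by (auto simp: complex_eq_iff)
  have "z5 * (u + w) + u * w = 0" using 0 by (simp add: bridge_den_def u_def w_def algebra_simps)
  then have "z5 = - (u * w / (u + w))" using nz by (simp add: field_simps add_eq_0_iff)
  also have "u * w / (u + w) = inverse (inverse u + inverse w)" using nz by (simp add: field_simps)
  finally have "Re z5 = - Re (inverse (inverse u + inverse w))" by simp
  moreover have "Re (inverse (inverse u + inverse w)) > 0"
    using Re_inverse_pos[OF u] Re_inverse_pos[OF w] by (intro Re_inverse_pos) simp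
  ultimately show False using assms by simp
qed

lemma impedance_Re_pos: "Re (impedance e s) > 0" if "element_value e > 0" "Re s > 0"
proof (cases e)
  case (Capacitor C)
  then have "Re (s * of_real C) > 0" using that by simp
  then show ?thesis using Re_inverse_pos[of "s * of_real C"] Capacitor by (simp add: inverse_eq_divide)
qed (use that in auto)

lemma sum_five_edges: "(\<Sum>k | k < 5 \<and> P k. f k) =
   (if P 0 then f 0 else 0) + (if P 1 then f 1 else 0) + (if P 2 then f 2 else 0)
   + (if P 3 then f 3 else 0) + (if P 4 then f 4 else (0::complex))" for f :: "nat \<Rightarrow> complex"
proof -
  have "(\<Sum>k | k < 5 \<and> P k. f k) = (\<Sum>k\<in>{..<5}. if P k then f k else 0)"
    by (subst sum.inter_filter[symmetric]) (auto intro: sum.cong)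
  also have "\<dots> = (if P 0 then f 0 else 0) + (if P 1 then f 1 else 0) + (if P 2 then f 2 else 0)
   + (if P 3 then f 3 else 0) + (if P 4 then f 4 else 0)"
    by (simp add: eval_nat_numeral lessThan_Suc add_ac)
  finally show ?thesis .
qed

definition bridge :: "element \<Rightarrow> element \<Rightarrow> element \<Rightarrow> element \<Rightarrow> element \<Rightarrow> bridge_vertex network" where
  "bridge e1 e2 e3 e4 e5 =
     [(VA, VP, e1), (VP, VA', e2), (VA, VQ, e3), (VQ, VA', e4), (VP, VQ, e5)]"

lemma all_vertex: "(\<forall>u. P u) \<longleftrightarrow> P VA \<and> P VA' \<and> P VP \<and> P VQ"
  by (metis bridge_vertex.exhaust)

lemma all_five_edges: "(\<forall>k<5. P k) \<longleftrightarrow> P 0 \<and> P 1 \<and> P 2 \<and> P 3 \<and> P (4::nat)"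
  by (simp add: eval_nat_numeral All_less_Suc conj_ac)

lemma length_bridge: "length (bridge e1 e2 e3 e4 e5) = 5" by (simp add: bridge_def)

lemma edge_element_bridge:
  "edge_element (bridge e1 e2 e3 e4 e5) 0 = e1" "edge_element (bridge e1 e2 e3 e4 e5) 1 = e2"
  "edge_element (bridge e1 e2 e3 e4 e5) 2 = e3" "edge_element (bridge e1 e2 e3 e4 e5) 3 = e4"
  "edge_element (bridge e1 e2 e3 e4 e5) 4 = e5"
  by (auto simp: bridge_def edge_element_def eval_nat_numeral)

lemma network_state_bridge:
  "network_state (bridge e1 e2 e3 e4 e5) VA VA' s c v i \<longleftrightarrow>
    v VA - v VP = impedance e1 s * i 0 \<and> v VP - v VA' = impedance e2 s * i 1 \<and>
    v VA - v VQ = impedance e3 s * i 2 \<and> v VQ - v VA' = impedance e4 s * i 3 \<and>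
    v VP - v VQ = impedance e5 s * i 4 \<and>
    i 0 + i 2 = c \<and> i 1 + i 3 = c \<and> i 1 + i 4 = i 0 \<and> i 3 = i 2 + i 4"
  unfolding network_state_def length_bridge sum_five_edges all_vertex all_five_edges
  by (auto simp: bridge_def edge_src_def edge_dst_def edge_element_def eval_nat_numeral algebra_simps)

text \<open>Eliminating all but two currents leaves the two loop equations, whose determinant is \<open>bridge_den\<close>
  up to sign. It does not vanish in the right half-plane, so the state exists and the voltage is
  determined by the injected current.\<close>

lemma driving_point_impedance_bridge:
  assumes "element_value e1 > 0" "element_value e2 > 0" "element_value e3 > 0" "element_value e4 > 0"
    "element_value e5 > 0" "Re s > 0"
  shows "driving_point_impedance (bridge e1 e2 e3 e4 e5) VA VA' s z \<longleftrightarrow>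
     z = bridge_num (impedance e1 s) (impedance e2 s) (impedance e3 s) (impedance e4 s) (impedance e5 s) /
         bridge_den (impedance e1 s) (impedance e2 s) (impedance e3 s) (impedance e4 s) (impedance e5 s)"
    (is "?L \<longleftrightarrow> z = ?n / ?d")
proof -
  define z1 z2 z3 z4 z5 where z: "z1 = impedance e1 s" "z2 = impedance e2 s" "z3 = impedance e3 s"
    "z4 = impedance e4 s" "z5 = impedance e5 s"
  have d: "?d \<noteq> 0" using assms by (intro bridge_den_nonzero impedance_Re_pos)
  have all: "v VA - v VA' = ?n / ?d * c"
    if "network_state (bridge e1 e2 e3 e4 e5) VA VA' s c v i" for c v i
  proof -
    have h: "v VA - v VP = z1 * i 0" "v VP - v VA' = z2 * i 1"
      "v VA - v VQ = z3 * i 2" "v VQ - v VA' = z4 * i 3"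
      "v VP - v VQ = z5 * i 4"
      "i 0 + i 2 = c" "i 1 + i 3 = c" "i 1 + i 4 = i 0" "i 3 = i 2 + i 4"
      using that unfolding network_state_bridge z by blast+
    have i: "i 2 = c - i 0" "i 3 = c - i 1" "i 4 = i 0 - i 1"
      using h(6-8) by (auto simp: eq_diff_eq add.commute)
    have V: "v VA - v VA' = z1 * i 0 + z2 * i 1" using h(1,2) by (simp add: algebra_simps)
    have "z1 * i 0 + z5 * i 4 = z3 * i 2"
      using h(1,3,5) by (metis add_diff_cancel_left' add_diff_cancel_right' diff_add_cancel diff_diff_eq2)
    then have loop1: "z1 * i 0 + z5 * (i 0 - i 1) = z3 * (c - i 0)" using i by simp
    have "z5 * i 4 + z4 * i 3 = z2 * i 1"
      using h(2,4,5) by (metis diff_add_cancel add_diff_eq)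
    then have loop2: "z5 * (i 0 - i 1) + z4 * (c - i 1) = z2 * i 1" using i by simp
    have "(z1 * i 0 + z2 * i 1) * bridge_den z1 z2 z3 z4 z5 = bridge_num z1 z2 z3 z4 z5 * c"
      using loop1 loop2 unfolding bridge_den_def bridge_num_def by algebra
    then have "(v VA - v VA') * bridge_den z1 z2 z3 z4 z5 = bridge_num z1 z2 z3 z4 z5 * c"
      unfolding V .
    then show ?thesis using d by (simp add: z field_simps)
  qed
  have ex: "\<exists>v i. network_state (bridge e1 e2 e3 e4 e5) VA VA' s 1 v i"
  proof -
    \<comment> \<open>The edge currents by Cramer's rule, before division by the determinant.\<close>
    define j0 j1 j2 j3 j4 where j: "j0 = z5 * (z3 + z4) + z3 * (z2 + z4)"
       "j1 = z5 * (z3 + z4) + z4 * (z1 + z3)" "j2 = z5 * (z1 + z2) + z1 * (z2 + z4)"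
       "j3 = z5 * (z1 + z2) + z2 * (z1 + z3)" "j4 = z2 * z3 - z1 * z4"
    define i where "i = (\<lambda>k::nat. (if k = 0 then j0 else if k = 1 then j1 else if k = 2 then j2
       else if k = 3 then j3 else j4) / ?d)"
    define v where "v = (\<lambda>u. case u of VA \<Rightarrow> z1 * i 0 + z2 * i 1 | VA' \<Rightarrow> 0
       | VP \<Rightarrow> z2 * i 1 | VQ \<Rightarrow> z4 * i 3)"
    have D: "?d = bridge_den z1 z2 z3 z4 z5" by (simp add: z)
    have i: "i 0 = j0 / ?d" "i 1 = j1 / ?d" "i 2 = j2 / ?d" "i 3 = j3 / ?d" "i 4 = j4 / ?d"
      by (simp_all add: i_def)
    have loops: "z1 * j0 + z2 * j1 - z4 * j3 = z3 * j2" "z2 * j1 - z4 * j3 = z5 * j4"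
      by (simp_all add: j algebra_simps)
    have nodes: "j1 + j4 = j0" "j3 = j2 + j4" "j0 + j2 = ?d" "j1 + j3 = ?d"
      unfolding D by (simp_all add: j bridge_den_def algebra_simps)
    have "v VA - v VQ = z3 * i 2" "v VP - v VQ = z5 * i 4"
      using loops by (simp_all add: v_def i[unfolded One_nat_def] flip: add_divide_distrib diff_divide_distrib)
    moreover have "v VA - v VP = z1 * i 0" "v VP - v VA' = z2 * i 1" "v VQ - v VA' = z4 * i 3"
      by (simp_all add: v_def)
    moreover have "i 0 + i 2 = 1" "i 1 + i 3 = 1" "i 1 + i 4 = i 0" "i 3 = i 2 + i 4"
      unfolding i add_divide_distrib[symmetric] nodes(3,4) using d nodes(1,2) by simp_all
    ultimately have "network_state (bridge e1 e2 e3 e4 e5) VA VA' s 1 v i"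
      unfolding network_state_bridge z by blast
    then show ?thesis by blast
  qed
  show ?thesis
  proof
    assume L: ?L
    obtain v i where st: "network_state (bridge e1 e2 e3 e4 e5) VA VA' s 1 v i" using ex by blast
    then have "v VA - v VA' = z * 1" using L unfolding driving_point_impedance_def by blast
    then show "z = ?n / ?d" using all[OF st] by simp
  next
    assume "z = ?n / ?d"
    then show ?L using ex all unfolding driving_point_impedance_def by blast
  qed
qed

definition bridge_realizes ::
  "element \<Rightarrow> element \<Rightarrow> element \<Rightarrow> element \<Rightarrow> element \<Rightarrow> biquadratic \<Rightarrow> bool" where
  "bridge_realizes e1 e2 e3 e4 e5 Z \<longleftrightarrow>
     element_value e1 > 0 \<and> element_value e2 > 0 \<and> element_value e3 > 0 \<and> element_value e4 > 0 \<and>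
     element_value e5 > 0 \<and>
     (\<forall>s. Re s > 0 \<longrightarrow> biquad_fun Z s =
         bridge_num (impedance e1 s) (impedance e2 s) (impedance e3 s) (impedance e4 s) (impedance e5 s) /
         bridge_den (impedance e1 s) (impedance e2 s) (impedance e3 s) (impedance e4 s) (impedance e5 s))"

lemma realizes_bridge:
  "realizes (bridge e1 e2 e3 e4 e5) VA VA' (biquad_fun Z) \<longleftrightarrow> bridge_realizes e1 e2 e3 e4 e5 Z"
  unfolding realizes_def bridge_realizes_def length_bridge all_five_edges edge_element_bridge
  using driving_point_impedance_bridge by auto

lemma two_reactive_bridge:
  "two_reactive (bridge e1 e2 e3 e4 e5) \<longleftrightarrow>
    of_bool (reactive e1) + of_bool (reactive e2) + of_bool (reactive e3) + of_bool (reactive e4)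
      + of_bool (reactive e5) = (2::nat)"
proof -
  have "card {k. k < 5 \<and> P k} = of_bool (P 0) + of_bool (P 1) + of_bool (P 2) + of_bool (P 3) + of_bool (P (4::nat))" for P
  proof -
    have "card {k. k < 5 \<and> P k} = (\<Sum>k\<in>{k\<in>{..<5}. P k}. 1)" by (simp only: card_eq_sum lessThan_iff)
    also have "\<dots> = (\<Sum>k\<in>{..<5}. of_bool (P k))" 
      unfolding of_bool_def by (rule sum.inter_filter) simp
    also have "\<dots> = of_bool (P 0) + of_bool (P 1) + of_bool (P 2) + of_bool (P 3) + of_bool (P 4)"
      by (simp add: eval_nat_numeral lessThan_Suc)
    finally show ?thesis .
  qed
  then show ?thesis unfolding two_reactive_def length_bridge by (simp only: edge_element_bridge)
qed

section \<open>Symmetries of the bridge\<close>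

lemma bridge_swap_inner:
  "bridge_num z3 z4 z1 z2 z5 = bridge_num z1 z2 z3 z4 z5" "bridge_den z3 z4 z1 z2 z5 = bridge_den z1 z2 z3 z4 z5"
  by (simp_all add: bridge_num_def bridge_den_def algebra_simps)

lemma bridge_swap_terminals:
  "bridge_num z2 z1 z4 z3 z5 = bridge_num z1 z2 z3 z4 z5" "bridge_den z2 z1 z4 z3 z5 = bridge_den z1 z2 z3 z4 z5"
  by (simp_all add: bridge_num_def bridge_den_def algebra_simps)

lemma bridge_realizes_swap_inner: "bridge_realizes e1 e2 e3 e4 e5 Z \<Longrightarrow> bridge_realizes e3 e4 e1 e2 e5 Z"
  unfolding bridge_realizes_def bridge_swap_inner[of "impedance e1 _"] by simp

lemma bridge_realizes_swap_terminals: "bridge_realizes e1 e2 e3 e4 e5 Z \<Longrightarrow> bridge_realizes e2 e1 e4 e3 e5 Z"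
  unfolding bridge_realizes_def bridge_swap_terminals[of "impedance e1 _"] by simp

definition freq_inv :: "biquadratic \<Rightarrow> biquadratic" where
  "freq_inv Z = Biquadratic (a\<^sub>0 Z) (a\<^sub>1 Z) (a\<^sub>2 Z) (b\<^sub>0 Z) (b\<^sub>1 Z) (b\<^sub>2 Z)"

fun element_freq_inv :: "element \<Rightarrow> element" where
  "element_freq_inv (Resistor R) = Resistor R"
| "element_freq_inv (Capacitor C) = Inductor (1 / C)"
| "element_freq_inv (Inductor L) = Capacitor (1 / L)"

text \<open>The coefficients of \<open>1/Z(1/s)\<close>. Taking the dual network exchanges the two kinds of reactive
  elements and frequency inversion exchanges them back, so this symmetry preserves the kinds.\<close>

definition dual_inv :: "biquadratic \<Rightarrow> biquadratic" where
  "dual_inv Z = Biquadratic (b\<^sub>0 Z) (b\<^sub>1 Z) (b\<^sub>2 Z) (a\<^sub>0 Z) (a\<^sub>1 Z) (a\<^sub>2 Z)"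

fun element_dual_inv :: "element \<Rightarrow> element" where
  "element_dual_inv (Resistor R) = Resistor (1 / R)"
| "element_dual_inv (Capacitor C) = Capacitor (1 / C)"
| "element_dual_inv (Inductor L) = Inductor (1 / L)"

lemma element_freq_inv_value: "element_value e > 0 \<Longrightarrow> element_value (element_freq_inv e) > 0"
  by (cases e) auto
lemma element_dual_inv_value: "element_value e > 0 \<Longrightarrow> element_value (element_dual_inv e) > 0"
  by (cases e) auto

lemma impedance_freq_inv: "impedance (element_freq_inv e) s = impedance e (inverse s)" if "s \<noteq> 0"
  using that by (cases e) (auto simp: field_simps)

lemma impedance_dual_inv: "impedance (element_dual_inv e) s = inverse (impedance e (inverse s))" if "s \<noteq> 0"
  using that by (cases e) (auto simp: field_simps)

lemma biquad_fun_freq_inv: "biquad_fun (freq_inv Z) s = biquad_fun Z (inverse s)" if "s \<noteq> 0"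
proof -
  have *: "x * inverse s ^ 2 + y * inverse s + w = (w * s^2 + y * s + x) / s^2" for x y w :: complex
    using that by (simp add: field_simps power2_eq_square)
  show ?thesis using that by (simp add: biquad_fun_def freq_inv_def *)
qed

lemma biquad_fun_dual_inv: "biquad_fun (dual_inv Z) s = inverse (biquad_fun Z (inverse s))" if "s \<noteq> 0"
proof -
  have *: "x * inverse s ^ 2 + y * inverse s + w = (w * s^2 + y * s + x) / s^2" for x y w :: complex
    using that by (simp add: field_simps power2_eq_square)
  show ?thesis using that by (simp add: biquad_fun_def dual_inv_def *)
qed

lemma bridge_realizes_freq_inv:
  assumes "bridge_realizes e1 e2 e3 e4 e5 Z"
  shows "bridge_realizes (element_freq_inv e1) (element_freq_inv e2) (element_freq_inv e3)
     (element_freq_inv e4) (element_freq_inv e5) (freq_inv Z)"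
proof -
  let ?z = "\<lambda>e s. impedance (element_freq_inv e) s"
  have "biquad_fun (freq_inv Z) s =
     bridge_num (?z e1 s) (?z e2 s) (?z e3 s) (?z e4 s) (?z e5 s) /
     bridge_den (?z e1 s) (?z e2 s) (?z e3 s) (?z e4 s) (?z e5 s)"
    if "Re s > 0" for s
  proof -
    have "s \<noteq> 0" using that by auto
    then show ?thesis using assms Re_inverse_pos[OF that]
      by (simp add: bridge_realizes_def biquad_fun_freq_inv impedance_freq_inv)
  qed
  then show ?thesis using assms by (simp add: bridge_realizes_def element_freq_inv_value)
qed

text \<open>The dual of the bridge, relative to the port, exchanges the edges \<open>pa'\<close> and \<open>aq\<close> and keeps the
  other three: a triangle of the bridge closed up by the port edge becomes a star.\<close>

lemma bridge_dual:
  assumes "z1 \<noteq> 0" "z2 \<noteq> 0" "z3 \<noteq> 0" "z4 \<noteq> 0" "z5 \<noteq> 0"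
  shows "bridge_num (inverse z1) (inverse z3) (inverse z2) (inverse z4) (inverse z5) * (z1 * z2 * z3 * z4 * z5)
           = bridge_den z1 z2 z3 z4 z5"
    and "bridge_den (inverse z1) (inverse z3) (inverse z2) (inverse z4) (inverse z5) * (z1 * z2 * z3 * z4 * z5)
           = bridge_num z1 z2 z3 z4 z5"
proof -
  define y1 y2 y3 y4 y5 where y: "y1 = inverse z1" "y2 = inverse z2" "y3 = inverse z3" "y4 = inverse z4"
    "y5 = inverse z5"
  have 1: "y1 * z1 = 1" "y2 * z2 = 1" "y3 * z3 = 1" "y4 * z4 = 1" "y5 * z5 = 1"
    using assms by (simp_all add: y)
  show "bridge_num (inverse z1) (inverse z3) (inverse z2) (inverse z4) (inverse z5) * (z1 * z2 * z3 * z4 * z5)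
           = bridge_den z1 z2 z3 z4 z5"
    unfolding y[symmetric] bridge_num_def bridge_den_def using 1 by algebra
  show "bridge_den (inverse z1) (inverse z3) (inverse z2) (inverse z4) (inverse z5) * (z1 * z2 * z3 * z4 * z5)
           = bridge_num z1 z2 z3 z4 z5"
    unfolding y[symmetric] bridge_num_def bridge_den_def using 1 by algebra
qed

lemma bridge_realizes_dual_inv:
  assumes "bridge_realizes e1 e2 e3 e4 e5 Z"
  shows "bridge_realizes (element_dual_inv e1) (element_dual_inv e3) (element_dual_inv e2)
     (element_dual_inv e4) (element_dual_inv e5) (dual_inv Z)"
proof -
  let ?z = "\<lambda>e s. impedance (element_dual_inv e) s"
  have "biquad_fun (dual_inv Z) s =
     bridge_num (?z e1 s) (?z e3 s) (?z e2 s) (?z e4 s) (?z e5 s) /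
     bridge_den (?z e1 s) (?z e3 s) (?z e2 s) (?z e4 s) (?z e5 s)"
    if s: "Re s > 0" for s
  proof -
    have s0: "s \<noteq> 0" using s by auto
    have nz: "impedance e (inverse s) \<noteq> 0" if "element_value e > 0" for e
      using impedance_Re_pos[OF that Re_inverse_pos[OF s]] by auto
    define z1 z2 z3 z4 z5 where z: "z1 = impedance e1 (inverse s)" "z2 = impedance e2 (inverse s)"
      "z3 = impedance e3 (inverse s)" "z4 = impedance e4 (inverse s)" "z5 = impedance e5 (inverse s)"
    have z0: "z1 \<noteq> 0" "z2 \<noteq> 0" "z3 \<noteq> 0" "z4 \<noteq> 0" "z5 \<noteq> 0"
      using nz assms by (auto simp: z bridge_realizes_def)
    have "biquad_fun Z (inverse s) = bridge_num z1 z2 z3 z4 z5 / bridge_den z1 z2 z3 z4 z5"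
      using assms Re_inverse_pos[OF s] by (simp add: bridge_realizes_def z)
    then show ?thesis
      unfolding biquad_fun_dual_inv[OF s0] impedance_dual_inv[OF s0] z[symmetric]
      using bridge_dual[OF z0, symmetric] z0 by simp
  qed
  then show ?thesis using assms by (simp add: bridge_realizes_def element_dual_inv_value)
qed

definition bridge_realizable :: "biquadratic \<Rightarrow> bool" where
  "bridge_realizable Z \<longleftrightarrow> (\<exists>e1 e2 e3 e4 e5. bridge_realizes e1 e2 e3 e4 e5 Z \<and>
    of_bool (reactive e1) + of_bool (reactive e2) + of_bool (reactive e3) + of_bool (reactive e4)
      + of_bool (reactive e5) = (2::nat))"

lemma realizable_two_reactive_bridge_iff:
  "realizable_two_reactive_bridge (biquad_fun Z) \<longleftrightarrow> bridge_realizable Z"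
proof -
  have "five_element_bridge N \<longleftrightarrow> (\<exists>e1 e2 e3 e4 e5. N = bridge e1 e2 e3 e4 e5)" for N
    by (simp add: five_element_bridge_def bridge_def)
  then show ?thesis
    unfolding realizable_two_reactive_bridge_def bridge_realizable_def
    by (metis two_reactive_bridge realizes_bridge)
qed

lemma reactive_freq_inv: "reactive (element_freq_inv e) = reactive e" by (cases e) auto
lemma reactive_dual_inv: "reactive (element_dual_inv e) = reactive e" by (cases e) auto

lemma freq_inv_idem [simp]: "freq_inv (freq_inv Z) = Z" by (cases Z) (simp add: freq_inv_def)
lemma dual_inv_idem [simp]: "dual_inv (dual_inv Z) = Z" by (cases Z) (simp add: dual_inv_def)

lemma bridge_realizable_freq_inv: "bridge_realizable (freq_inv Z) \<longleftrightarrow> bridge_realizable Z"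
proof -
  have "bridge_realizable Z \<Longrightarrow> bridge_realizable (freq_inv Z)" for Z
  proof -
    assume "bridge_realizable Z"
    then obtain e1 e2 e3 e4 e5 where e: "bridge_realizes e1 e2 e3 e4 e5 Z"
      "of_bool (reactive e1) + of_bool (reactive e2) + of_bool (reactive e3) + of_bool (reactive e4)
        + of_bool (reactive e5) = (2::nat)" unfolding bridge_realizable_def by blast
    show "bridge_realizable (freq_inv Z)"
      unfolding bridge_realizable_def
      by (intro exI conjI, rule bridge_realizes_freq_inv[OF e(1)]) (simp only: reactive_freq_inv e(2))
  qed
  then show ?thesis by (metis freq_inv_idem)
qed

lemma bridge_realizable_dual_inv: "bridge_realizable (dual_inv Z) \<longleftrightarrow> bridge_realizable Z"
proof -
  have "bridge_realizable Z \<Longrightarrow> bridge_realizable (dual_inv Z)" for Z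
  proof -
    assume "bridge_realizable Z"
    then obtain e1 e2 e3 e4 e5 where e: "bridge_realizes e1 e2 e3 e4 e5 Z"
      "of_bool (reactive e1) + of_bool (reactive e2) + of_bool (reactive e3) + of_bool (reactive e4)
        + of_bool (reactive e5) = (2::nat)" unfolding bridge_realizable_def by blast
    have "of_bool (reactive e1) + of_bool (reactive e3) + of_bool (reactive e2) + of_bool (reactive e4)
        + of_bool (reactive e5) = (2::nat)" using e(2) by linarith
    then have n: "of_bool (reactive (element_dual_inv e1)) + of_bool (reactive (element_dual_inv e3))
        + of_bool (reactive (element_dual_inv e2)) + of_bool (reactive (element_dual_inv e4))
        + of_bool (reactive (element_dual_inv e5)) = (2::nat)" by (simp only: reactive_dual_inv)
    show "bridge_realizable (dual_inv Z)"
      unfolding bridge_realizable_def using bridge_realizes_dual_inv[OF e(1)] n by blast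
  qed
  then show ?thesis by (metis dual_inv_idem)
qed

section \<open>Realizability in terms of coefficients\<close>

definition pos_coeffs :: "biquadratic \<Rightarrow> bool" where
  "pos_coeffs Z \<longleftrightarrow> a\<^sub>2 Z > 0 \<and> a\<^sub>1 Z > 0 \<and> a\<^sub>0 Z > 0 \<and> b\<^sub>2 Z > 0 \<and> b\<^sub>1 Z > 0 \<and> b\<^sub>0 Z > 0"

definition proportional :: "biquadratic \<Rightarrow> real \<Rightarrow> real \<Rightarrow> real \<Rightarrow> real \<Rightarrow> real \<Rightarrow> real \<Rightarrow> bool" where
  "proportional Z n2 n1 n0 d2 d1 d0 \<longleftrightarrow>
    (\<exists>k>0. k * a\<^sub>2 Z = n2 \<and> k * a\<^sub>1 Z = n1 \<and> k * a\<^sub>0 Z = n0 \<and>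
      k * b\<^sub>2 Z = d2 \<and> k * b\<^sub>1 Z = d1 \<and> k * b\<^sub>0 Z = d0)"

text \<open>The hypothesis \<open>res\<close> says that the resultant of the two polynomials is nonzero, so they are coprime
  and the fraction has no other representation of degree at most two.\<close>

lemma proportional_of_cross_product:
  fixes A2 A1 A0 B2 B1 B0 n2 n1 n0 d2 d1 d0 :: real
  assumes pos: "A2 > 0" "A0 > 0" "B2 > 0" "B0 > 0"
    and res: "(A0 * B1 - A1 * B0) * (A1 * B2 - A2 * B1) - (A0 * B2 - A2 * B0)\<^sup>2 \<noteq> 0"
    and eq: "\<And>x. x > 0 \<Longrightarrow> (A2 * x\<^sup>2 + A1 * x + A0) * (d2 * x\<^sup>2 + d1 * x + d0)
       = (B2 * x\<^sup>2 + B1 * x + B0) * (n2 * x\<^sup>2 + n1 * x + n0)"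
  shows "\<exists>k. k * A2 = n2 \<and> k * A1 = n1 \<and> k * A0 = n0 \<and> k * B2 = d2 \<and> k * B1 = d1 \<and> k * B0 = d0"
proof -
  \<comment> \<open>A polynomial identity of degree four follows from its values at five points.\<close>
  have c: "A2 * d2 = B2 * n2" "A2 * d1 + A1 * d2 = B2 * n1 + B1 * n2"
    "A2 * d0 + A1 * d1 + A0 * d2 = B2 * n0 + B1 * n1 + B0 * n2"
    "A1 * d0 + A0 * d1 = B1 * n0 + B0 * n1" "A0 * d0 = B0 * n0"
    using eq[of 1] eq[of 2] eq[of 3] eq[of 4] eq[of 5] by (simp_all add: algebra_simps)
  define k where "k = d2 / B2"
  define e1 e0 m1 m0 where e: "e1 = d1 - k * B1" "e0 = d0 - k * B0" "m1 = n1 - k * A1" "m0 = n0 - k * A0"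
  have k: "k * B2 = d2" using pos by (simp add: k_def)
  have kA: "k * A2 = n2" using c(1) pos k by (simp add: k_def field_simps)
  have E1: "A2 * e1 = B2 * m1" using c(2) unfolding e k[symmetric] kA[symmetric] by (simp add: algebra_simps)
  have E2: "A2 * e0 + A1 * e1 = B2 * m0 + B1 * m1" using c(3) unfolding e k[symmetric] kA[symmetric] by (simp add: algebra_simps)
  have E3: "A1 * e0 + A0 * e1 = B1 * m0 + B0 * m1" using c(4) unfolding e by (simp add: algebra_simps)
  have E4: "A0 * e0 = B0 * m0" using c(5) unfolding e by (simp add: algebra_simps)
  have m0: "m0 = A0 * e0 / B0" and m1: "m1 = A2 * e1 / B2" using E4 E1 pos by (simp_all add: field_simps)
  have F1: "e1 * B0 * (A1 * B2 - A2 * B1) = e0 * B2 * (A0 * B2 - A2 * B0)"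
    using E2 pos unfolding m0 m1 by (simp add: field_simps)
  have F2: "e0 * B2 * (A0 * B1 - A1 * B0) = e1 * B0 * (A0 * B2 - A2 * B0)"
    using E3 pos unfolding m0 m1 by (simp add: field_simps)
  define A B C where ABC: "A = A0 * B1 - A1 * B0" "B = A0 * B2 - A2 * B0" "C = A1 * B2 - A2 * B1"
  have F: "e1 * B0 * C = e0 * B2 * B" "e0 * B2 * A = e1 * B0 * B" using F1 F2 by (simp_all add: ABC)
  have "e1 * B0 * (A * C - B\<^sup>2) = 0" "e0 * B2 * (A * C - B\<^sup>2) = 0" using F by algebra+
  then have e10: "e1 = 0" and e00: "e0 = 0" using res pos by (simp_all add: ABC)
  have "m0 = 0" "m1 = 0" using e10 e00 m0 m1 by simp_all
  then show ?thesis using e10 e00 k kA e by (intro exI[of _ k]) simp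
qed

text \<open>Divided by \<open>s\<close>, the denominator has positive real part.\<close>

lemma biquad_denominator_nonzero:
  assumes "pos_coeffs Z" "Re s > 0"
  shows "of_real (b\<^sub>2 Z) * s^2 + of_real (b\<^sub>1 Z) * s + of_real (b\<^sub>0 Z) \<noteq> 0"
proof
  assume 0: "of_real (b\<^sub>2 Z) * s^2 + of_real (b\<^sub>1 Z) * s + of_real (b\<^sub>0 Z) = 0"
  have s0: "s \<noteq> 0" using assms by auto
  have "of_real (b\<^sub>2 Z) * s + of_real (b\<^sub>1 Z) + of_real (b\<^sub>0 Z) * inverse s
     = (of_real (b\<^sub>2 Z) * s^2 + of_real (b\<^sub>1 Z) * s + of_real (b\<^sub>0 Z)) / s"
    using s0 by (simp add: field_simps power2_eq_square)
  then have "Re (of_real (b\<^sub>2 Z) * s + of_real (b\<^sub>1 Z) + of_real (b\<^sub>0 Z) * inverse s) = 0"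
    using 0 by simp
  then have "b\<^sub>2 Z * Re s + b\<^sub>1 Z + b\<^sub>0 Z * Re (inverse s) = 0"
    by (simp del: inverse_complex.simps)
  moreover have "b\<^sub>2 Z * Re s > 0" "b\<^sub>0 Z * Re (inverse s) > 0" "b\<^sub>1 Z > 0"
    using assms Re_inverse_pos[OF assms(2)] by (auto simp: pos_coeffs_def simp del: inverse_complex.simps)
  ultimately show False by linarith
qed

text \<open>The power \<open>s ^ j\<close> clears the poles at zero that capacitors bring in. The assumption \<open>d2 \<ge> 0\<close> is there
  only to make the factor of proportionality positive.\<close>

lemma bridge_realizes_iff_coeffs:
  fixes n2 n1 n0 d2 d1 d0 :: real and j :: nat
  assumes Z: "pos_coeffs Z" "\<R> Z \<noteq> 0"
    and val: "element_value e1 > 0" "element_value e2 > 0" "element_value e3 > 0" "element_value e4 > 0"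
      "element_value e5 > 0"
    and d2: "d2 \<ge> 0"
    and num: "\<And>s. Re s > 0 \<Longrightarrow>
      bridge_num (impedance e1 s) (impedance e2 s) (impedance e3 s) (impedance e4 s) (impedance e5 s) * s ^ j
        = of_real n2 * s\<^sup>2 + of_real n1 * s + of_real n0"
    and den: "\<And>s. Re s > 0 \<Longrightarrow>
      bridge_den (impedance e1 s) (impedance e2 s) (impedance e3 s) (impedance e4 s) (impedance e5 s) * s ^ j
        = of_real d2 * s\<^sup>2 + of_real d1 * s + of_real d0"
  shows "bridge_realizes e1 e2 e3 e4 e5 Z \<longleftrightarrow>
    proportional Z n2 n1 n0 d2 d1 d0"
    (is "?L \<longleftrightarrow> ?R")
proof -
  let ?N = "\<lambda>s. bridge_num (impedance e1 s) (impedance e2 s) (impedance e3 s) (impedance e4 s) (impedance e5 s)"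
  let ?D = "\<lambda>s. bridge_den (impedance e1 s) (impedance e2 s) (impedance e3 s) (impedance e4 s) (impedance e5 s)"
  have D0: "?D s \<noteq> 0" if "Re s > 0" for s
    using val that by (intro bridge_den_nonzero impedance_Re_pos)
  have cancel: "?N s / ?D s = (of_real n2 * s\<^sup>2 + of_real n1 * s + of_real n0) / (of_real d2 * s\<^sup>2 + of_real d1 * s + of_real d0)"
    and dn: "of_real d2 * s\<^sup>2 + of_real d1 * s + of_real d0 \<noteq> 0" if "Re s > 0" for s
  proof -
    have "s \<noteq> 0" using that by auto
    then show "?N s / ?D s = (of_real n2 * s\<^sup>2 + of_real n1 * s + of_real n0) / (of_real d2 * s\<^sup>2 + of_real d1 * s + of_real d0)"
      "of_real d2 * s\<^sup>2 + of_real d1 * s + of_real d0 \<noteq> 0"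
      using D0[OF that] unfolding num[OF that, symmetric] den[OF that, symmetric] by simp_all
  qed
  have frac: "u * d = v * n" if "u / v = n / d" "v \<noteq> 0" "d \<noteq> 0" for u v n d :: complex
    using that by (simp add: field_simps)
  show ?thesis
  proof
    assume L: ?L
    have cross: "(a\<^sub>2 Z * x\<^sup>2 + a\<^sub>1 Z * x + a\<^sub>0 Z) * (d2 * x\<^sup>2 + d1 * x + d0)
       = (b\<^sub>2 Z * x\<^sup>2 + b\<^sub>1 Z * x + b\<^sub>0 Z) * (n2 * x\<^sup>2 + n1 * x + n0)" if "x > 0" for x :: real
    proof -
      have s: "Re (complex_of_real x) > 0" using that by simp
      let ?s = "complex_of_real x"
      have "biquad_fun Z ?s = (of_real n2 * ?s\<^sup>2 + of_real n1 * ?s + of_real n0) / (of_real d2 * ?s\<^sup>2 + of_real d1 * ?s + of_real d0)"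
        using L s cancel[OF s] by (simp add: bridge_realizes_def)
      then have "(of_real (a\<^sub>2 Z) * ?s^2 + of_real (a\<^sub>1 Z) * ?s + of_real (a\<^sub>0 Z)) * (of_real d2 * ?s\<^sup>2 + of_real d1 * ?s + of_real d0)
         = (of_real (b\<^sub>2 Z) * ?s^2 + of_real (b\<^sub>1 Z) * ?s + of_real (b\<^sub>0 Z)) * (of_real n2 * ?s\<^sup>2 + of_real n1 * ?s + of_real n0)"
        unfolding biquad_fun_def by (rule frac) (rule biquad_denominator_nonzero[OF Z(1) s] dn[OF s])+
      then have "complex_of_real ((a\<^sub>2 Z * x\<^sup>2 + a\<^sub>1 Z * x + a\<^sub>0 Z) * (d2 * x\<^sup>2 + d1 * x + d0))
         = complex_of_real ((b\<^sub>2 Z * x\<^sup>2 + b\<^sub>1 Z * x + b\<^sub>0 Z) * (n2 * x\<^sup>2 + n1 * x + n0))"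
        by (simp only: of_real_mult of_real_add of_real_power)
      then show ?thesis by (simp only: of_real_eq_iff)
    qed
    obtain k where k: "k * a\<^sub>2 Z = n2" "k * a\<^sub>1 Z = n1" "k * a\<^sub>0 Z = n0" "k * b\<^sub>2 Z = d2" "k * b\<^sub>1 Z = d1" "k * b\<^sub>0 Z = d0"
      using proportional_of_cross_product[of "a\<^sub>2 Z" "a\<^sub>0 Z" "b\<^sub>2 Z" "b\<^sub>0 Z" "b\<^sub>1 Z" "a\<^sub>1 Z", OF _ _ _ _ _ cross] Z
      unfolding pos_coeffs_def \<R>_def \<A>_def \<B>_def \<C>_def by auto
    have "k \<ge> 0" using k(4) d2 Z(1) by (metis pos_coeffs_def not_less zero_le_mult_iff less_le_not_le)
    moreover have "k \<noteq> 0" using dn[of 1] k by auto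
    ultimately have "k > 0" by simp
    then show ?R using k by (auto simp: proportional_def)
  next
    assume ?R
    then obtain k where k: "k > 0" "n2 = k * a\<^sub>2 Z" "n1 = k * a\<^sub>1 Z" "n0 = k * a\<^sub>0 Z" "d2 = k * b\<^sub>2 Z" "d1 = k * b\<^sub>1 Z" "d0 = k * b\<^sub>0 Z" by (auto simp: proportional_def)
    have "biquad_fun Z s = ?N s / ?D s" if "Re s > 0" for s
    proof -
      have "?N s / ?D s = (of_real k * (of_real (a\<^sub>2 Z) * s^2 + of_real (a\<^sub>1 Z) * s + of_real (a\<^sub>0 Z))) /
         (of_real k * (of_real (b\<^sub>2 Z) * s^2 + of_real (b\<^sub>1 Z) * s + of_real (b\<^sub>0 Z)))"
        unfolding cancel[OF that] k by (simp add: algebra_simps)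
      also have "\<dots> = biquad_fun Z s" using k(1) unfolding biquad_fun_def by simp
      finally show ?thesis by simp
    qed
    then show ?L using val by (simp add: bridge_realizes_def)
  qed
qed

section \<open>The canonical bridges\<close>

text \<open>In each of the next five predicates \<open>x\<close> is the inductance in the arm \<open>ap\<close>, and \<open>y\<close> is the second
  inductance or the inverse of the capacitance. The numbers \<open>p\<close>, \<open>q\<close>, \<open>r\<close> are the resistances on the
  remaining edges in the order \<open>pa'\<close>, \<open>aq\<close>, \<open>qa'\<close>, \<open>pq\<close>. The second reactive element lies in the
  opposite arm \<open>qa'\<close> (\<open>opp\<close>), in the diagonal \<open>pq\<close> (\<open>arm\<close>), or in \<open>pa'\<close>, in series along the branch
  through the vertex \<open>p\<close> (\<open>ser\<close>).\<close>

definition opp_LL :: "biquadratic \<Rightarrow> bool" where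
  "opp_LL Z \<longleftrightarrow> (\<exists>x y p q r. x > 0 \<and> y > 0 \<and> p > 0 \<and> q > 0 \<and> r > 0 \<and>
     proportional Z (x * y * (p + q + r)) (x * q * (r + p) + y * p * (r + q)) (p * q * r) (x * y) (x * (r + p) + y * (r + q)) (p * q + q * r + r * p))"

definition arm_LL :: "biquadratic \<Rightarrow> bool" where
  "arm_LL Z \<longleftrightarrow> (\<exists>x y p q r. x > 0 \<and> y > 0 \<and> p > 0 \<and> q > 0 \<and> r > 0 \<and>
     proportional Z (x * y * (q + r)) (y * p * (q + r) + x * (p * q + p * r + q * r)) (p * q * r) (x * y) (y * (p + q + r) + x * (p + r)) (q * (p + r)))"

definition opp_LC :: "biquadratic \<Rightarrow> bool" where
  "opp_LC Z \<longleftrightarrow> (\<exists>x y p q r. x > 0 \<and> y > 0 \<and> p > 0 \<and> q > 0 \<and> r > 0 \<and>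
     proportional Z (x * q * (r + p)) (x * y * (p + q + r) + p * q * r) (y * p * (r + q)) (x * (r + p)) (x * y + p * q + q * r + r * p) (y * (r + q)))"

definition ser_LC :: "biquadratic \<Rightarrow> bool" where
  "ser_LC Z \<longleftrightarrow> (\<exists>x y p q r. x > 0 \<and> y > 0 \<and> p > 0 \<and> q > 0 \<and> r > 0 \<and>
     proportional Z (x * (p * q + q * r + r * p)) (x * y * (p + q)) (y * (p * q + q * r + r * p)) (x * (r + q)) (x * y + p * q + q * r + r * p) (y * (r + p)))"

definition arm_LC :: "biquadratic \<Rightarrow> bool" where
  "arm_LC Z \<longleftrightarrow> (\<exists>x y p q r. x > 0 \<and> y > 0 \<and> p > 0 \<and> q > 0 \<and> r > 0 \<and>
     proportional Z (x * (p * q + p * r + q * r)) (x * y * (q + r) + p * q * r) (y * p * (q + r)) (x * (p + r)) (x * y + q * (p + r)) (y * (p + q + r)))"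

lemma opp_LL_iff:
  assumes "pos_coeffs Z" "\<R> Z \<noteq> 0"
  shows "opp_LL Z \<longleftrightarrow> (\<exists>x y p q r. bridge_realizes (Inductor x) (Resistor p) (Resistor q) (Inductor y) (Resistor r) Z)"
proof -
  have iff: "bridge_realizes (Inductor x) (Resistor p) (Resistor q) (Inductor y) (Resistor r) Z \<longleftrightarrow>
    proportional Z (x * y * (p + q + r)) (x * q * (r + p) + y * p * (r + q)) (p * q * r) (x * y) (x * (r + p) + y * (r + q)) (p * q + q * r + r * p)"
    if "x > 0" "y > 0" "p > 0" "q > 0" "r > 0" for x y p q r
    using that by (intro bridge_realizes_iff_coeffs[where j = 0, OF assms])
      (simp_all add: bridge_num_def bridge_den_def algebra_simps power2_eq_square)
  show ?thesis
  proof
    assume "opp_LL Z"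
    then show "\<exists>x y p q r. bridge_realizes (Inductor x) (Resistor p) (Resistor q) (Inductor y) (Resistor r) Z"
      unfolding opp_LL_def using iff by blast
  next
    assume "\<exists>x y p q r. bridge_realizes (Inductor x) (Resistor p) (Resistor q) (Inductor y) (Resistor r) Z"
    then obtain x y p q r where br: "bridge_realizes (Inductor x) (Resistor p) (Resistor q) (Inductor y) (Resistor r) Z" by blast
    then have pos: "x > 0" "y > 0" "p > 0" "q > 0" "r > 0" by (simp_all add: bridge_realizes_def)
    then show "opp_LL Z" unfolding opp_LL_def using iff[OF pos] pos br by blast
  qed
qed

lemma arm_LL_iff:
  assumes "pos_coeffs Z" "\<R> Z \<noteq> 0"
  shows "arm_LL Z \<longleftrightarrow> (\<exists>x y p q r. bridge_realizes (Inductor x) (Resistor p) (Resistor q) (Resistor r) (Inductor y) Z)"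
proof -
  have iff: "bridge_realizes (Inductor x) (Resistor p) (Resistor q) (Resistor r) (Inductor y) Z \<longleftrightarrow>
    proportional Z (x * y * (q + r)) (y * p * (q + r) + x * (p * q + p * r + q * r)) (p * q * r) (x * y) (y * (p + q + r) + x * (p + r)) (q * (p + r))"
    if "x > 0" "y > 0" "p > 0" "q > 0" "r > 0" for x y p q r
    using that by (intro bridge_realizes_iff_coeffs[where j = 0, OF assms])
      (simp_all add: bridge_num_def bridge_den_def algebra_simps power2_eq_square)
  show ?thesis
  proof
    assume "arm_LL Z"
    then show "\<exists>x y p q r. bridge_realizes (Inductor x) (Resistor p) (Resistor q) (Resistor r) (Inductor y) Z"
      unfolding arm_LL_def using iff by blast
  next
    assume "\<exists>x y p q r. bridge_realizes (Inductor x) (Resistor p) (Resistor q) (Resistor r) (Inductor y) Z"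
    then obtain x y p q r where br: "bridge_realizes (Inductor x) (Resistor p) (Resistor q) (Resistor r) (Inductor y) Z" by blast
    then have pos: "x > 0" "y > 0" "p > 0" "q > 0" "r > 0" by (simp_all add: bridge_realizes_def)
    then show "arm_LL Z" unfolding arm_LL_def using iff[OF pos] pos br by blast
  qed
qed

lemma opp_LC_iff:
  assumes "pos_coeffs Z" "\<R> Z \<noteq> 0"
  shows "opp_LC Z \<longleftrightarrow> (\<exists>x c p q r. bridge_realizes (Inductor x) (Resistor p) (Resistor q) (Capacitor c) (Resistor r) Z)"
proof -
  have iff: "bridge_realizes (Inductor x) (Resistor p) (Resistor q) (Capacitor (1 / y)) (Resistor r) Z \<longleftrightarrow>
    proportional Z (x * q * (r + p)) (x * y * (p + q + r) + p * q * r) (y * p * (r + q)) (x * (r + p)) (x * y + p * q + q * r + r * p) (y * (r + q))"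
    if "x > 0" "y > 0" "p > 0" "q > 0" "r > 0" for x y p q r
  proof (intro bridge_realizes_iff_coeffs[where j = 1, OF assms])
    fix s :: complex assume "Re s > 0"
    then have "s \<noteq> 0" by auto
    then show "bridge_num (impedance (Inductor x) s) (impedance (Resistor p) s) (impedance (Resistor q) s)
      (impedance (Capacitor (1 / y)) s) (impedance (Resistor r) s) * s ^ 1 = of_real (x * q * (r + p)) * s\<^sup>2
        + of_real (x * y * (p + q + r) + p * q * r) * s + of_real (y * p * (r + q))"
      "bridge_den (impedance (Inductor x) s) (impedance (Resistor p) s) (impedance (Resistor q) s)
      (impedance (Capacitor (1 / y)) s) (impedance (Resistor r) s) * s ^ 1 = of_real (x * (r + p)) * s\<^sup>2
        + of_real (x * y + p * q + q * r + r * p) * s + of_real (y * (r + q))"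
      by (simp_all add: bridge_num_def bridge_den_def field_simps power2_eq_square)
  qed (use that in simp_all)
  show ?thesis
  proof
    assume "opp_LC Z"
    then show "\<exists>x c p q r. bridge_realizes (Inductor x) (Resistor p) (Resistor q) (Capacitor c) (Resistor r) Z"
      unfolding opp_LC_def using iff by blast
  next
    assume "\<exists>x c p q r. bridge_realizes (Inductor x) (Resistor p) (Resistor q) (Capacitor c) (Resistor r) Z"
    then obtain x c p q r where br: "bridge_realizes (Inductor x) (Resistor p) (Resistor q) (Capacitor c) (Resistor r) Z" by blast
    then have pos: "x > 0" "1 / c > 0" "p > 0" "q > 0" "r > 0" by (simp_all add: bridge_realizes_def)
    have "bridge_realizes (Inductor x) (Resistor p) (Resistor q) (Capacitor (1 / (1 / c))) (Resistor r) Z" using br by simp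
    then show "opp_LC Z" unfolding opp_LC_def using iff[OF pos] pos by blast
  qed
qed

lemma ser_LC_iff:
  assumes "pos_coeffs Z" "\<R> Z \<noteq> 0"
  shows "ser_LC Z \<longleftrightarrow> (\<exists>x c p q r. bridge_realizes (Inductor x) (Capacitor c) (Resistor p) (Resistor q) (Resistor r) Z)"
proof -
  have iff: "bridge_realizes (Inductor x) (Capacitor (1 / y)) (Resistor p) (Resistor q) (Resistor r) Z \<longleftrightarrow>
    proportional Z (x * (p * q + q * r + r * p)) (x * y * (p + q)) (y * (p * q + q * r + r * p)) (x * (r + q)) (x * y + p * q + q * r + r * p) (y * (r + p))"
    if "x > 0" "y > 0" "p > 0" "q > 0" "r > 0" for x y p q r
  proof (intro bridge_realizes_iff_coeffs[where j = 1, OF assms])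
    fix s :: complex assume "Re s > 0"
    then have "s \<noteq> 0" by auto
    then show "bridge_num (impedance (Inductor x) s) (impedance (Capacitor (1 / y)) s) (impedance (Resistor p) s)
      (impedance (Resistor q) s) (impedance (Resistor r) s) * s ^ 1 = of_real (x * (p * q + q * r + r * p)) * s\<^sup>2
        + of_real (x * y * (p + q)) * s + of_real (y * (p * q + q * r + r * p))"
      "bridge_den (impedance (Inductor x) s) (impedance (Capacitor (1 / y)) s) (impedance (Resistor p) s)
      (impedance (Resistor q) s) (impedance (Resistor r) s) * s ^ 1 = of_real (x * (r + q)) * s\<^sup>2
        + of_real (x * y + p * q + q * r + r * p) * s + of_real (y * (r + p))"
      by (simp_all add: bridge_num_def bridge_den_def field_simps power2_eq_square)
  qed (use that in simp_all)
  show ?thesis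
  proof
    assume "ser_LC Z"
    then show "\<exists>x c p q r. bridge_realizes (Inductor x) (Capacitor c) (Resistor p) (Resistor q) (Resistor r) Z"
      unfolding ser_LC_def using iff by blast
  next
    assume "\<exists>x c p q r. bridge_realizes (Inductor x) (Capacitor c) (Resistor p) (Resistor q) (Resistor r) Z"
    then obtain x c p q r where br: "bridge_realizes (Inductor x) (Capacitor c) (Resistor p) (Resistor q) (Resistor r) Z" by blast
    then have pos: "x > 0" "1 / c > 0" "p > 0" "q > 0" "r > 0" by (simp_all add: bridge_realizes_def)
    have "bridge_realizes (Inductor x) (Capacitor (1 / (1 / c))) (Resistor p) (Resistor q) (Resistor r) Z" using br by simp
    then show "ser_LC Z" unfolding ser_LC_def using iff[OF pos] pos by blast
  qed
qed

lemma arm_LC_iff: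
  assumes "pos_coeffs Z" "\<R> Z \<noteq> 0"
  shows "arm_LC Z \<longleftrightarrow> (\<exists>x c p q r. bridge_realizes (Inductor x) (Resistor p) (Resistor q) (Resistor r) (Capacitor c) Z)"
proof -
  have iff: "bridge_realizes (Inductor x) (Resistor p) (Resistor q) (Resistor r) (Capacitor (1 / y)) Z \<longleftrightarrow>
    proportional Z (x * (p * q + p * r + q * r)) (x * y * (q + r) + p * q * r) (y * p * (q + r)) (x * (p + r)) (x * y + q * (p + r)) (y * (p + q + r))"
    if "x > 0" "y > 0" "p > 0" "q > 0" "r > 0" for x y p q r
  proof (intro bridge_realizes_iff_coeffs[where j = 1, OF assms])
    fix s :: complex assume "Re s > 0"
    then have "s \<noteq> 0" by auto
    then show "bridge_num (impedance (Inductor x) s) (impedance (Resistor p) s) (impedance (Resistor q) s)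
      (impedance (Resistor r) s) (impedance (Capacitor (1 / y)) s) * s ^ 1 = of_real (x * (p * q + p * r + q * r)) * s\<^sup>2
        + of_real (x * y * (q + r) + p * q * r) * s + of_real (y * p * (q + r))"
      "bridge_den (impedance (Inductor x) s) (impedance (Resistor p) s) (impedance (Resistor q) s)
      (impedance (Resistor r) s) (impedance (Capacitor (1 / y)) s) * s ^ 1 = of_real (x * (p + r)) * s\<^sup>2
        + of_real (x * y + q * (p + r)) * s + of_real (y * (p + q + r))"
      by (simp_all add: bridge_num_def bridge_den_def field_simps power2_eq_square)
  qed (use that in simp_all)
  show ?thesis
  proof
    assume "arm_LC Z"
    then show "\<exists>x c p q r. bridge_realizes (Inductor x) (Resistor p) (Resistor q) (Resistor r) (Capacitor c) Z"
      unfolding arm_LC_def using iff by blast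
  next
    assume "\<exists>x c p q r. bridge_realizes (Inductor x) (Resistor p) (Resistor q) (Resistor r) (Capacitor c) Z"
    then obtain x c p q r where br: "bridge_realizes (Inductor x) (Resistor p) (Resistor q) (Resistor r) (Capacitor c) Z" by blast
    then have pos: "x > 0" "1 / c > 0" "p > 0" "q > 0" "r > 0" by (simp_all add: bridge_realizes_def)
    have "bridge_realizes (Inductor x) (Resistor p) (Resistor q) (Resistor r) (Capacitor (1 / (1 / c))) Z" using br by simp
    then show "arm_LC Z" unfolding arm_LC_def using iff[OF pos] pos by blast
  qed
qed

text \<open>At zero frequency the two inductors short-circuit the terminals, so \<open>a\<^sub>0\<close> would vanish.\<close>

lemma no_ser_LL:
  assumes "pos_coeffs Z" "\<R> Z \<noteq> 0"
  shows "\<not> bridge_realizes (Inductor x) (Inductor y) (Resistor p) (Resistor q) (Resistor r) Z"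
proof
  assume br: "bridge_realizes (Inductor x) (Inductor y) (Resistor p) (Resistor q) (Resistor r) Z"
  then have "x > 0 \<and> y > 0 \<and> p > 0 \<and> q > 0 \<and> r > 0" by (simp add: bridge_realizes_def)
  then have "bridge_realizes (Inductor x) (Inductor y) (Resistor p) (Resistor q) (Resistor r) Z \<longleftrightarrow>
    proportional Z (x * y * (p + q)) ((x + y) * (r * (p + q) + p * q)) (0) (x * y) (x * (r + q) + y * (r + p)) (r * (p + q) + p * q)"
    by (intro bridge_realizes_iff_coeffs[where j = 0, OF assms])
      (simp_all add: bridge_num_def bridge_den_def algebra_simps power2_eq_square)
  then show False using br assms by (auto simp: pos_coeffs_def proportional_def)
qed


lemma pos_coeffs_freq_inv [simp]: "pos_coeffs (freq_inv Z) \<longleftrightarrow> pos_coeffs Z"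
  by (auto simp: pos_coeffs_def freq_inv_def)

lemma pos_coeffs_dual_inv [simp]: "pos_coeffs (dual_inv Z) \<longleftrightarrow> pos_coeffs Z"
  by (auto simp: pos_coeffs_def dual_inv_def)

lemma R_freq_inv [simp]: "\<R> (freq_inv Z) = \<R> Z"
  by (simp add: \<R>_def \<A>_def \<B>_def \<C>_def freq_inv_def algebra_simps power2_eq_square)

lemma R_dual_inv [simp]: "\<R> (dual_inv Z) = \<R> Z"
  by (simp add: \<R>_def \<A>_def \<B>_def \<C>_def dual_inv_def algebra_simps power2_eq_square)

lemma reactive_element: "reactive e \<Longrightarrow> (\<exists>x. e = Inductor x) \<or> (\<exists>c. e = Capacitor c)" by (cases e) auto
lemma resistive_element: "\<not> reactive e \<Longrightarrow> \<exists>R. e = Resistor R" by (cases e) auto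

text \<open>The ten pairs of edges fall into four orbits under the exchanges of the inner vertices and of the
  terminals. The dual merges the pairs in series along a branch with the pairs at a common terminal.\<close>

lemma reactive_pair_positions:
  assumes "bridge_realizable Z"
  shows "(\<exists>e f p q r. reactive e \<and> reactive f \<and> bridge_realizes e f (Resistor p) (Resistor q) (Resistor r) Z)
    \<or> (\<exists>e f p q r. reactive e \<and> reactive f \<and> bridge_realizes e f (Resistor p) (Resistor q) (Resistor r) (dual_inv Z))
    \<or> (\<exists>e f p q r. reactive e \<and> reactive f \<and> bridge_realizes e (Resistor p) (Resistor q) f (Resistor r) Z)
    \<or> (\<exists>e f p q r. reactive e \<and> reactive f \<and> bridge_realizes e (Resistor p) (Resistor q) (Resistor r) f Z)"
    (is "?S Z \<or> ?S (dual_inv Z) \<or> ?O \<or> ?A")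
proof -
  obtain e1 e2 e3 e4 e5 where br: "bridge_realizes e1 e2 e3 e4 e5 Z"
    and two: "of_bool (reactive e1) + of_bool (reactive e2) + of_bool (reactive e3) + of_bool (reactive e4)
        + of_bool (reactive e5) = (2::nat)" using assms unfolding bridge_realizable_def by blast
  note T = bridge_realizes_swap_terminals and I = bridge_realizes_swap_inner
  have S: "?S Z'" if "bridge_realizes f1 f2 f3 f4 f5 Z'" "reactive f1" "reactive f2" "\<not> reactive f3" "\<not> reactive f4" "\<not> reactive f5"
    for f1 f2 f3 f4 f5 Z' using that resistive_element by metis
  have D: "?S (dual_inv Z)" if "bridge_realizes f1 f2 f3 f4 f5 Z" "reactive f1" "reactive f3" "\<not> reactive f2" "\<not> reactive f4" "\<not> reactive f5"
    for f1 f2 f3 f4 f5 using S[OF bridge_realizes_dual_inv[OF that(1)]] that(2-) by (simp add: reactive_dual_inv)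
  have O: ?O if "bridge_realizes f1 f2 f3 f4 f5 Z" "reactive f1" "reactive f4" "\<not> reactive f2" "\<not> reactive f3" "\<not> reactive f5"
    for f1 f2 f3 f4 f5 using that resistive_element by metis
  have A: ?A if "bridge_realizes f1 f2 f3 f4 f5 Z" "reactive f1" "reactive f5" "\<not> reactive f2" "\<not> reactive f3" "\<not> reactive f4"
    for f1 f2 f3 f4 f5 using that resistive_element by metis
  consider "reactive e1" "reactive e2" "\<not> reactive e3" "\<not> reactive e4" "\<not> reactive e5"
    | "reactive e1" "\<not> reactive e2" "reactive e3" "\<not> reactive e4" "\<not> reactive e5"
    | "reactive e1" "\<not> reactive e2" "\<not> reactive e3" "reactive e4" "\<not> reactive e5"
    | "reactive e1" "\<not> reactive e2" "\<not> reactive e3" "\<not> reactive e4" "reactive e5"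
    | "\<not> reactive e1" "reactive e2" "reactive e3" "\<not> reactive e4" "\<not> reactive e5"
    | "\<not> reactive e1" "reactive e2" "\<not> reactive e3" "reactive e4" "\<not> reactive e5"
    | "\<not> reactive e1" "reactive e2" "\<not> reactive e3" "\<not> reactive e4" "reactive e5"
    | "\<not> reactive e1" "\<not> reactive e2" "reactive e3" "reactive e4" "\<not> reactive e5"
    | "\<not> reactive e1" "\<not> reactive e2" "reactive e3" "\<not> reactive e4" "reactive e5"
    | "\<not> reactive e1" "\<not> reactive e2" "\<not> reactive e3" "reactive e4" "reactive e5"
    using two by (cases "reactive e1"; cases "reactive e2"; cases "reactive e3"; cases "reactive e4"; cases "reactive e5") simp_all
  then show ?thesis
  proof cases
    case 1 show ?thesis using S[OF br] 1 by blast
  next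
    case 2 show ?thesis using D[OF br] 2 by blast
  next
    case 3 show ?thesis using O[OF br] 3 by blast
  next
    case 4 show ?thesis using A[OF br] 4 by blast
  next
    case 5 show ?thesis using O[OF T[OF br]] 5 by blast
  next
    case 6 show ?thesis using D[OF T[OF br]] 6 by blast
  next
    case 7 show ?thesis using A[OF T[OF br]] 7 by blast
  next
    case 8 show ?thesis using S[OF I[OF br]] 8 by blast
  next
    case 9 show ?thesis using A[OF I[OF br]] 9 by blast
  next
    case 10 show ?thesis using A[OF T[OF I[OF br]]] 10 by blast
  qed
qed

lemma ser_pair_types:
  assumes Z: "pos_coeffs Z" "\<R> Z \<noteq> 0" and ef: "reactive e" "reactive f"
    and br: "bridge_realizes e f (Resistor p) (Resistor q) (Resistor r) Z"
  shows "ser_LC Z"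
proof -
  have inv: "bridge_realizes (element_freq_inv e) (element_freq_inv f) (Resistor p) (Resistor q) (Resistor r) (freq_inv Z)"
    using bridge_realizes_freq_inv[OF br] by simp
  have Z': "pos_coeffs (freq_inv Z)" "\<R> (freq_inv Z) \<noteq> 0" using Z by simp_all
  consider x y where "e = Inductor x" "f = Inductor y" | x y where "e = Capacitor x" "f = Capacitor y"
    | x y where "e = Inductor x" "f = Capacitor y" | x y where "e = Capacitor x" "f = Inductor y"
    using ef[THEN reactive_element] by blast
  then show ?thesis
  proof cases
    case 1 then show ?thesis using br no_ser_LL[OF Z] by blast
  next
    case 2 then show ?thesis using inv no_ser_LL[OF Z'] by (auto simp only: element_freq_inv.simps)
  next
    case 3 then show ?thesis using br ser_LC_iff[OF Z] by blast
  next
    case 4 then show ?thesis using bridge_realizes_swap_terminals[OF br] ser_LC_iff[OF Z] by blast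
  qed
qed

lemma opp_pair_types:
  assumes Z: "pos_coeffs Z" "\<R> Z \<noteq> 0" and ef: "reactive e" "reactive f"
    and br: "bridge_realizes e (Resistor p) (Resistor q) f (Resistor r) Z"
  shows "opp_LL Z \<or> opp_LL (freq_inv Z) \<or> opp_LC Z"
proof -
  have inv: "bridge_realizes (element_freq_inv e) (Resistor p) (Resistor q) (element_freq_inv f) (Resistor r) (freq_inv Z)"
    using bridge_realizes_freq_inv[OF br] by simp
  have Z': "pos_coeffs (freq_inv Z)" "\<R> (freq_inv Z) \<noteq> 0" using Z by simp_all
  consider x y where "e = Inductor x" "f = Inductor y" | x y where "e = Capacitor x" "f = Capacitor y"
    | x y where "e = Inductor x" "f = Capacitor y" | x y where "e = Capacitor x" "f = Inductor y"
    using ef[THEN reactive_element] by blast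
  then show ?thesis
  proof cases
    case 1 then show ?thesis using br opp_LL_iff[OF Z] by blast
  next
    case 2 
    then have "bridge_realizes (Inductor (1 / x)) (Resistor p) (Resistor q) (Inductor (1 / y)) (Resistor r) (freq_inv Z)" using inv by simp
    then show ?thesis using opp_LL_iff[OF Z'] by blast
  next
    case 3 then show ?thesis using br opp_LC_iff[OF Z] by blast
  next
    case 4 then show ?thesis
      using bridge_realizes_swap_inner[OF bridge_realizes_swap_terminals[OF br]] opp_LC_iff[OF Z] by blast
  qed
qed

lemma arm_pair_types:
  assumes Z: "pos_coeffs Z" "\<R> Z \<noteq> 0" and ef: "reactive e" "reactive f"
    and br: "bridge_realizes e (Resistor p) (Resistor q) (Resistor r) f Z"
  shows "arm_LL Z \<or> arm_LL (freq_inv Z) \<or> arm_LC Z \<or> arm_LC (freq_inv Z)"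
proof -
  have inv: "bridge_realizes (element_freq_inv e) (Resistor p) (Resistor q) (Resistor r) (element_freq_inv f) (freq_inv Z)"
    using bridge_realizes_freq_inv[OF br] by simp
  have Z': "pos_coeffs (freq_inv Z)" "\<R> (freq_inv Z) \<noteq> 0" using Z by simp_all
  consider x y where "e = Inductor x" "f = Inductor y" | x y where "e = Capacitor x" "f = Capacitor y"
    | x y where "e = Inductor x" "f = Capacitor y" | x y where "e = Capacitor x" "f = Inductor y"
    using ef[THEN reactive_element] by blast
  then show ?thesis
  proof cases
    case 1 then show ?thesis using br arm_LL_iff[OF Z] by blast
  next
    case 2 
    then have "bridge_realizes (Inductor (1 / x)) (Resistor p) (Resistor q) (Resistor r) (Inductor (1 / y)) (freq_inv Z)" using inv by simp
    then show ?thesis using arm_LL_iff[OF Z'] by blast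
  next
    case 3 then show ?thesis using br arm_LC_iff[OF Z] by blast
  next
    case 4 
    then have "bridge_realizes (Inductor (1 / x)) (Resistor p) (Resistor q) (Resistor r) (Capacitor (1 / y)) (freq_inv Z)" using inv by simp
    then show ?thesis using arm_LC_iff[OF Z'] by blast
  qed
qed

text \<open>Only series pairs need the term \<open>dual_inv\<close>, and only pairs of the same kind and the arm-diagonal
  pairs need \<open>freq_inv\<close>: every other form is mapped to itself by the symmetry, up to the exchanges of vertices.\<close>

theorem bridge_realizable_iff:
  assumes Z: "pos_coeffs Z" "\<R> Z \<noteq> 0"
  shows "bridge_realizable Z \<longleftrightarrow> opp_LL Z \<or> opp_LL (freq_inv Z) \<or> arm_LL Z \<or> arm_LL (freq_inv Z) \<or>
    opp_LC Z \<or> ser_LC Z \<or> ser_LC (dual_inv Z) \<or> arm_LC Z \<or> arm_LC (freq_inv Z)" (is "_ \<longleftrightarrow> ?R")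
proof
  have Zd: "pos_coeffs (dual_inv Z)" "\<R> (dual_inv Z) \<noteq> 0" using Z by simp_all
  assume "bridge_realizable Z"
  from reactive_pair_positions[OF this] show ?R
    by (elim disjE exE conjE)
      (blast dest: ser_pair_types[OF Z] ser_pair_types[OF Zd] opp_pair_types[OF Z] arm_pair_types[OF Z])+
next
  have LL: "bridge_realizable W" if "opp_LL W \<or> arm_LL W \<or> opp_LC W \<or> ser_LC W \<or> arm_LC W" "pos_coeffs W" "\<R> W \<noteq> 0" for W
    using that(1) unfolding opp_LL_iff[OF that(2,3)] arm_LL_iff[OF that(2,3)] opp_LC_iff[OF that(2,3)]
      ser_LC_iff[OF that(2,3)] arm_LC_iff[OF that(2,3)]
  proof (elim disjE exE)
  qed (unfold bridge_realizable_def, (intro exI conjI, assumption, simp)+)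
  assume ?R
  then show "bridge_realizable Z"
    using LL[of Z] LL[of "freq_inv Z"] LL[of "dual_inv Z"] Z
    unfolding bridge_realizable_freq_inv bridge_realizable_dual_inv by auto
qed

section \<open>Necessary conditions\<close>

text \<open>Up to factors whose sign is known, the first two are the discriminants of the quadratic equations to
  which the bridges \<open>opp_LL\<close> and \<open>arm_LL\<close> lead, and the third is the linear coefficient of the quadratic
  equation for the resistance \<open>r\<close> of \<open>arm_LC\<close>.\<close>

definition opp_disc :: "biquadratic \<Rightarrow> real" where
  "opp_disc Z = \<R> Z - 4 * a\<^sub>0 Z * b\<^sub>2 Z * (a\<^sub>1 Z * b\<^sub>1 Z + 2 * \<B> Z)"

definition arm_disc :: "biquadratic \<Rightarrow> real" where
  "arm_disc Z = \<R> Z - 4 * a\<^sub>0 Z * a\<^sub>2 Z * b\<^sub>0 Z * b\<^sub>2 Z"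

definition arm_LC_linear_coeff :: "biquadratic \<Rightarrow> real" where
  "arm_LC_linear_coeff Z = \<R> Z - 2 * a\<^sub>0 Z * b\<^sub>2 Z * \<B> Z"

lemmas biquad_invariants = \<R>_def \<A>_def \<B>_def \<C>_def \<D>\<^sub>a_def \<D>\<^sub>b_def \<E>\<^sub>a_def \<E>\<^sub>b_def

lemma proportional_invariants:
  assumes "proportional Z n2 n1 n0 d2 d1 d0"
  obtains k where "k > 0" "\<B> (Biquadratic n2 n1 n0 d2 d1 d0) = k^2 * \<B> Z"
    "\<R> (Biquadratic n2 n1 n0 d2 d1 d0) = k^4 * \<R> Z"
    "opp_disc (Biquadratic n2 n1 n0 d2 d1 d0) = k^4 * opp_disc Z"
    "arm_disc (Biquadratic n2 n1 n0 d2 d1 d0) = k^4 * arm_disc Z"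
    "arm_LC_linear_coeff (Biquadratic n2 n1 n0 d2 d1 d0) = k^4 * arm_LC_linear_coeff Z"
    "\<D>\<^sub>b (Biquadratic n2 n1 n0 d2 d1 d0) = k^3 * \<D>\<^sub>b Z"
    "\<E>\<^sub>a (Biquadratic n2 n1 n0 d2 d1 d0) = k^3 * \<E>\<^sub>a Z"
proof -
  obtain k where "k > 0" and k: "n2 = k * a\<^sub>2 Z" "n1 = k * a\<^sub>1 Z" "n0 = k * a\<^sub>0 Z" "d2 = k * b\<^sub>2 Z" "d1 = k * b\<^sub>1 Z" "d0 = k * b\<^sub>0 Z"
    using assms by (auto simp: proportional_def)
  show thesis
    by (rule that[OF \<open>k > 0\<close>])
      (simp_all add: k biquad_invariants opp_disc_def arm_disc_def arm_LC_linear_coeff_def algebra_simps power2_eq_square power3_eq_cube power4_eq_xxxx)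
qed

text \<open>Both \<open>\<R>\<close> and the discriminant are \<open>x y\<close> times a square.\<close>

lemma opp_LL_necessary:
  assumes "opp_LL Z"
  shows "\<B> Z < 0" "\<R> Z \<ge> 0" "opp_disc Z \<ge> 0"
proof -
  obtain x y p q r where pos: "x > 0" "y > 0" "p > 0" "q > 0" "r > 0" and
    pr: "proportional Z (x * y * (p + q + r)) (x * q * (r + p) + y * p * (r + q)) (p * q * r)
       (x * y) (x * (r + p) + y * (r + q)) (p * q + q * r + r * p)"
    using assms unfolding opp_LL_def by blast
  let ?W = "Biquadratic (x * y * (p + q + r)) (x * q * (r + p) + y * p * (r + q)) (p * q * r)
       (x * y) (x * (r + p) + y * (r + q)) (p * q + q * r + r * p)"
  obtain k where k: "k > 0" "\<B> ?W = k^2 * \<B> Z" "\<R> ?W = k^4 * \<R> Z" "opp_disc ?W = k^4 * opp_disc Z"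
    using proportional_invariants[OF pr] by metis
  have B: "\<B> ?W = - (x * y * (p + q) * (q + r) * (r + p))"
    by (simp add: biquad_invariants algebra_simps)
  have R: "\<R> ?W = x * y * (x * q * (p + r)^2 - y * p * (q + r)^2)^2"
    by (simp add: biquad_invariants) algebra
  have Q: "opp_disc ?W = x * y * (x * q * (p + r) * (p - r) - y * p * (q + r) * (q - r))^2"
    unfolding opp_disc_def R B by simp algebra
  have "k^2 * \<B> Z < 0" using pos by (simp add: B flip: k(2))
  then show "\<B> Z < 0" using k(1) by (simp add: mult_less_0_iff)
  have "k^4 * \<R> Z \<ge> 0" using pos by (simp add: R flip: k(3))
  then show "\<R> Z \<ge> 0" using k(1) by (simp add: zero_le_mult_iff)
  have "k^4 * opp_disc Z \<ge> 0" using pos by (simp add: Q flip: k(4))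
  then show "opp_disc Z \<ge> 0" using k(1) by (simp add: zero_le_mult_iff)
qed

lemma arm_LL_necessary:
  assumes "arm_LL Z"
  shows "\<B> Z < 0" "\<R> Z \<ge> 0" "arm_disc Z \<ge> 0"
proof -
  obtain x y p q r where pos: "x > 0" "y > 0" "p > 0" "q > 0" "r > 0" and
    pr: "proportional Z (x * y * (q + r)) (y * p * (q + r) + x * (p * q + p * r + q * r)) (p * q * r)
     (x * y) (y * (p + q + r) + x * (p + r)) (q * (p + r))"
    using assms unfolding arm_LL_def by blast
  let ?W = "Biquadratic (x * y * (q + r)) (y * p * (q + r) + x * (p * q + p * r + q * r)) (p * q * r)
     (x * y) (y * (p + q + r) + x * (p + r)) (q * (p + r))"
  obtain k where k: "k > 0" "\<B> ?W = k^2 * \<B> Z" "\<R> ?W = k^4 * \<R> Z" "arm_disc ?W = k^4 * arm_disc Z"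
    using proportional_invariants[OF pr] by metis
  have B: "\<B> ?W = - (x * y * q * (p * q + q * r + r * r))"
    by (simp add: biquad_invariants algebra_simps)
  have R: "\<R> ?W = x * y * q^2 * (y * p * (q + r) + x * r * (p + r))^2"
    by (simp add: biquad_invariants) algebra
  have Q: "arm_disc ?W = x * y * q^2 * (y * p * (q + r) - x * r * (p + r))^2"
    unfolding arm_disc_def R by simp algebra
  have "k^2 * \<B> Z < 0" using pos by (simp add: B add_pos_pos flip: k(2))
  then show "\<B> Z < 0" using k(1) by (simp add: mult_less_0_iff)
  have "k^4 * \<R> Z \<ge> 0" using pos by (simp add: R flip: k(3))
  then show "\<R> Z \<ge> 0" using k(1) by (simp add: zero_le_mult_iff)
  have "k^4 * arm_disc Z \<ge> 0" using pos by (simp add: Q flip: k(4))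
  then show "arm_disc Z \<ge> 0" using k(1) by (simp add: zero_le_mult_iff)
qed

text \<open>With \<open>g = x y\<close>, the sign of \<open>g - p q\<close> decides which of the two quantities is positive. At
  \<open>g = p q\<close>, where \<open>\<R> = 0\<close>, both are, because \<open>p < q\<close> when \<open>\<B> < 0\<close>; \<open>\<D>\<^sub>b\<close> then stays positive for
  larger \<open>g\<close> and \<open>\<E>\<^sub>a\<close> for smaller \<open>g\<close>.\<close>

lemma opp_LC_necessary:
  assumes "opp_LC Z"
  shows "\<R> Z \<le> 0" "\<B> Z < 0 \<Longrightarrow> \<D>\<^sub>b Z > 0 \<or> \<E>\<^sub>a Z > 0"
proof -
  obtain x y p q r where pos: "x > 0" "y > 0" "p > 0" "q > 0" "r > 0" and
    pr: "proportional Z (x * q * (r + p)) (x * y * (p + q + r) + p * q * r) (y * p * (r + q))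
      (x * (r + p)) (x * y + p * q + q * r + r * p) (y * (r + q))"
    using assms unfolding opp_LC_def by blast
  let ?W = "Biquadratic (x * q * (r + p)) (x * y * (p + q + r) + p * q * r) (y * p * (r + q))
      (x * (r + p)) (x * y + p * q + q * r + r * p) (y * (r + q))"
  obtain k where k: "k > 0" "\<B> ?W = k^2 * \<B> Z" "\<R> ?W = k^4 * \<R> Z" "\<D>\<^sub>b ?W = k^3 * \<D>\<^sub>b Z" "\<E>\<^sub>a ?W = k^3 * \<E>\<^sub>a Z"
    using proportional_invariants[OF pr] by metis
  define g where "g = x * y"
  have g: "g > 0" using pos by (simp add: g_def)
  have B: "\<B> ?W = x * y * (r + p) * (r + q) * (p - q)"
    by (simp add: biquad_invariants algebra_simps)
  have R: "\<R> ?W = - (g * (r + p)^2 * (r + q)^2 * (g - p * q)^2)"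
    by (simp add: biquad_invariants g_def) algebra
  have D: "\<D>\<^sub>b ?W = y * (q + r)^2 * (g^2 + 2 * r * p * g - p^2 * (p * q + r * p + r * q))"
    by (simp add: biquad_invariants g_def) algebra
  have E: "\<E>\<^sub>a ?W = x * (p + r)^2 * (- (g^2) * (p + q + r) + 2 * p * q^2 * g + p * q^3 * r)"
    by (simp add: biquad_invariants g_def) algebra
  have "k^4 * \<R> Z \<le> 0" using g by (simp add: R flip: k(3))
  then show "\<R> Z \<le> 0" using k(1) by (simp add: mult_le_0_iff)
  assume "\<B> Z < 0"
  then have "k^2 * \<B> Z < 0" using k(1) by (simp add: mult_less_0_iff)
  then have pq: "p < q" using pos unfolding k(2)[symmetric] B by (simp add: mult_less_0_iff zero_less_mult_iff)
  show "\<D>\<^sub>b Z > 0 \<or> \<E>\<^sub>a Z > 0"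
  proof (cases "g \<ge> p * q")
    case True
    have "g^2 \<ge> (p * q)^2" using True pos by (intro power_mono) auto
    moreover have "2 * r * p * g \<ge> 2 * r * p * (p * q)" using True pos by (intro mult_left_mono) auto
    moreover have "(p * q)^2 + 2 * r * p * (p * q) - p^2 * (p * q + r * p + r * q) = p^2 * (q + r) * (q - p)"
      by (simp add: algebra_simps power2_eq_square)
    moreover have "p^2 * (q + r) * (q - p) > 0" using pq pos by simp
    ultimately have "g^2 + 2 * r * p * g - p^2 * (p * q + r * p + r * q) > 0" by linarith
    then have "k^3 * \<D>\<^sub>b Z > 0" unfolding k(4)[symmetric] D using pos by simp
    then show ?thesis using k(1) by (simp add: zero_less_mult_iff)
  next
    case False
    then have gl: "g < p * q" by simp
    \<comment> \<open>A concave quadratic in \<open>g\<close>, compared with its chord from \<open>0\<close> to \<open>p q\<close>.\<close>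
    have "p * q * (- (g^2) * (p + q + r) + 2 * p * q^2 * g + p * q^3 * r)
        = (p * q - g) * (p * q^3 * r) + g * (p * q^2 * (q - p) * (p + r)) + (p + q + r) * g * (p * q - g) * (p * q)"
      by algebra
    moreover have "\<dots> > 0" using pos g gl pq by (intro add_pos_pos mult_pos_pos) auto
    ultimately have "0 < p * q * (- (g^2) * (p + q + r) + 2 * p * q^2 * g + p * q^3 * r)" by simp
    then have "- (g^2) * (p + q + r) + 2 * p * q^2 * g + p * q^3 * r > 0"
      by (rule zero_less_mult_pos) (use pos in simp)
    then have "k^3 * \<E>\<^sub>a Z > 0" unfolding k(5)[symmetric] E using pos by simp
    then show ?thesis using k(1) by (simp add: zero_less_mult_iff)
  qed
qed


text \<open>Again the zero of \<open>\<R>\<close>, now at \<open>g p q = S\<^sup>2\<close>, separates the range of \<open>g\<close> on which \<open>\<E>\<^sub>a > 0\<close> is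
  certain from the one on which \<open>\<D>\<^sub>b > 0\<close> is.\<close>

lemma ser_LC_necessary:
  assumes "ser_LC Z"
  shows "\<R> Z \<le> 0" "\<B> Z < 0 \<Longrightarrow> \<D>\<^sub>b Z > 0 \<or> \<E>\<^sub>a Z > 0"
proof -
  obtain x y p q r where pos: "x > 0" "y > 0" "p > 0" "q > 0" "r > 0" and
    pr: "proportional Z (x * (p * q + q * r + r * p)) (x * y * (p + q)) (y * (p * q + q * r + r * p))
      (x * (r + q)) (x * y + p * q + q * r + r * p) (y * (r + p))"
    using assms unfolding ser_LC_def by blast
  let ?W = "Biquadratic (x * (p * q + q * r + r * p)) (x * y * (p + q)) (y * (p * q + q * r + r * p))
      (x * (r + q)) (x * y + p * q + q * r + r * p) (y * (r + p))"
  obtain k where k: "k > 0" "\<B> ?W = k^2 * \<B> Z" "\<R> ?W = k^4 * \<R> Z" "\<D>\<^sub>b ?W = k^3 * \<D>\<^sub>b Z" "\<E>\<^sub>a ?W = k^3 * \<E>\<^sub>a Z"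
    using proportional_invariants[OF pr] by metis
  define g S where "g = x * y" and S_def: "S = p * q + q * r + r * p"
  have g: "g > 0" and S: "S > 0" using pos by (simp_all add: g_def S_def add_pos_pos)
  have B: "\<B> ?W = x * y * S * (q - p)"
    by (simp add: biquad_invariants S_def algebra_simps)
  have R: "\<R> ?W = - (g * (S^2 - g * p * q)^2)"
    by (simp add: biquad_invariants g_def S_def) algebra
  have D: "\<D>\<^sub>b ?W = y * (g^2 * p^2 - 2 * p * r * S * g - S^3)"
    by (simp add: biquad_invariants g_def S_def) algebra
  have E: "\<E>\<^sub>a ?W = x * g * q * (2 * S^2 - g * q * (p + q))"
    by (simp add: biquad_invariants g_def S_def) algebra
  have "k^4 * \<R> Z \<le> 0" using g by (simp add: R flip: k(3))
  then show "\<R> Z \<le> 0" using k(1) by (simp add: mult_le_0_iff)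
  assume "\<B> Z < 0"
  then have "k^2 * \<B> Z < 0" using k(1) by (simp add: mult_less_0_iff)
  then have pq: "q < p" using pos S unfolding k(2)[symmetric] B by (simp add: mult_less_0_iff zero_less_mult_iff)
  show "\<D>\<^sub>b Z > 0 \<or> \<E>\<^sub>a Z > 0"
  proof (cases "g * p * q \<le> S^2")
    case True
    have "g * q * q < g * p * q" using pq pos g by simp
    then have "2 * S^2 - g * q * (p + q) > 0" using True by (simp add: algebra_simps)
    then have "k^3 * \<E>\<^sub>a Z > 0" unfolding k(5)[symmetric] E using pos g by simp
    then show ?thesis using k(1) by (simp add: zero_less_mult_iff)
  next
    case False
    define u where "u = g * p * q - S^2"
    have u: "u > 0" using False by (simp add: u_def)
    have "q^2 * (g^2 * p^2 - 2 * p * r * S * g - S^3) = u^2 + 2 * S * (p * q + r * p) * u + S^3 * (p * q + r * p - q * r - q^2)"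
      unfolding u_def S_def by algebra
    moreover have "p * q + r * p - q * r - q^2 = (p - q) * (q + r)" by (simp add: algebra_simps power2_eq_square)
    moreover have "u^2 + 2 * S * (p * q + r * p) * u + S^3 * ((p - q) * (q + r)) > 0"
      using u S pos pq by (intro add_pos_pos mult_pos_pos zero_less_power) auto
    ultimately have "0 < q^2 * (g^2 * p^2 - 2 * p * r * S * g - S^3)" by simp
    then have "g^2 * p^2 - 2 * p * r * S * g - S^3 > 0"
      by (rule zero_less_mult_pos) (use pos in simp)
    then have "k^3 * \<D>\<^sub>b Z > 0" unfolding k(4)[symmetric] D using pos by simp
    then show ?thesis using k(1) by (simp add: zero_less_mult_iff)
  qed
qed

text \<open>The last claim rests on the identity \<open>T\<close> in the proof: \<open>arm_LC_linear_coeff\<close> is a combination of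
  \<open>- \<D>\<^sub>b\<close> and \<open>- \<E>\<^sub>a\<close> with positive coefficients.\<close>

lemma arm_LC_necessary:
  assumes "arm_LC Z"
  shows "\<B> Z < 0" "\<R> Z \<le> 0" "opp_disc Z \<le> 0"
    "\<D>\<^sub>b Z < 0 \<Longrightarrow> \<E>\<^sub>a Z < 0 \<Longrightarrow> arm_LC_linear_coeff Z > 0"
proof -
  obtain x y p q r where pos: "x > 0" "y > 0" "p > 0" "q > 0" "r > 0" and
    pr: "proportional Z (x * (p * q + p * r + q * r)) (x * y * (q + r) + p * q * r) (y * p * (q + r))
     (x * (p + r)) (x * y + q * (p + r)) (y * (p + q + r))"
    using assms unfolding arm_LC_def by blast
  let ?W = "Biquadratic (x * (p * q + p * r + q * r)) (x * y * (q + r) + p * q * r) (y * p * (q + r))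
     (x * (p + r)) (x * y + q * (p + r)) (y * (p + q + r))"
  obtain k where k: "k > 0" "\<B> ?W = k^2 * \<B> Z" "\<R> ?W = k^4 * \<R> Z" "opp_disc ?W = k^4 * opp_disc Z"
    "arm_LC_linear_coeff ?W = k^4 * arm_LC_linear_coeff Z" "\<D>\<^sub>b ?W = k^3 * \<D>\<^sub>b Z" "\<E>\<^sub>a ?W = k^3 * \<E>\<^sub>a Z"
    using proportional_invariants[OF pr] by metis
  have B: "\<B> ?W = - (x * y * q * ((q + r) * (p + r) + p * r))"
    by (simp add: biquad_invariants) algebra
  have R: "\<R> ?W = - (x * y * (x * y * r * (q + r) + p * q^2 * (p + r))^2)"
    by (simp add: biquad_invariants) algebra
  have Q: "opp_disc ?W = - (x * y * (x * y * (q + r) * (r + 2 * p) - p * q * (p + r) * (q + 2 * r))^2)"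
    unfolding opp_disc_def R B by simp algebra
  have D: "\<D>\<^sub>b ?W = y * ((x * y)^2 * (q + r)^2 - 2 * x * y * (q + r) * p * q * (p + r) - p^2 * q^3 * (p + r))"
    by (simp add: biquad_invariants) algebra
  have E: "\<E>\<^sub>a ?W = x * (- ((x * y)^2) * (q + r) * r^2 - 2 * p * q * r * (p + r) * (x * y * (q + r)) + p * q^3 * r * (p + r)^2)"
    by (simp add: biquad_invariants) algebra
  have T: "r * arm_LC_linear_coeff ?W = - (x * (p + r) * r^2 * \<D>\<^sub>b ?W) - (y * p * (q + r)) * \<E>\<^sub>a ?W"
    unfolding arm_LC_linear_coeff_def R B D E by simp algebra
  have "k^2 * \<B> Z < 0" using pos by (simp add: B add_pos_pos flip: k(2))
  then show "\<B> Z < 0" using k(1) by (simp add: mult_less_0_iff)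
  have "k^4 * \<R> Z \<le> 0" using pos by (simp add: R flip: k(3))
  then show "\<R> Z \<le> 0" using k(1) by (simp add: mult_le_0_iff)
  have "k^4 * opp_disc Z \<le> 0" using pos by (simp add: Q flip: k(4))
  then show "opp_disc Z \<le> 0" using k(1) by (simp add: mult_le_0_iff)
  assume DE: "\<D>\<^sub>b Z < 0" "\<E>\<^sub>a Z < 0"
  have DW: "\<D>\<^sub>b ?W < 0" "\<E>\<^sub>a ?W < 0" using DE k(1) unfolding k(6,7) by (simp_all add: mult_less_0_iff)
  have wts: "x * (p + r) * r^2 > 0" "y * p * (q + r) > 0" using pos by simp_all
  have "r * arm_LC_linear_coeff ?W > 0"
    using mult_pos_neg[OF wts(1) DW(1)] mult_pos_neg[OF wts(2) DW(2)] unfolding T by linarith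
  then have "k^4 * arm_LC_linear_coeff Z > 0" using pos by (simp add: zero_less_mult_iff flip: k(5))
  then show "arm_LC_linear_coeff Z > 0" using k(1) by (simp add: zero_less_mult_iff)
qed

section \<open>Regular biquadratic functions\<close>

lemma biquad_axis_denominator:
  assumes "pos_coeffs Z"
  shows "(b\<^sub>0 Z - b\<^sub>2 Z * t\<^sup>2)\<^sup>2 + (b\<^sub>1 Z * t)\<^sup>2 > 0"
proof (cases "t = 0")
  case False
  then have "(b\<^sub>1 Z * t)\<^sup>2 > 0" using assms by (simp add: pos_coeffs_def)
  then show ?thesis by (simp add: add_nonneg_pos)
qed (use assms in \<open>simp add: pos_coeffs_def\<close>)

text \<open>On the imaginary axis the real part is a quotient of quadratic polynomials in \<open>x = \<omega>\<^sup>2\<close>.\<close>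

definition axis_num :: "biquadratic \<Rightarrow> real \<Rightarrow> real" where
  "axis_num Z x = a\<^sub>2 Z * b\<^sub>2 Z * x\<^sup>2 + (a\<^sub>1 Z * b\<^sub>1 Z - a\<^sub>0 Z * b\<^sub>2 Z - a\<^sub>2 Z * b\<^sub>0 Z) * x + a\<^sub>0 Z * b\<^sub>0 Z"

definition axis_den :: "biquadratic \<Rightarrow> real \<Rightarrow> real" where
  "axis_den Z x = (b\<^sub>2 Z)\<^sup>2 * x\<^sup>2 + ((b\<^sub>1 Z)\<^sup>2 - 2 * b\<^sub>0 Z * b\<^sub>2 Z) * x + (b\<^sub>0 Z)\<^sup>2"

lemma axis_den_pos: "pos_coeffs Z \<Longrightarrow> axis_den Z (t\<^sup>2) > 0"
  using biquad_axis_denominator[of Z t] by (simp add: axis_den_def power2_eq_square algebra_simps)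

lemma Re_biquad_axis:
  assumes "pos_coeffs Z"
  shows "Re (biquad_fun Z (\<i> * of_real t)) = axis_num Z (t\<^sup>2) / axis_den Z (t\<^sup>2)"
proof -
  let ?p = "Complex (a\<^sub>0 Z - a\<^sub>2 Z * t\<^sup>2) (a\<^sub>1 Z * t)" and ?q = "Complex (b\<^sub>0 Z - b\<^sub>2 Z * t\<^sup>2) (b\<^sub>1 Z * t)"
  have "of_real (a\<^sub>2 Z) * (\<i> * of_real t)^2 + of_real (a\<^sub>1 Z) * (\<i> * of_real t) + of_real (a\<^sub>0 Z) = ?p"
    "of_real (b\<^sub>2 Z) * (\<i> * of_real t)^2 + of_real (b\<^sub>1 Z) * (\<i> * of_real t) + of_real (b\<^sub>0 Z) = ?q"
    by (simp_all add: complex_eq_iff power2_eq_square)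
  then have "biquad_fun Z (\<i> * of_real t) = ?p / ?q" by (simp add: biquad_fun_def)
  also have "Re \<dots> = ((a\<^sub>0 Z - a\<^sub>2 Z * t\<^sup>2) * (b\<^sub>0 Z - b\<^sub>2 Z * t\<^sup>2) + (a\<^sub>1 Z * t) * (b\<^sub>1 Z * t))
      / ((b\<^sub>0 Z - b\<^sub>2 Z * t\<^sup>2)\<^sup>2 + (b\<^sub>1 Z * t)\<^sup>2)"
    by (simp add: Re_divide)
  also have "\<dots> = axis_num Z (t\<^sup>2) / axis_den Z (t\<^sup>2)"
    by (rule arg_cong2[where f = "(/)"])
      (simp_all add: axis_num_def axis_den_def power2_eq_square algebra_simps)
  finally show ?thesis .
qed

lemma Re_axis_biquad:
  assumes "pos_coeffs Z"
  shows "Re_axis (biquad_fun Z) w = axis_num Z (w\<^sup>2) / axis_den Z (w\<^sup>2)"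
proof -
  have "((\<lambda>t. axis_num Z (t\<^sup>2) / axis_den Z (t\<^sup>2)) \<longlongrightarrow> axis_num Z (w\<^sup>2) / axis_den Z (w\<^sup>2)) (at w)"
    using axis_den_pos[OF assms, of w] unfolding axis_num_def axis_den_def
    by (intro tendsto_intros) auto
  then show ?thesis unfolding Re_axis_def Re_biquad_axis[OF assms]
    by (intro tendsto_Lim) auto
qed

text \<open>After division by \<open>t\<^sup>4\<close> the real part is a continuous function of \<open>1/t\<close> near zero.\<close>

lemma Re_axis_infinity_biquad:
  assumes "pos_coeffs Z"
  shows "Re_axis_infinity (biquad_fun Z) = a\<^sub>2 Z / b\<^sub>2 Z"
proof -
  let ?f = "\<lambda>t. axis_num Z (t\<^sup>2) / axis_den Z (t\<^sup>2)"
  let ?g = "\<lambda>u. (a\<^sub>2 Z * b\<^sub>2 Z + (a\<^sub>1 Z * b\<^sub>1 Z - a\<^sub>0 Z * b\<^sub>2 Z - a\<^sub>2 Z * b\<^sub>0 Z) * u\<^sup>2 + a\<^sub>0 Z * b\<^sub>0 Z * u^4) /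
     ((b\<^sub>2 Z)\<^sup>2 + ((b\<^sub>1 Z)\<^sup>2 - 2 * b\<^sub>0 Z * b\<^sub>2 Z) * u\<^sup>2 + (b\<^sub>0 Z)\<^sup>2 * u^4)"
  have b2: "b\<^sub>2 Z > 0" using assms by (simp add: pos_coeffs_def)
  have inv: "((\<lambda>t::real. inverse t) \<longlongrightarrow> 0) at_infinity" by (rule tendsto_inverse_0)
  have "((\<lambda>t. ?g (inverse t)) \<longlongrightarrow> ?g 0) at_infinity"
    using b2 by (intro tendsto_intros inv) auto
  moreover have "eventually (\<lambda>t::real. ?g (inverse t) = ?f t) at_infinity"
  proof -
    have eq: "?g (inverse t) = ?f t" if "t \<noteq> 0" for t
    proof -
      have n: "axis_num Z (t\<^sup>2) = t^4 * (a\<^sub>2 Z * b\<^sub>2 Z + (a\<^sub>1 Z * b\<^sub>1 Z - a\<^sub>0 Z * b\<^sub>2 Z - a\<^sub>2 Z * b\<^sub>0 Z) * (inverse t)\<^sup>2 + a\<^sub>0 Z * b\<^sub>0 Z * (inverse t)^4)"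
        using that by (simp add: axis_num_def field_simps power2_eq_square power4_eq_xxxx)
      have d: "axis_den Z (t\<^sup>2) = t^4 * ((b\<^sub>2 Z)\<^sup>2 + ((b\<^sub>1 Z)\<^sup>2 - 2 * b\<^sub>0 Z * b\<^sub>2 Z) * (inverse t)\<^sup>2 + (b\<^sub>0 Z)\<^sup>2 * (inverse t)^4)"
        using that by (simp add: axis_den_def field_simps power2_eq_square power4_eq_xxxx)
      show ?thesis unfolding n d using that by simp
    qed
    show ?thesis unfolding eventually_at_infinity
      by (rule exI[of _ 1]) (use eq in auto)
  qed
  ultimately have "(?f \<longlongrightarrow> ?g 0) at_infinity" by (simp add: tendsto_cong)
  moreover have "?g 0 = a\<^sub>2 Z / b\<^sub>2 Z" using b2 by (simp add: power2_eq_square)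
  ultimately have "(?f \<longlongrightarrow> a\<^sub>2 Z / b\<^sub>2 Z) at_infinity" by simp
  then show ?thesis unfolding Re_axis_infinity_def Re_biquad_axis[OF assms]
    by (intro tendsto_Lim trivial_limit_at_infinity)
qed

lemma quadratic_nonneg_iff:
  fixes u v :: real
  shows "(\<forall>x\<ge>0. x * (u * x + v) \<ge> 0) \<longleftrightarrow> u \<ge> 0 \<and> v \<ge> 0"
proof
  assume all: "\<forall>x\<ge>0. x * (u * x + v) \<ge> 0"
  then have lin: "u * x + v \<ge> 0" if "x > 0" for x
  proof -
    have "x * (u * x + v) \<ge> 0" using all that by simp
    then show ?thesis using that by (simp add: zero_le_mult_iff)
  qed
  have "v \<ge> 0"
  proof (rule ccontr)
    assume v: "\<not> v \<ge> 0"
    then have "u * (- v / (2 * (\<bar>u\<bar> + 1))) \<le> \<bar>u\<bar> * (- v / (2 * (\<bar>u\<bar> + 1)))"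
      by (intro mult_right_mono) (auto intro!: divide_nonpos_pos simp: field_simps)
    also have "\<dots> < - v"
    proof -
      have "(- v) * \<bar>u\<bar> \<ge> 0" using v by (intro mult_nonneg_nonneg) auto
      then have "\<bar>u\<bar> * (- v) < (- v) * (2 * (\<bar>u\<bar> + 1))" using v by (simp add: algebra_simps)
      then show ?thesis by (simp add: field_simps)
    qed
    finally have "u * (- v / (2 * (\<bar>u\<bar> + 1))) + v < 0" by simp
    moreover have "- v / (2 * (\<bar>u\<bar> + 1)) > 0" using v by (intro divide_pos_pos) auto
    ultimately show False using lin[of "- v / (2 * (\<bar>u\<bar> + 1))"] by linarith
  qed
  moreover have "u \<ge> 0"
  proof (rule ccontr)
    assume u: "\<not> u \<ge> 0"
    have "u * ((\<bar>v\<bar> + 1) / - u) + v = v - \<bar>v\<bar> - 1" using u by (simp add: field_simps)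
    moreover have "(\<bar>v\<bar> + 1) / - u > 0" using u by (intro divide_pos_pos) auto
    ultimately show False using lin[of "(\<bar>v\<bar> + 1) / - u"] by linarith
  qed
  ultimately show "u \<ge> 0 \<and> v \<ge> 0" by simp
next
  assume "u \<ge> 0 \<and> v \<ge> 0"
  then show "\<forall>x\<ge>0. x * (u * x + v) \<ge> 0" by simp
qed

lemma all_square_iff: "(\<forall>w::real. P (w\<^sup>2)) \<longleftrightarrow> (\<forall>x\<ge>0. P x)"
proof (intro iffI allI impI)
  fix x :: real assume "\<forall>w. P (w\<^sup>2)" "x \<ge> 0"
  then have "P ((sqrt x)\<^sup>2)" by blast
  then show "P x" using \<open>x \<ge> 0\<close> by simp
qed simp

text \<open>The difference \<open>Re Z(j\<omega>) - Z(0)\<close> has, up to a positive factor, the numerator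
  \<open>\<omega>\<^sup>2 (- b\<^sub>2 \<B> \<omega>\<^sup>2 + \<D>\<^sub>b)\<close>.\<close>

lemma axis_min_at_zero_iff:
  assumes "pos_coeffs Z"
  shows "(\<forall>w. Re_axis (biquad_fun Z) 0 \<le> Re_axis (biquad_fun Z) w) \<and> Re_axis (biquad_fun Z) 0 \<le> Re_axis_infinity (biquad_fun Z)
     \<longleftrightarrow> \<B> Z \<le> 0 \<and> \<D>\<^sub>b Z \<ge> 0"
proof -
  have pos: "a\<^sub>0 Z > 0" "b\<^sub>0 Z > 0" "b\<^sub>2 Z > 0" using assms by (auto simp: pos_coeffs_def)
  have Re0: "Re_axis (biquad_fun Z) 0 = a\<^sub>0 Z / b\<^sub>0 Z"
    using pos unfolding Re_axis_biquad[OF assms] by (simp add: axis_num_def axis_den_def power2_eq_square)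
  have "Re_axis (biquad_fun Z) 0 \<le> Re_axis (biquad_fun Z) w \<longleftrightarrow> w\<^sup>2 * ((- b\<^sub>2 Z * \<B> Z) * w\<^sup>2 + \<D>\<^sub>b Z) \<ge> 0" for w
  proof -
    have "Re_axis (biquad_fun Z) 0 \<le> Re_axis (biquad_fun Z) w
       \<longleftrightarrow> a\<^sub>0 Z * axis_den Z (w\<^sup>2) \<le> b\<^sub>0 Z * axis_num Z (w\<^sup>2)"
      unfolding Re0 Re_axis_biquad[OF assms, of w] using axis_den_pos[OF assms, of w] pos by (simp add: field_simps)
    also have "\<dots> \<longleftrightarrow> b\<^sub>0 Z * axis_num Z (w\<^sup>2) - a\<^sub>0 Z * axis_den Z (w\<^sup>2) \<ge> 0" by simp
    also have "b\<^sub>0 Z * axis_num Z (w\<^sup>2) - a\<^sub>0 Z * axis_den Z (w\<^sup>2) = w\<^sup>2 * ((- b\<^sub>2 Z * \<B> Z) * w\<^sup>2 + \<D>\<^sub>b Z)"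
      unfolding axis_num_def axis_den_def \<B>_def \<D>\<^sub>b_def \<A>_def by algebra
    finally show ?thesis .
  qed
  then have "(\<forall>w. Re_axis (biquad_fun Z) 0 \<le> Re_axis (biquad_fun Z) w) \<longleftrightarrow> - b\<^sub>2 Z * \<B> Z \<ge> 0 \<and> \<D>\<^sub>b Z \<ge> 0"
    by (simp only: all_square_iff[of "\<lambda>x. x * ((- b\<^sub>2 Z * \<B> Z) * x + \<D>\<^sub>b Z) \<ge> 0"] quadratic_nonneg_iff)
  moreover have "- b\<^sub>2 Z * \<B> Z \<ge> 0 \<longleftrightarrow> \<B> Z \<le> 0" using pos by (simp add: mult_le_0_iff)
  moreover have "a\<^sub>0 Z / b\<^sub>0 Z \<le> a\<^sub>2 Z / b\<^sub>2 Z \<longleftrightarrow> \<B> Z \<le> 0" using pos by (simp add: \<B>_def field_simps)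
  ultimately show ?thesis unfolding Re0 Re_axis_infinity_biquad[OF assms] by blast
qed

text \<open>The difference \<open>Re Z(j\<omega>) - Z(\<infinity>)\<close> has, up to a positive factor, the numerator
  \<open>\<E>\<^sub>b \<omega>\<^sup>2 + b\<^sub>0 \<B>\<close>.\<close>

lemma axis_min_at_infinity_iff:
  assumes "pos_coeffs Z"
  shows "(\<forall>w. Re_axis_infinity (biquad_fun Z) \<le> Re_axis (biquad_fun Z) w) \<longleftrightarrow> \<B> Z \<ge> 0 \<and> \<E>\<^sub>b Z \<ge> 0"
proof -
  have pos: "a\<^sub>0 Z > 0" "b\<^sub>0 Z > 0" "b\<^sub>2 Z > 0" using assms by (auto simp: pos_coeffs_def)
  have "Re_axis_infinity (biquad_fun Z) \<le> Re_axis (biquad_fun Z) w \<longleftrightarrow> \<E>\<^sub>b Z * w\<^sup>2 + b\<^sub>0 Z * \<B> Z \<ge> 0" for w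
  proof -
    have "Re_axis_infinity (biquad_fun Z) \<le> Re_axis (biquad_fun Z) w
       \<longleftrightarrow> a\<^sub>2 Z * axis_den Z (w\<^sup>2) \<le> b\<^sub>2 Z * axis_num Z (w\<^sup>2)"
      unfolding Re_axis_infinity_biquad[OF assms] Re_axis_biquad[OF assms]
      using axis_den_pos[OF assms, of w] pos by (simp add: field_simps)
    also have "\<dots> \<longleftrightarrow> b\<^sub>2 Z * axis_num Z (w\<^sup>2) - a\<^sub>2 Z * axis_den Z (w\<^sup>2) \<ge> 0" by simp
    also have "b\<^sub>2 Z * axis_num Z (w\<^sup>2) - a\<^sub>2 Z * axis_den Z (w\<^sup>2) = \<E>\<^sub>b Z * w\<^sup>2 + b\<^sub>0 Z * \<B> Z"
      unfolding axis_num_def axis_den_def \<B>_def \<E>\<^sub>b_def \<C>_def by algebra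
    finally show ?thesis .
  qed
  then have "(\<forall>w. Re_axis_infinity (biquad_fun Z) \<le> Re_axis (biquad_fun Z) w) \<longleftrightarrow> (\<forall>x\<ge>0. \<E>\<^sub>b Z * x + b\<^sub>0 Z * \<B> Z \<ge> 0)"
    by (simp only: all_square_iff[of "\<lambda>x. \<E>\<^sub>b Z * x + b\<^sub>0 Z * \<B> Z \<ge> 0"])
  also have "\<dots> \<longleftrightarrow> \<E>\<^sub>b Z \<ge> 0 \<and> b\<^sub>0 Z * \<B> Z \<ge> 0"
  proof
    assume lin: "\<forall>x\<ge>0. \<E>\<^sub>b Z * x + b\<^sub>0 Z * \<B> Z \<ge> 0"
    then have "\<forall>x\<ge>0. x * (\<E>\<^sub>b Z * x + b\<^sub>0 Z * \<B> Z) \<ge> 0" by (blast intro: mult_nonneg_nonneg)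
    then show "\<E>\<^sub>b Z \<ge> 0 \<and> b\<^sub>0 Z * \<B> Z \<ge> 0" by (simp only: quadratic_nonneg_iff)
  qed (blast intro: add_nonneg_nonneg mult_nonneg_nonneg)
  also have "\<dots> \<longleftrightarrow> \<B> Z \<ge> 0 \<and> \<E>\<^sub>b Z \<ge> 0" using pos by (auto simp: zero_le_mult_iff)
  finally show ?thesis .
qed

lemma min_at_zero_or_infinity_iff:
  assumes "pos_coeffs Z"
  shows "min_at_zero_or_infinity (biquad_fun Z) \<longleftrightarrow> (\<B> Z \<le> 0 \<and> \<D>\<^sub>b Z \<ge> 0) \<or> (\<B> Z \<ge> 0 \<and> \<E>\<^sub>b Z \<ge> 0)"
  using axis_min_at_zero_iff[OF assms] axis_min_at_infinity_iff[OF assms]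
  unfolding min_at_zero_or_infinity_def by auto

definition recip :: "biquadratic \<Rightarrow> biquadratic" where
  "recip Z = Biquadratic (b\<^sub>2 Z) (b\<^sub>1 Z) (b\<^sub>0 Z) (a\<^sub>2 Z) (a\<^sub>1 Z) (a\<^sub>0 Z)"

lemma biquad_fun_recip: "biquad_fun (recip Z) = (\<lambda>s. inverse (biquad_fun Z s))"
  by (simp add: fun_eq_iff biquad_fun_def recip_def)

text \<open>For \<open>s = x + jy\<close> the numerator of \<open>Re Z(s)\<close> is that of \<open>Re Z(j\<omega>)\<close> at \<open>\<omega>\<^sup>2 = |s|\<^sup>2\<close> plus terms that
  are nonnegative for \<open>x > 0\<close>.\<close>

lemma positive_real_biquad:
  assumes Z: "pos_coeffs Z" and nonneg: "\<And>x. x \<ge> 0 \<Longrightarrow> axis_num Z x \<ge> 0"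
  shows "positive_real (biquad_fun Z)"
  unfolding positive_real_def
proof (intro conjI allI impI)
  let ?p = "[:a\<^sub>0 Z, a\<^sub>1 Z, a\<^sub>2 Z:]" and ?q = "[:b\<^sub>0 Z, b\<^sub>1 Z, b\<^sub>2 Z:]"
  have "?q \<noteq> 0" using Z by (simp add: pos_coeffs_def)
  moreover have "biquad_fun Z s = poly (map_poly of_real ?p) s / poly (map_poly of_real ?q) s" for s
    by (simp add: biquad_fun_def map_poly_pCons power2_eq_square algebra_simps)
  ultimately show "real_rational (biquad_fun Z)" unfolding real_rational_def by blast
next
  show "biquad_fun Z analytic_on {s. Re s > 0}"
    unfolding biquad_fun_def using biquad_denominator_nonzero[OF Z]
    by (intro analytic_intros) auto
next
  fix s :: complex assume s: "Re s > 0"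
  let ?p = "of_real (a\<^sub>2 Z) * s^2 + of_real (a\<^sub>1 Z) * s + of_real (a\<^sub>0 Z)"
  let ?q = "of_real (b\<^sub>2 Z) * s^2 + of_real (b\<^sub>1 Z) * s + of_real (b\<^sub>0 Z)"
  obtain x y where xy: "s = Complex x y" by (cases s)
  have x: "x > 0" using s xy by simp
  have pos: "a\<^sub>2 Z > 0" "a\<^sub>1 Z > 0" "a\<^sub>0 Z > 0" "b\<^sub>2 Z > 0" "b\<^sub>1 Z > 0" "b\<^sub>0 Z > 0"
    using Z by (auto simp: pos_coeffs_def)
  have "Re ?p * Re ?q + Im ?p * Im ?q = axis_num Z (x\<^sup>2 + y\<^sup>2)
     + x * ((a\<^sub>2 Z * b\<^sub>1 Z + a\<^sub>1 Z * b\<^sub>2 Z) * (x\<^sup>2 + y\<^sup>2) + a\<^sub>1 Z * b\<^sub>0 Z + a\<^sub>0 Z * b\<^sub>1 Z)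
     + 2 * (a\<^sub>2 Z * b\<^sub>0 Z + a\<^sub>0 Z * b\<^sub>2 Z) * x\<^sup>2"
    by (simp add: xy axis_num_def power2_eq_square) algebra
  also have "\<dots> \<ge> 0" using nonneg[of "x\<^sup>2 + y\<^sup>2"] x pos by (intro add_nonneg_nonneg mult_nonneg_nonneg) auto
  finally show "Re (biquad_fun Z s) \<ge> 0"
    unfolding biquad_fun_def Re_divide by (intro divide_nonneg_nonneg) auto
qed

text \<open>A minimum of the real part at \<open>\<omega> = 0\<close> or \<open>\<omega> = \<infinity>\<close> has the value \<open>Z(0) > 0\<close> or \<open>Z(\<infinity>) > 0\<close>, so it
  already implies positive-realness; what is left is the location of the minimum for \<open>Z\<close> and \<open>1/Z\<close>.\<close>

lemma regular_biquad_iff: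
  assumes Z: "pos_coeffs Z"
  shows "regular (biquad_fun Z) \<longleftrightarrow>
    (\<B> Z \<le> 0 \<and> (\<D>\<^sub>b Z \<ge> 0 \<or> \<E>\<^sub>a Z \<ge> 0)) \<or> (\<B> Z \<ge> 0 \<and> (\<D>\<^sub>a Z \<ge> 0 \<or> \<E>\<^sub>b Z \<ge> 0))"
    (is "_ \<longleftrightarrow> ?R")
proof -
  have r: "pos_coeffs (recip Z)" using Z by (auto simp: pos_coeffs_def recip_def)
  have inv: "\<B> (recip Z) = - \<B> Z" "\<D>\<^sub>b (recip Z) = \<D>\<^sub>a Z" "\<E>\<^sub>b (recip Z) = \<E>\<^sub>a Z"
    by (simp_all add: recip_def \<B>_def \<D>\<^sub>a_def \<D>\<^sub>b_def \<E>\<^sub>a_def \<E>\<^sub>b_def \<A>_def \<C>_def algebra_simps)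
  have min: "min_at_zero_or_infinity (biquad_fun Z) \<or> min_at_zero_or_infinity (\<lambda>s. inverse (biquad_fun Z s)) \<longleftrightarrow> ?R"
    using min_at_zero_or_infinity_iff[OF Z] min_at_zero_or_infinity_iff[OF r]
    unfolding biquad_fun_recip inv by auto
  have "positive_real (biquad_fun Z)" if ?R
  proof (rule positive_real_biquad[OF Z])
    fix x :: real assume x: "x \<ge> 0"
    have bound: "axis_num W x \<ge> 0" if "pos_coeffs W" "(\<B> W \<le> 0 \<and> \<D>\<^sub>b W \<ge> 0) \<or> (\<B> W \<ge> 0 \<and> \<E>\<^sub>b W \<ge> 0)" for W
    proof -
      have w: "(sqrt x)\<^sup>2 = x" using x by simp
      have pos: "a\<^sub>0 W > 0" "b\<^sub>0 W > 0" "b\<^sub>2 W > 0" "a\<^sub>2 W > 0" using that(1) by (auto simp: pos_coeffs_def)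
      have Re0: "Re_axis (biquad_fun W) 0 = a\<^sub>0 W / b\<^sub>0 W"
        using pos unfolding Re_axis_biquad[OF that(1)] by (simp add: axis_num_def axis_den_def power2_eq_square)
      have "a\<^sub>0 W / b\<^sub>0 W \<le> Re_axis (biquad_fun W) (sqrt x) \<or> a\<^sub>2 W / b\<^sub>2 W \<le> Re_axis (biquad_fun W) (sqrt x)"
        using that(2) axis_min_at_zero_iff[OF that(1)] axis_min_at_infinity_iff[OF that(1)]
        unfolding Re0 Re_axis_infinity_biquad[OF that(1)] by blast
      moreover have "a\<^sub>0 W / b\<^sub>0 W > 0" "a\<^sub>2 W / b\<^sub>2 W > 0" using pos by simp_all
      ultimately have "0 \<le> Re_axis (biquad_fun W) (sqrt x)" by linarith
      then show ?thesis using axis_den_pos[OF that(1), of "sqrt x"] unfolding Re_axis_biquad[OF that(1)] w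
        by (simp add: zero_le_divide_iff)
    qed
    have "axis_num (recip Z) x = axis_num Z x" by (simp add: axis_num_def recip_def algebra_simps)
    then show "axis_num Z x \<ge> 0"
      using bound[OF Z] bound[OF r] that unfolding inv by auto
  qed
  then show ?thesis unfolding regular_def using min by blast
qed

section \<open>Element values for two inductors\<close>

text \<open>From here on \<open>l\<close>, \<open>h\<close>, \<open>a\<close>, \<open>b\<close>, \<open>t\<close> stand for \<open>Z(0) = a\<^sub>0/b\<^sub>0\<close>, \<open>Z(\<infinity>) = a\<^sub>2/b\<^sub>2\<close>, \<open>a\<^sub>1\<close>, \<open>b\<^sub>1\<close> and
  \<open>b\<^sub>0 b\<^sub>2\<close>. All the conditions depend on these five numbers alone (see \<open>reduced_form\<close>), and \<open>\<B> < 0\<close>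
  becomes \<open>l < h\<close>. The expression in the last assumption is \<open>\<R>\<close> divided by \<open>t\<close>.\<close>

lemma interlacing:
  fixes a b h l t :: real
  assumes "0 < b" "l < h" "0 \<le> t" "(a - l * b) * (h * b - a) - t * (h - l)^2 > 0"
  shows "l * b < a" "a < h * b"
proof -
  have "t * (h - l)^2 \<ge> 0" using assms by simp
  then have p: "(a - l * b) * (h * b - a) > 0" using assms by linarith
  have "l * b < h * b" using assms by simp
  then show "l * b < a" "a < h * b" using p by (auto simp: zero_less_mult_iff)
qed

text \<open>Given the diagonal resistance \<open>r\<close>, the values \<open>Z(0)\<close> and \<open>Z(\<infinity>)\<close> determine \<open>p + q\<close> and \<open>p q\<close>, and
  the middle coefficients determine \<open>X\<close> and \<open>Y\<close> linearly. The remaining equation is the quadratic \<open>F\<close>.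
  The discriminant of \<open>p\<close> and \<open>q\<close> has the sign of \<open>T\<close>, and it is nonnegative because \<open>F = 0\<close> makes
  \<open>R T\<close> a square. If \<open>p = q\<close>, then \<open>X\<close> and \<open>Y\<close> are no longer determined linearly; they are then the
  roots of a quadratic equation whose discriminant is positive because \<open>R\<close> is.\<close>

lemma opp_LL_parameters:
  fixes a b h l t r :: real
  assumes pos: "0 < l" "0 < a" "0 < b" "0 < t" and r: "l < r" "r < h"
    and res: "(a - l * b) * (h * b - a) - t * (h - l)^2 > 0"
    and F: "(h - r) * (r - l) * (a * b - t * (h - l)) - a^2 * (r - l) - l * b^2 * r * (h - r) + 4 * l * r * t * (h - l) = 0"
  shows "\<exists>p q X Y. 0 < p \<and> 0 < q \<and> 0 < X \<and> 0 < Y \<and> p + q + r = h \<and>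
    p * q * r = l * (p * q + q * r + r * p) \<and> X + Y = (p * q + q * r + r * p) * b \<and>
    q * X + p * Y = (p * q + q * r + r * p) * a \<and> X * Y = (p * q + q * r + r * p) * t * (r + p) * (r + q)"
proof -
  define R T where "R = (a - l * b) * (h * b - a) - t * (h - l)^2" and "T = (h - r) * (r - l) - 4 * l * r"
  have I: "R * T = (a * (r + l) - l * b * (h + r))^2"
  proof -
    have "R * T - (a * (r + l) - l * b * (h + r))^2 = (h - l) * ((h - r) * (r - l) * (a * b - t * (h - l)) - a^2 * (r - l) - l * b^2 * r * (h - r) + 4 * l * r * t * (h - l))"
      unfolding R_def T_def by algebra
    then show ?thesis using F by simp
  qed
  have R: "R > 0" using res by (simp add: R_def)
  have "R * T \<ge> 0" unfolding I by simp
  then have T: "T \<ge> 0" using R by (simp add: zero_le_mult_iff)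
  define s m where "s = h - r" and "m = l * r * s / (r - l)"
  have s: "s > 0" and m: "m > 0" using pos r by (simp_all add: s_def m_def)
  have mr: "m * (r - l) = l * r * s" using r by (simp add: m_def)
  have disc: "(s^2 - 4 * m) * (r - l) = s * T"
    using mr unfolding T_def s_def by algebra
  have "(s^2 - 4 * m) * (r - l) \<ge> 0" unfolding disc using s T by simp
  then have dn: "s^2 - 4 * m \<ge> 0" using r by (simp add: zero_le_mult_iff)
  define d where "d = sqrt (s^2 - 4 * m)"
  have d: "d \<ge> 0" "d^2 = s^2 - 4 * m" using dn by (simp_all add: d_def)
  have "d^2 < s^2" using d m by simp
  then have ds: "d < s" by (rule power2_less_imp_less) (use s in simp)
  define p q where "p = (s - d) / 2" and "q = (s + d) / 2"
  have p: "p > 0" and q: "q > 0" using ds d s by (simp_all add: p_def q_def)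
  have pq: "p + q = s" "p * q = m"
    using d(2) by (simp_all add: p_def q_def field_simps power2_eq_square)
  define k where "k = p * q + q * r + r * p"
  have k: "k > 0" using p q r pos by (simp add: k_def add_pos_pos)
  have ks: "k = m + r * s" unfolding k_def pq(1)[symmetric] pq(2)[symmetric] by (simp add: algebra_simps)
  have c1: "p + q + r = h" using pq by (simp add: s_def)
  have c2: "p * q * r = l * k" unfolding ks pq using mr by (simp add: algebra_simps)
  have kr: "k * (r - l) = r^2 * s" unfolding ks using mr by (simp add: algebra_simps power2_eq_square)
  have H: "(r + p) * (r + q) = r^2 + k" by (simp add: k_def algebra_simps power2_eq_square)
  have "\<exists>X Y. 0 < X \<and> 0 < Y \<and> X + Y = k * b \<and> q * X + p * Y = k * a \<and> X * Y = k * t * ((r + p) * (r + q))"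
  proof (cases "d = 0")
    case False
    then have d0: "d > 0" using d by simp
    have qp: "q - p = d" by (simp add: p_def q_def field_simps)
    define X Y where "X = k * (a - p * b) / d" and "Y = k * (q * b - a) / d"
    have Xd: "X * d = k * (a - p * b)" "Y * d = k * (q * b - a)" using d0 by (simp_all add: X_def Y_def)
    have "(X + Y) * d = (k * b) * d" "(q * X + p * Y) * d = (k * a) * d"
      using Xd unfolding qp[symmetric] by algebra+
    then have sum: "X + Y = k * b" and lin: "q * X + p * Y = k * a" using d0 by simp_all
    have key: "k * ((a - p * b) * (q * b - a)) = d^2 * t * ((r + p) * (r + q))"
    proof -
      have e: "(a - p * b) * (q * b - a) = s * a * b - a^2 - m * b^2"
        unfolding pq(1)[symmetric] pq(2)[symmetric] by (simp add: algebra_simps power2_eq_square)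
      have F': "s * (r - l) * (a * b - t * (h - l)) - a^2 * (r - l) - l * b^2 * r * s + 4 * l * r * t * (h - l) = 0"
        using F unfolding s_def .
      have hs: "h = s + r" by (simp add: s_def)
      have "(r - l)^2 * (k * (s * a * b - a^2 - m * b^2) - (s^2 - 4 * m) * t * (r^2 + k)) = 0"
      proof -
        have "(r - l)^2 * (k * (s * a * b - a^2 - m * b^2) - (s^2 - 4 * m) * t * (r^2 + k)) = 
          (k * (r - l)) * (s * a * b * (r - l) - a^2 * (r - l) - (m * (r - l)) * b^2)
          - (s^2 * (r - l) - 4 * (m * (r - l))) * t * (r^2 * (r - l) + k * (r - l))" by algebra
        also have "\<dots> = r^2 * s * (s * (r - l) * (a * b - t * (h - l)) - a^2 * (r - l) - l * b^2 * r * s + 4 * l * r * t * (h - l))"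
          unfolding kr mr hs by algebra
        finally show ?thesis using F' by simp
      qed
      then have "k * (s * a * b - a^2 - m * b^2) = (s^2 - 4 * m) * t * (r^2 + k)" using r by simp
      then show ?thesis unfolding e d(2) H .
    qed
    have prod: "X * Y = k * t * ((r + p) * (r + q))"
    proof -
      have "X * Y = k * (k * ((a - p * b) * (q * b - a))) / d^2" by (simp add: X_def Y_def power2_eq_square)
      then show ?thesis unfolding key using d0 by simp
    qed
    have "X * Y > 0" unfolding prod using k p q r pos by simp
    moreover have "X + Y > 0" unfolding sum using k pos by simp
    ultimately have "X > 0" "Y > 0" by (auto simp: zero_less_mult_iff)
    then show ?thesis using sum lin prod by blast
  next
    case True
    have eq: "p = q" "s = 2 * p" using True by (simp_all add: p_def q_def)
    have mp: "m = p^2" using pq eq by (simp add: power2_eq_square)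
    have "(s^2 - 4 * m) * (r - l) = 0" unfolding mp eq(2) by (simp add: power2_eq_square)
    then have "s * T = 0" unfolding disc .
    then have T0: "T = 0" using s by simp
    have lr: "l * (p + 2 * r) = r * p"
      using mr p unfolding mp eq(2) by (simp add: power2_eq_square) (simp add: algebra_simps)
    have hp: "h = 2 * p + r" using eq(2) by (simp add: s_def)
    have kp: "k = p * (p + 2 * r)" using eq by (simp add: k_def algebra_simps)
    have "a * (r + l) - l * b * (h + r) = 0" using I T0 by simp
    moreover have "l * (h + r) = p * (r + l)" unfolding hp using lr by (simp add: algebra_simps)
    then have "l * b * (h + r) = p * b * (r + l)" by (simp add: mult_ac)
    ultimately have "(a - p * b) * (r + l) = 0" by (simp add: left_diff_distrib)
    then have ap: "a = p * b" using r pos by simp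
    define D where "D = (k * b)^2 - 4 * (k * t * (r + p)^2)"
    have D: "D > 0"
    proof -
      have w: "p + 2 * r > 0" using p r pos by simp
      have "R * (p + 2 * r)^2 = (p + r)^2 * (b^2 * p * (p + 2 * r) - 4 * t * (p + r)^2)"
      proof -
        have e: "(p - l) * (p + 2 * r) = p * (p + r)" "(h - l) * (p + 2 * r) = 2 * (p + r)^2"
          using lr by (simp_all add: hp algebra_simps power2_eq_square)
        have "R * (p + 2 * r)^2 = b^2 * ((p - l) * (p + 2 * r)) * (h - p) * (p + 2 * r) - t * ((h - l) * (p + 2 * r))^2"
          unfolding R_def ap by (simp add: algebra_simps power2_eq_square)
        also have "\<dots> = (p + r)^2 * (b^2 * p * (p + 2 * r) - 4 * t * (p + r)^2)"
          unfolding e by (simp add: hp algebra_simps power2_eq_square)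
        finally show ?thesis .
      qed
      moreover have "R * (p + 2 * r)^2 > 0" using R w by simp
      ultimately have "b^2 * p * (p + 2 * r) - 4 * t * (p + r)^2 > 0" by (simp add: zero_less_mult_iff)
      then have "k * (b^2 * p * (p + 2 * r) - 4 * t * (p + r)^2) > 0" using k by simp
      moreover have "k * (b^2 * p * (p + 2 * r) - 4 * t * (p + r)^2) = D"
      proof -
        have "k * (b^2 * p * (p + 2 * r) - 4 * t * (p + r)^2) = k * b^2 * (p * (p + 2 * r)) - 4 * (k * t * (r + p)^2)"
          by (simp add: algebra_simps)
        also have "\<dots> = D" unfolding kp[symmetric] D_def by (simp add: power2_eq_square)
        finally show ?thesis .
      qed
      ultimately show ?thesis by simp
    qed
    define e where "e = sqrt D"
    have e: "e^2 = D" "e > 0" using D by (simp_all add: e_def)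
    have "k * t * (r + p)^2 > 0" using k pos p r by simp
    then have "e^2 < (k * b)^2" unfolding e(1) D_def by linarith
    then have ek: "e < k * b" by (rule power2_less_imp_less) (use k pos in simp)
    define X Y where "X = (k * b - e) / 2" and "Y = (k * b + e) / 2"
    have "0 < X" "0 < Y" using ek e k pos by (simp_all add: X_def Y_def add_pos_pos)
    moreover have sum: "X + Y = k * b" by (simp add: X_def Y_def field_simps)
    moreover have "q * X + p * Y = k * a"
    proof -
      have "q * X + p * Y = p * (X + Y)" by (simp add: eq(1) distrib_left)
      then show ?thesis unfolding sum ap by (simp add: mult_ac)
    qed
    moreover have "X * Y = k * t * ((r + p) * (r + q))"
    proof -
      have "X * Y = ((k * b)^2 - e^2) / 4" by (simp add: X_def Y_def field_simps power2_eq_square)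
      also have "\<dots> = k * t * (r + p)^2" unfolding e(1) D_def by simp
      finally show ?thesis by (simp add: eq(1) power2_eq_square)
    qed
    ultimately show ?thesis by blast
  qed
  then obtain X Y where XY: "0 < X" "0 < Y" "X + Y = k * b" "q * X + p * Y = k * a" "X * Y = k * t * ((r + p) * (r + q))" by blast
  have "X * Y = k * t * (r + p) * (r + q)" using XY(5) by (simp only: mult.assoc)
  then show ?thesis unfolding k_def
    by (intro exI[of _ p] exI[of _ q] exI[of _ X] exI[of _ Y] conjI p q c1 c2[unfolded k_def] XY(1-4)[unfolded k_def])
qed

text \<open>The quadratic \<open>F\<close> is negative at \<open>l\<close>, so it suffices to find a point in \<open>(l, h)\<close> where it is
  nonnegative. The identities \<open>I1\<close> and \<open>I2\<close> write \<open>(h - l) F\<close> and \<open>(h - 9 l) F\<close> as \<open>R T\<close> and \<open>Q T\<close> minus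
  squares of expressions that are linear in \<open>r\<close>. At the zero of either linear expression \<open>F\<close> is
  nonnegative if \<open>T\<close> is (for the second one because \<open>h > 9 l\<close>), and the sign of \<open>n\<close> tells at which of the two zeros \<open>T\<close> is nonnegative.\<close>

lemma opp_LL_solvable:
  fixes a b h l t :: real
  assumes pos: "0 < l" "l < h" "0 < a" "0 < b" "0 < t"
    and res: "(a - l * b) * (h * b - a) - t * (h - l)^2 > 0"
    and disc: "(a - l * b) * (h * b - a) - t * (h - l)^2 - 4 * l * (a * b - 2 * t * (h - l)) \<ge> 0"
  shows "\<exists>p q r X Y. 0 < p \<and> 0 < q \<and> 0 < r \<and> 0 < X \<and> 0 < Y \<and> p + q + r = h \<and>
    p * q * r = l * (p * q + q * r + r * p) \<and> X + Y = (p * q + q * r + r * p) * b \<and>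
    q * X + p * Y = (p * q + q * r + r * p) * a \<and> X * Y = (p * q + q * r + r * p) * t * (r + p) * (r + q)"
proof -
  define R Q where "R = (a - l * b) * (h * b - a) - t * (h - l)^2" and "Q = R - 4 * l * (a * b - 2 * t * (h - l))"
  define F where "F = (\<lambda>r. (h - r) * (r - l) * (a * b - t * (h - l)) - a^2 * (r - l) - l * b^2 * r * (h - r) + 4 * l * r * t * (h - l))"
  define T where "T = (\<lambda>r. (h - r) * (r - l) - 4 * l * r)"
  have R: "R > 0" and Q: "Q \<ge> 0" using res disc by (simp_all add: R_def Q_def)
  have I1: "R * T r - (a * (r + l) - l * b * (h + r))^2 = (h - l) * F r" for r
    unfolding R_def T_def F_def by algebra
  have I2: "Q * T r - (a * (3 * l - r) - l * b * (h - 3 * r))^2 = (h - 9 * l) * F r" for r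
    unfolding R_def Q_def T_def F_def by algebra
  note il = interlacing[OF pos(4,2) less_imp_le[OF pos(5)] res]
  define n where "n = 2 * a^2 + 2 * l * h * b^2 - (h + 3 * l) * (a * b)"
  have ab: "a * b > 0" using pos by simp
  have ex: "\<exists>r>0. T r \<ge> 0 \<and> F r \<ge> 0"
  proof (cases "n \<le> 0")
    case True
    define r where "r = l * (h * b - a) / (a - l * b)"
    have r: "r > 0" using pos il by (simp add: r_def)
    have rr: "r * (a - l * b) = l * (h * b - a)" using il by (simp add: r_def)
    have "T r * (a - l * b)^2 = l * (h - l) * (- n)"
      using rr unfolding T_def n_def by algebra
    moreover have "l * (h - l) * (- n) \<ge> 0" using pos True by (intro mult_nonneg_nonneg) auto
    moreover have "(a - l * b)^2 > 0" using il by simp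
    ultimately have T: "T r \<ge> 0" by (metis zero_le_mult_iff not_less less_le_not_le)
    have "a * (r + l) - l * b * (h + r) = 0" using rr by (simp add: algebra_simps)
    then have "(h - l) * F r = R * T r" using I1[of r] by simp
    also have "\<dots> \<ge> 0" using R T by simp
    finally have "F r \<ge> 0" using pos by (simp add: zero_le_mult_iff)
    then show ?thesis using r T by blast
  next
    case False
    then have n: "n > 0" by simp
    have hl: "h > 9 * l"
    proof (rule ccontr)
      assume "\<not> h > 9 * l"
      then have h9: "9 * l - h \<ge> 0" by simp
      have "2 * R = (h - l) * (a * b - 2 * t * (h - l)) - n"
        unfolding R_def n_def by algebra
      then have "(h - l) * (a * b - 2 * t * (h - l)) > 0" using R n by linarith
      then have "a * b - 2 * t * (h - l) > 0" using pos by (simp add: zero_less_mult_iff)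
      then have "(9 * l - h) * (a * b - 2 * t * (h - l)) \<ge> 0" using h9 by simp
      moreover have "2 * Q = - ((9 * l - h) * (a * b - 2 * t * (h - l))) - n"
        unfolding Q_def R_def n_def by algebra
      ultimately show False using Q n by linarith
    qed
    have P: "(h * b - 3 * a) * (3 * l * b - a) > 0"
    proof -
      have "2 * ((h * b - 3 * a) * (3 * l * b - a)) = 3 * n + (h - 9 * l) * (a * b)" unfolding n_def by algebra
      moreover have "(h - 9 * l) * (a * b) > 0" using hl ab by simp
      ultimately show ?thesis using n by linarith
    qed
    define r where "r = l * ((h * b - 3 * a) / (3 * l * b - a))"
    have nz: "3 * l * b - a \<noteq> 0" using P by auto
    have "(h * b - 3 * a) / (3 * l * b - a) > 0" using P by (simp only: zero_less_divide_iff zero_less_mult_iff)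
    then have r: "r > 0" unfolding r_def by (rule mult_pos_pos[OF pos(1)])
    have rr: "r * (3 * l * b - a) = l * (h * b - 3 * a)" using nz by (simp add: r_def)
    have "T r * (3 * l * b - a)^2 = l * (h - 9 * l) * n"
      using rr unfolding T_def n_def by algebra
    moreover have "l * (h - 9 * l) * n > 0" using pos hl n by simp
    moreover have "(3 * l * b - a)^2 > 0" using nz by simp
    ultimately have T: "T r \<ge> 0" by (metis zero_less_mult_iff not_less less_imp_le)
    have "a * (3 * l - r) - l * b * (h - 3 * r) = 0" using rr by (simp add: algebra_simps)
    then have "(h - 9 * l) * F r = Q * T r" using I2[of r] by simp
    also have "\<dots> \<ge> 0" using Q T by simp
    finally have "F r \<ge> 0" using hl by (simp add: zero_le_mult_iff)
    then show ?thesis using r T by blast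
  qed
  then obtain u where u: "u > 0" "T u \<ge> 0" "F u \<ge> 0" by blast
  have "(h - u) * (u - l) > 0" using u pos unfolding T_def by (smt (verit) mult_pos_pos)
  then have ur: "l < u" "u < h" using pos by (auto simp: zero_less_mult_iff)
  have "F l < 0"
  proof -
    have "T l < 0" using pos by (simp add: T_def)
    then have "R * T l < 0" using R by (simp add: mult_less_0_iff)
    then have "(h - l) * F l < 0" unfolding I1[symmetric] by (smt (verit) zero_le_power2)
    then show ?thesis using pos by (simp add: mult_less_0_iff)
  qed
  moreover have "\<And>x. isCont F x" unfolding F_def by (intro continuous_intros)
  ultimately obtain r where r: "l \<le> r" "r \<le> u" "F r = 0"
    using IVT[of F l 0 u] u ur by auto
  have "r \<noteq> l" using r \<open>F l < 0\<close> by auto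
  then have lr: "l < r" "r < h" using r ur by auto
  obtain p q X Y where "0 < p \<and> 0 < q \<and> 0 < X \<and> 0 < Y \<and> p + q + r = h \<and>
    p * q * r = l * (p * q + q * r + r * p) \<and> X + Y = (p * q + q * r + r * p) * b \<and>
    q * X + p * Y = (p * q + q * r + r * p) * a \<and> X * Y = (p * q + q * r + r * p) * t * (r + p) * (r + q)"
    using opp_LL_parameters[OF pos(1,3,4,5) lr res] r(3) unfolding F_def by blast
  note sol = this
  have "r > 0" using lr pos by simp
  then show ?thesis
    using sol by (intro exI[of _ p] exI[of _ q] exI[of _ r] exI[of _ X] exI[of _ Y]) simp
qed

text \<open>The parameter is \<open>u = (r - l)/(h - r)\<close>, in terms of which all element values are explicit; the
  equation \<open>f u = 0\<close> expresses \<open>x y = k t\<close>. By the arithmetic-geometric mean inequality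
  the most favourable point is \<open>u0\<close>, where \<open>f\<close> has the sign of the discriminant.\<close>

lemma arm_LL_solvable:
  fixes a b h l t :: real
  assumes pos: "0 < l" "l < h" "0 < a" "0 < b" "0 < t"
    and disc: "(a - l * b) * (h * b - a) - t * (h - l)^2 \<ge> 4 * l * h * t"
  shows "\<exists>p q r x y. 0 < p \<and> 0 < q \<and> 0 < r \<and> 0 < x \<and> 0 < y \<and> q + r = h \<and>
    p * r = l * (p + r) \<and> q * (p + r) * b = y * (p + q + r) + x * (p + r) \<and>
    q * (p + r) * a = y * p * (q + r) + x * (p * q + p * r + q * r) \<and> x * y = q * (p + r) * t"
proof -
  define A C where "A = a - l * b" and "C = h * b - a"
  have "4 * l * h * t > 0" using pos by simp
  then have res: "(a - l * b) * (h * b - a) - t * (h - l)^2 > 0" using disc by linarith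
  have A: "A > 0" and C: "C > 0" using interlacing[OF pos(4,2) less_imp_le[OF pos(5)] res] by (simp_all add: A_def C_def)
  have AC: "A * C \<ge> t * (h + l)^2"
  proof -
    have "t * (h + l)^2 = t * (h - l)^2 + 4 * l * h * t" by algebra
    then show ?thesis using disc unfolding A_def C_def by linarith
  qed
  define f where "f = (\<lambda>u. (C - u * A) * (u * A * h^2 - C * l^2) - u * t * (h^2 - l^2)^2)"
  define u0 u1 where "u0 = C * l / (A * h)" and "u1 = C / A"
  have u0: "u0 > 0" and u01: "u0 < u1"
    using A C pos by (simp_all add: u0_def u1_def field_simps)
  have uA: "u0 * (A * h) = C * l" using A pos by (simp add: u0_def)
  have hl2: "h^2 - l^2 > 0" using pos by (simp add: power_strict_mono)
  have "f u0 \<ge> 0"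
  proof -
    have "h * A * f u0 = C * l * (h - l)^2 * (A * C - t * (h + l)^2)"
      unfolding f_def using uA by algebra
    also have "\<dots> \<ge> 0" using C pos AC by simp
    finally have "h * A * f u0 \<ge> 0" .
    moreover have "h * A > 0" using pos A by simp
    ultimately show ?thesis by (metis mult_pos_neg not_le)
  qed
  moreover have "f u1 \<le> 0"
  proof -
    have "u1 * A = C" using A by (simp add: u1_def)
    then have "f u1 = - (u1 * t * (h^2 - l^2)^2)" by (simp add: f_def)
    moreover have "u1 * t * (h^2 - l^2)^2 > 0" using u0 u01 pos hl2 by simp
    ultimately show ?thesis by simp
  qed
  moreover have "\<And>x. isCont f x" unfolding f_def by (intro continuous_intros)
  ultimately obtain u where u: "u0 \<le> u" "u \<le> u1" "f u = 0"
    using IVT2[of f u1 0 u0] u01 by auto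
  have up: "u > 0" using u u0 by simp
  have prod: "(C - u * A) * (u * A * h^2 - C * l^2) = u * t * (h^2 - l^2)^2" using u(3) by (simp add: f_def)
  have "(C - u * A) * (u * A * h^2 - C * l^2) > 0" unfolding prod using up pos hl2 by simp
  moreover have "C - u * A \<ge> 0" using u(2) A by (simp add: u1_def field_simps)
  ultimately have f1: "C - u * A > 0" and f2: "u * A * h^2 - C * l^2 > 0" by (auto simp: zero_less_mult_iff)
  define q r where "q = (h - l) / (1 + u)" and "r = h - q"
  have q: "q > 0" using up pos by (simp add: q_def)
  have "q * (1 + u) = h - l" using up by (simp add: q_def)
  then have rl: "r - l = u * q" and qr: "q + r = h" by (simp_all add: r_def algebra_simps)
  have "u * q > 0" using up q by simp
  then have r: "r > 0" using rl pos by linarith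
  define p where "p = l * r / (u * q)"
  have p: "p > 0" using up q r pos by (simp add: p_def)
  have pr: "p * (r - l) = l * r" using up q by (simp add: p_def rl)
  have pr': "p * (u * q) = l * r" using pr by (simp add: rl)
  define k where "k = q * (p + r)"
  have ku: "k * u = r^2" using pr' rl unfolding k_def by algebra
  have k: "k > 0" using p q r by (simp add: k_def)
  define w where "w = h^2 - l^2"
  have w: "w > 0" using hl2 by (simp add: w_def)
  define y x where "y = k * (C - u * A) / w" and "x = k * (u * A * h^2 - C * l^2) / (r^2 * w)"
  have y: "y > 0" and x: "x > 0" using k f1 f2 w r by (simp_all add: y_def x_def)
  have yw: "y * w = k * (C - u * A)" and xw: "x * r^2 * w = k * (u * A * h^2 - C * l^2)"
    using w r by (simp_all add: y_def x_def)
  have xw': "x * u * w = u * A * h^2 - C * l^2"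
  proof -
    have "k * (x * u * w) = k * (u * A * h^2 - C * l^2)" using xw ku by algebra
    then show ?thesis using k by simp
  qed
  have c5: "x * y = k * t"
  proof -
    have "(x * u * w) * (y * w) = (u * A * h^2 - C * l^2) * (k * (C - u * A))" unfolding xw' yw ..
    also have "\<dots> = k * (u * t * w^2)" using prod unfolding w_def[symmetric] by (simp add: mult_ac)
    finally have "u * w^2 * (x * y) = u * w^2 * (k * t)" by (simp add: algebra_simps power2_eq_square)
    then show ?thesis using up w by simp
  qed
  have lr: "l * (p + r) = p * r" using pr by (simp add: algebra_simps)
  have prk: "p + r = k / q" using q by (simp add: k_def)
  have prq: "(p + r) * q * u = r^2" using ku by (simp add: k_def mult_ac)
  have uq: "u * q = r - l" using rl by simp
  have mean: "u * q * p = l * r" using pr' by (simp add: mult_ac)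
  have hq: "q = h - r" using qr by simp
  have sum: "A + C = (h - l) * b" "h * A + l * C = (h - l) * a" by (simp_all add: A_def C_def algebra_simps)
  have c3: "k * b = y * (p + q + r) + x * (p + r)"
  proof -
    have i: "u * q * (p + h) - l^2 = u * q * (h + l)" "h^2 - u * q * (p + h) = q * (h + l)"
      using mean uq hq by algebra+
    have "u * w * (y * (p + q + r) + x * (p + r)) = u * (y * w) * (p + h) + (x * u * w) * (p + r)"
      by (simp add: algebra_simps flip: qr)
    also have "\<dots> = (p + r) * (C * (u * q * (p + h) - l^2) + u * A * (h^2 - u * q * (p + h)))"
      unfolding yw xw' k_def by algebra
    also have "\<dots> = u * (q * (p + r)) * (h + l) * (A + C)" unfolding i by algebra
    also have "\<dots> = u * w * (k * b)" unfolding sum k_def w_def by algebra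
    finally show ?thesis using up w by simp
  qed
  have c4: "k * a = y * p * (q + r) + x * (p * q + p * r + q * r)"
  proof -
    have S: "p * q + p * r + q * r = (p + r) * (q + l)" using lr by algebra
    have i: "u * q * p * h - l^2 * (q + l) = u * q * (h + l) * l" "h^2 * (q + l) - u * q * p * h = q * (h + l) * h"
      using mean uq hq by algebra+
    have "u * w * (y * p * (q + r) + x * (p * q + p * r + q * r)) = u * (y * w) * p * h + (x * u * w) * ((p + r) * (q + l))"
      unfolding S qr by (simp add: algebra_simps)
    also have "\<dots> = (p + r) * (C * (u * q * p * h - l^2 * (q + l)) + u * A * (h^2 * (q + l) - u * q * p * h))"
      unfolding yw xw' k_def by algebra
    also have "\<dots> = u * (q * (p + r)) * (h + l) * (h * A + l * C)" unfolding i by algebra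
    also have "\<dots> = u * w * (k * a)" unfolding sum k_def w_def by algebra
    finally show ?thesis using up w by simp
  qed
  show ?thesis using p q r x y qr lr c3 c4 c5 unfolding k_def by (intro exI[of _ p] exI[of _ q] exI[of _ r] exI[of _ x] exI[of _ y]) simp
qed

section \<open>Element values for an inductor and a capacitor\<close>

lemma quadratic_root_beyond:
  fixes u v w x0 :: real
  assumes u: "u > 0" and neg: "u * x0^2 + v * x0 + w < 0"
  shows "\<exists>x>x0. u * x^2 + v * x + w = 0"
proof -
  define D where "D = v^2 - 4 * u * w"
  have "(2 * u * x0 + v)^2 - D = 4 * u * (u * x0^2 + v * x0 + w)" unfolding D_def by algebra
  also have "\<dots> < 0" using u neg by (simp add: mult_less_0_iff)
  finally have sq: "(2 * u * x0 + v)^2 < D" by simp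
  then have D: "D > 0" by (smt (verit) zero_le_power2)
  have lt: "2 * u * x0 + v < sqrt D" using sq by (rule real_less_rsqrt)
  define x where "x = (sqrt D - v) / (2 * u)"
  have x: "2 * u * x + v = sqrt D" using u by (simp add: x_def)
  have "u * x0 < u * x" using lt x by linarith
  then have "x > x0" using u by simp
  have "4 * u * (u * x^2 + v * x + w) = (2 * u * x + v)^2 - D" unfolding D_def by algebra
  also have "\<dots> = 0" unfolding x using D by simp
  finally have "u * x^2 + v * x + w = 0" using u by simp
  then show ?thesis using \<open>x > x0\<close> by blast
qed

text \<open>Here \<open>Z(0)\<close> and \<open>Z(\<infinity>)\<close> are themselves the resistances of two arms. The equations for \<open>a\<close> and \<open>b\<close>
  give \<open>k\<close> and \<open>g = x y\<close> in terms of the diagonal resistance \<open>r\<close>, and substitution into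
  \<open>g (r + l) (r + h) = k\<^sup>2 t\<close> yields the quadratic equation; its cubic terms cancel. The first and the
  last coefficient are \<open>\<Gamma>\<^sub>a\<close> and \<open>l h \<Gamma>\<^sub>b\<close>, both divided by \<open>t\<close>.\<close>

lemma opp_LC_parameters:
  fixes a b h l t r :: real
  assumes pos: "0 < l" "0 < h" "0 < a" "0 < b" "0 < t" "0 < r" and E: "a < b * (l + h + r)"
    and root: "(a * b * (l + h) - l * h * b^2 - t * (l + h)^2) * r^2
       + ((l + h) * (a * b * (l + h) - a^2 - t * (l + h)^2) + l * h * b * (2 * a - (l + h) * b)) * r
       + l * h * (a * b * (l + h) - a^2 - t * (l + h)^2) = 0"
  shows "\<exists>k g. 0 < k \<and> 0 < g \<and> k * b = g + l * h + h * r + r * l \<and> k * a = g * (l + h + r) + l * h * r \<and>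
    g * (r + l) * (r + h) = k^2 * t"
proof -
  define e s H m where "e = b * (l + h + r) - a" and "s = l + h" and "H = (r + l) * (r + h)" and "m = l * h + h * r + r * l"
  have e: "e > 0" and s: "s > 0" and H: "H > 0" using pos E by (simp_all add: e_def s_def H_def)
  have key: "s * H * b * e - m * e^2 = s^2 * H * t"
  proof -
    have "s * H * b * e - m * e^2 - s^2 * H * t = (a * b * (l + h) - l * h * b^2 - t * (l + h)^2) * r^2
       + ((l + h) * (a * b * (l + h) - a^2 - t * (l + h)^2) + l * h * b * (2 * a - (l + h) * b)) * r
       + l * h * (a * b * (l + h) - a^2 - t * (l + h)^2)"
      unfolding e_def s_def H_def m_def by algebra
    then show ?thesis using root by simp
  qed
  define k where "k = s * H / e"
  define g where "g = k^2 * t / H"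
  have k: "k > 0" using s H e by (simp add: k_def)
  have g: "g > 0" using k pos H by (simp add: g_def)
  have ke: "k * e = s * H" using e by (simp add: k_def)
  have gH: "g * H = k^2 * t" using H by (simp add: g_def)
  have "e^2 * H * (k * b - m - g) = 0"
  proof -
    have "e^2 * H * (k * b - m - g) = H * ((k * e) * b * e - m * e^2) - e^2 * (g * H)" by (simp add: algebra_simps power2_eq_square)
    also have "e^2 * (g * H) = (k * e)^2 * t" unfolding gH by (simp add: power_mult_distrib)
    also have "H * ((k * e) * b * e - m * e^2) - (k * e)^2 * t = H * (s * H * b * e - m * e^2) - (s * H)^2 * t" unfolding ke ..
    also have "\<dots> = 0" unfolding key by (simp add: algebra_simps power2_eq_square)
    finally show ?thesis .
  qed
  then have kb: "k * b = g + m" using e H by simp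
  have "k * a = k * b * (l + h + r) - k * e" by (simp add: e_def algebra_simps)
  also have "\<dots> = g * (l + h + r) + l * h * r" unfolding kb ke by (simp add: m_def s_def H_def algebra_simps)
  finally have ka: "k * a = g * (l + h + r) + l * h * r" .
  show ?thesis using k g kb ka gH by (intro exI[of _ k] exI[of _ g]) (simp add: m_def H_def mult.assoc)
qed

text \<open>With opposite signs of the outer coefficients there is exactly one positive root; what has to be
  checked is that it lies beyond the point where \<open>k\<close> changes sign.\<close>

lemma opp_LC_opposite_signs:
  fixes a b h l t :: real
  assumes pos: "0 < l" "0 < h" "0 < a" "0 < b" "0 < t"
    and signs: "(a * b * (l + h) - l * h * b^2 - t * (l + h)^2) * (a * b * (l + h) - a^2 - t * (l + h)^2) < 0"
  shows "\<exists>r k g. 0 < r \<and> 0 < k \<and> 0 < g \<and> k * b = g + l * h + h * r + r * l \<and> k * a = g * (l + h + r) + l * h * r \<and>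
    g * (r + l) * (r + h) = k^2 * t"
proof -
  define Ga Gb c where "Ga = a * b * (l + h) - l * h * b^2 - t * (l + h)^2" and "Gb = a * b * (l + h) - a^2 - t * (l + h)^2"
    and "c = (l + h) * Gb + l * h * b * (2 * a - (l + h) * b)"
  have "\<exists>r>0. a < b * (l + h + r) \<and> Ga * r^2 + c * r + l * h * Gb = 0"
  proof (cases "Ga > 0")
    case True
    then have Gb: "Gb < 0" using signs unfolding Ga_def[symmetric] Gb_def[symmetric] by (simp add: mult_less_0_iff)
    \<comment> \<open>At \<open>r = a/b - (l + h)\<close> the denominator of \<open>k\<close> vanishes and the quadratic is negative.\<close>
    define x0 where "x0 = max 0 (a / b - (l + h))"
    have "Ga * x0^2 + c * x0 + l * h * Gb < 0"
    proof (cases "a / b - (l + h) \<le> 0")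
      case True
      then show ?thesis using Gb pos by (simp add: x0_def mult_pos_neg)
    next
      case False
      then have x: "x0 > 0" "a = b * (l + h + x0)" using pos by (simp_all add: x0_def field_simps)
      have "Ga * x0^2 + c * x0 + l * h * Gb = - ((l + h)^2 * t * (x0 + l) * (x0 + h))"
        unfolding c_def Ga_def Gb_def x(2) by algebra
      then show ?thesis using pos x by simp
    qed
    then obtain r where r: "r > x0" "Ga * r^2 + c * r + l * h * Gb = 0" using quadratic_root_beyond[OF True] by blast
    have "r > a / b - (l + h)" "r > 0" using r(1) by (simp_all add: x0_def)
    then show ?thesis using r(2) pos by (intro exI[of _ r]) (simp add: field_simps)
  next
    case False
    then have G: "Ga < 0" "Gb > 0" using signs unfolding Ga_def[symmetric] Gb_def[symmetric] by (auto simp: mult_less_0_iff)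
    have "(- Ga) * 0^2 + (- c) * 0 + (- (l * h * Gb)) < 0" using pos G by simp
    then obtain r where r: "r > 0" "(- Ga) * r^2 + (- c) * r + (- (l * h * Gb)) = 0"
      using quadratic_root_beyond[of "- Ga" 0 "- c" "- (l * h * Gb)"] G by (metis neg_0_less_iff_less)
    have "a * a < a * (b * (l + h))"
    proof -
      have "t * (l + h)^2 > 0" using pos by simp
      then show ?thesis using G(2) by (simp add: Gb_def power2_eq_square mult_ac)
    qed
    then have "a < b * (l + h)" using pos by simp
    also have "\<dots> < b * (l + h + r)" using pos r by simp
    finally show ?thesis using r by (intro exI[of _ r]) simp
  qed
  then obtain r where r: "r > 0" "a < b * (l + h + r)" "Ga * r^2 + c * r + l * h * Gb = 0" by blast
  show ?thesis using opp_LC_parameters[OF pos r(1,2) r(3)[unfolded c_def Ga_def Gb_def]] r(1) by blast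
qed

text \<open>The discriminant is \<open>(l + h)\<^sup>2 R (R - 4 l h t)\<close>, which is positive for \<open>R < 0\<close>. The bound on \<open>a b\<close>
  makes the linear coefficient negative, so both roots are positive.\<close>

lemma opp_LC_both_positive:
  fixes a b h l t :: real
  assumes pos: "0 < l" "0 < h" "0 < a" "0 < b" "0 < t"
    and res: "(a - l * b) * (h * b - a) - t * (h - l)^2 < 0"
    and Ga: "a * b * (l + h) - l * h * b^2 - t * (l + h)^2 > 0"
    and Gb: "a * b * (l + h) - a^2 - t * (l + h)^2 > 0"
    and small: "a * b \<le> 2 * t * (l + h)"
  shows "\<exists>r k g. 0 < r \<and> 0 < k \<and> 0 < g \<and> k * b = g + l * h + h * r + r * l \<and> k * a = g * (l + h + r) + l * h * r \<and>
    g * (r + l) * (r + h) = k^2 * t"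
proof -
  define Ga Gb c R where "Ga = a * b * (l + h) - l * h * b^2 - t * (l + h)^2" and "Gb = a * b * (l + h) - a^2 - t * (l + h)^2"
    and "c = (l + h) * Gb + l * h * b * (2 * a - (l + h) * b)" and "R = (a - l * b) * (h * b - a) - t * (h - l)^2"
  have G: "Ga > 0" "Gb > 0" "R < 0" using assms by (simp_all add: Ga_def Gb_def R_def)
  have c: "c < 0"
  proof -
    have "c = (l + h) * R + 2 * (l * h) * (a * b - 2 * t * (l + h))" unfolding c_def Gb_def R_def by algebra
    moreover have "(l + h) * R < 0" using G pos by (simp add: mult_pos_neg)
    moreover have "2 * (l * h) * (a * b - 2 * t * (l + h)) \<le> 0" using small pos by (intro mult_nonneg_nonpos) auto
    ultimately show ?thesis by linarith
  qed
  define x0 where "x0 = - c / (2 * Ga)"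
  have x0: "x0 > 0" using c G unfolding x0_def by (intro divide_pos_pos) auto
  have xG: "2 * Ga * x0 = - c" using G by (simp add: x0_def)
  have "4 * Ga * (Ga * x0^2 + c * x0 + l * h * Gb) < 0"
  proof -
    have "4 * Ga * (Ga * x0^2 + c * x0 + l * h * Gb) = (2 * Ga * x0 + c)^2 - (c^2 - 4 * (l * h) * Ga * Gb)" by algebra
    also have "2 * Ga * x0 + c = 0" unfolding xG by simp
    also have "c^2 - 4 * (l * h) * Ga * Gb = (l + h)^2 * (R * (R - 4 * (l * h) * t))"
      unfolding c_def Ga_def Gb_def R_def by (simp add: algebra_simps power2_eq_square)
    also have "0^2 - (l + h)^2 * (R * (R - 4 * (l * h) * t)) = - ((l + h)^2 * (R * (R - 4 * (l * h) * t)))" by simp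
    also have "\<dots> < 0"
    proof -
      have "4 * (l * h) * t > 0" using pos by simp
      then have "R - 4 * (l * h) * t < 0" using G(3) by linarith
      then have "R * (R - 4 * (l * h) * t) > 0" using G(3) by (simp add: mult_neg_neg)
      then show ?thesis using pos by simp
    qed
    finally show ?thesis .
  qed
  then have "Ga * x0^2 + c * x0 + l * h * Gb < 0" using G by (simp add: mult_less_0_iff)
  then obtain r where r: "r > x0" "Ga * r^2 + c * r + l * h * Gb = 0" using quadratic_root_beyond[OF G(1)] by blast
  have r0: "r > 0" using r(1) x0 by simp
  have "a * a < a * (b * (l + h))"
  proof -
    have "t * (l + h)^2 > 0" using pos by simp
    then show ?thesis using G(2) by (simp add: Gb_def power2_eq_square mult_ac)
  qed
  then have "a < b * (l + h)" using pos by simp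
  also have "\<dots> < b * (l + h + r)" using pos r0 by simp
  finally have E: "a < b * (l + h + r)" .
  show ?thesis using opp_LC_parameters[OF pos r0 E r(2)[unfolded c_def Ga_def Gb_def]] r0 by blast
qed

text \<open>The parameter \<open>c\<close> is \<open>r/S\<close> with \<open>S = p q + q r + r p\<close>. The values \<open>Z(0)\<close> and \<open>Z(\<infinity>)\<close> then give
  \<open>p/S = 1/l - c\<close> and \<open>q/S = 1/h - c\<close>, whence \<open>1/S = 1/(l h) - c\<^sup>2\<close>; all resistances are positive exactly
  for \<open>0 < c < 1/h\<close>. The remaining equation is quadratic in \<open>c\<close>.\<close>

lemma ser_LC_parameters:
  fixes a b h l t c :: real
  assumes pos: "0 < l" "l < h" "0 < a" "0 < b" "0 < t" "0 < c" "c < 1 / h"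
    and root: "(4 * (l * h) * t - a^2) * c^2 + 2 * (a * b - 2 * t * (l + h)) * c
       = (a * b * (l + h) - a^2 - t * (l + h)^2) / (l * h)"
  shows "\<exists>p q r k g. 0 < p \<and> 0 < q \<and> 0 < r \<and> 0 < k \<and> 0 < g \<and>
    h * (r + q) = p * q + q * r + r * p \<and> l * (r + p) = p * q + q * r + r * p \<and>
    k * a = g * (p + q) \<and> k * b = p * q + q * r + r * p + g \<and> g * (p * q + q * r + r * p)^2 = k^2 * (l * h * t)"
proof -
  define L H where "L = 1 / l" and "H = 1 / h"
  have LH: "L * l = 1" "H * h = 1" using pos by (simp_all add: L_def H_def)
  have H: "0 < H" "H < L" "c < H" using pos by (simp_all add: L_def H_def frac_less2)
  define v u m where "v = L * H - c^2" and "u = L + H - 2 * c" and "m = l * h * t"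
  have "c * c < L * H" using H pos by (intro mult_strict_mono) auto
  then have v: "v > 0" by (simp add: v_def power2_eq_square)
  have u: "u > 0" using H by (simp add: u_def)
  have m: "m > 0" using pos by (simp add: m_def)
  have key: "a * b * u = m * u^2 + a^2 * v"
  proof -
    have "(a * b * (l + h) - a^2 - t * (l + h)^2) / (l * h) = (a * b * (l + h) - a^2 - t * (l + h)^2) * (L * H)"
      by (simp add: L_def H_def)
    also have "\<dots> = a * b * (L + H) - a^2 * (L * H) - m * (L + H)^2"
      unfolding m_def using LH by algebra
    finally have "(4 * (l * h) * t - a^2) * c^2 + 2 * (a * b - 2 * t * (l + h)) * c = a * b * (L + H) - a^2 * (L * H) - m * (L + H)^2"
      using root by simp
    moreover have "t * (l + h) = m * (L + H)" unfolding m_def using LH by algebra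
    ultimately show ?thesis unfolding u_def v_def m_def by algebra
  qed
  define S where "S = 1 / v"
  have S: "S > 0" and Sv: "S * v = 1" using v by (simp_all add: S_def)
  define p q r where "p = S * (L - c)" and "q = S * (H - c)" and "r = S * c"
  have pqr: "p > 0" "q > 0" "r > 0" using S H pos by (simp_all add: p_def q_def r_def)
  have Seq: "p * q + q * r + r * p = S"
  proof -
    have "p * q + q * r + r * p = S * (S * v)" unfolding p_def q_def r_def v_def by algebra
    then show ?thesis unfolding Sv by simp
  qed
  have c1: "h * (r + q) = S" "l * (r + p) = S" unfolding p_def q_def r_def using LH by algebra+
  have pq: "p + q = S * u" by (simp add: p_def q_def u_def algebra_simps)
  define k where "k = a * S / (m * u)"
  define g where "g = a^2 / (m * u^2)"
  have k: "k > 0" and g: "g > 0" using pos S m u by (simp_all add: k_def g_def)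
  have c2: "k * a = g * (p + q)" unfolding pq k_def g_def using m u by (simp add: field_simps power2_eq_square)
  have c3: "k * b = S + g"
  proof -
    have "m * u^2 * (k * b) = S * (a * b * u)" unfolding k_def using m u by (simp add: field_simps power2_eq_square)
    also have "\<dots> = S * m * u^2 + a^2 * (S * v)" unfolding key by (simp add: algebra_simps)
    also have "\<dots> = m * u^2 * (S + g)" unfolding Sv g_def using m u by (simp add: field_simps)
    finally show ?thesis using m u by simp
  qed
  have c4: "g * S^2 = k^2 * m" unfolding k_def g_def using m u by (simp add: field_simps power2_eq_square)
  show ?thesis
    using pqr k g c1 c2 c3 c4 by (intro exI[of _ p] exI[of _ q] exI[of _ r] exI[of _ k] exI[of _ g]) (simp add: Seq m_def)
qed

text \<open>The signs of the quadratic at the ends \<open>0\<close> and \<open>1/h\<close> of the admissible interval are those of \<open>\<Gamma>\<^sub>b\<close>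
  and \<open>\<E>\<^sub>a\<close>.\<close>

lemma ser_LC_opposite_signs:
  fixes a b h l t :: real
  assumes pos: "0 < l" "l < h" "0 < a" "0 < b" "0 < t"
    and Gb: "a * b * (l + h) - a^2 - t * (l + h)^2 < 0"
    and Ea: "a * (h * b - a) - t * h * (h - l) > 0"
  shows "\<exists>c>0. c < 1 / h \<and> (4 * (l * h) * t - a^2) * c^2 + 2 * (a * b - 2 * t * (l + h)) * c
       = (a * b * (l + h) - a^2 - t * (l + h)^2) / (l * h)"
proof -
  define G where "G = (a * b * (l + h) - a^2 - t * (l + h)^2) / (l * h)"
  define f where "f = (\<lambda>c. G - ((4 * (l * h) * t - a^2) * c^2 + 2 * (a * b - 2 * t * (l + h)) * c))"
  have "f 0 < 0" using Gb pos by (simp add: f_def G_def divide_neg_pos)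
  moreover have "f (1 / h) > 0"
  proof -
    have "l * h^2 * f (1 / h) = (h - l) * (a * (h * b - a) - t * h * (h - l))"
      unfolding f_def G_def using pos by (simp add: field_simps power2_eq_square)
    moreover have "(h - l) * (a * (h * b - a) - t * h * (h - l)) > 0" using Ea pos by simp
    ultimately have "0 < l * h^2 * f (1 / h)" by simp
    then show ?thesis by (rule zero_less_mult_pos) (use pos in simp)
  qed
  moreover have "\<And>x. isCont f x" unfolding f_def by (intro continuous_intros)
  ultimately obtain c where c: "0 \<le> c" "c \<le> 1 / h" "f c = 0"
    using IVT[of f 0 0 "1 / h"] pos by auto
  have "c \<noteq> 0" "c \<noteq> 1 / h" using c(3) \<open>f 0 < 0\<close> \<open>f (1 / h) > 0\<close> by auto
  then show ?thesis using c unfolding f_def G_def by (intro exI[of _ c]) auto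
qed

text \<open>The quadratic is negative at \<open>0\<close> and concave with vertex \<open>K/w\<close> inside the admissible interval. Its
  value at the vertex has the sign of \<open>- R\<close>.\<close>

lemma ser_LC_both_positive:
  fixes a b h l t :: real
  assumes pos: "0 < l" "l < h" "0 < a" "0 < b" "0 < t"
    and res: "(a - l * b) * (h * b - a) - t * (h - l)^2 < 0"
    and Gb: "a * b * (l + h) - a^2 - t * (l + h)^2 > 0"
    and large: "a * b > 2 * t * (l + h)" and vertex: "h * (a * b - 2 * t * (l + h)) < a^2 - 4 * (l * h) * t"
  shows "\<exists>c>0. c < 1 / h \<and> (4 * (l * h) * t - a^2) * c^2 + 2 * (a * b - 2 * t * (l + h)) * c
       = (a * b * (l + h) - a^2 - t * (l + h)^2) / (l * h)"
proof -
  define G K w where "G = (a * b * (l + h) - a^2 - t * (l + h)^2) / (l * h)" and "K = a * b - 2 * t * (l + h)"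
    and "w = a^2 - 4 * (l * h) * t"
  define f where "f = (\<lambda>c. (4 * (l * h) * t - a^2) * c^2 + 2 * K * c - G)"
  have K: "K > 0" using large by (simp add: K_def)
  then have w: "w > 0" using vertex pos by (smt (verit) K_def w_def mult_pos_pos)
  have G: "G > 0" using Gb pos by (simp add: G_def)
  have lhG: "l * h * G = a * b * (l + h) - a^2 - t * (l + h)^2" using pos by (simp add: G_def)
  have "f 0 < 0" using G by (simp add: f_def)
  moreover have fv: "f (K / w) > 0"
  proof -
    have z: "K / w * w = K" using w by simp
    have "w * f c = - ((c * w)^2) + 2 * K * (c * w) - w * G" for c
      unfolding f_def w_def by (simp add: algebra_simps power2_eq_square)
    from this[of "K / w"] have "w * f (K / w) = K^2 - w * G" unfolding z by (simp add: power2_eq_square)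
    moreover have "l * h * (K^2 - w * G) = a^2 * (- ((a - l * b) * (h * b - a) - t * (h - l)^2))"
    proof -
      have "l * h * (K^2 - w * G) = l * h * K^2 - w * (l * h * G)" by (simp add: algebra_simps)
      also have "\<dots> = a^2 * (- ((a - l * b) * (h * b - a) - t * (h - l)^2))"
        unfolding lhG K_def w_def by algebra
      finally show ?thesis .
    qed
    moreover have "a^2 * (- ((a - l * b) * (h * b - a) - t * (h - l)^2)) > 0" using res pos by simp
    ultimately have "0 < (l * h * w) * f (K / w)" by (simp add: mult_ac)
    then show ?thesis by (rule zero_less_mult_pos) (use pos w in simp)
  qed
  moreover have "\<And>x. isCont f x" unfolding f_def by (intro continuous_intros)
  ultimately obtain c where c: "0 \<le> c" "c \<le> K / w" "f c = 0"
    using IVT[of f 0 0 "K / w"] K w by auto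
  have "c \<noteq> 0" using c(3) \<open>f 0 < 0\<close> by auto
  moreover have "K / w < 1 / h"
  proof -
    have "h * K < w" using vertex by (simp only: K_def w_def)
    then show ?thesis using w pos by (simp add: field_simps)
  qed
  ultimately show ?thesis using c unfolding f_def G_def K_def by (intro exI[of _ c]) auto
qed

text \<open>The two alternatives say that the vertex lies in the admissible interval for \<open>Z\<close>, respectively for
  \<open>1/Z(1/s)\<close>. If both fail, then \<open>a\<^sup>2\<close> and \<open>l h b\<^sup>2\<close> are at most \<open>X\<close>, and \<open>(X - a\<^sup>2) (X - l h b\<^sup>2) \<ge> 0\<close>
  contradicts \<open>R < 0\<close>.\<close>

lemma vertex_alternative:
  fixes a b h l t :: real
  assumes pos: "0 < l" "l < h" "0 < a" "0 < b" "0 < t"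
    and res: "(a - l * b) * (h * b - a) - t * (h - l)^2 < 0"
    and large: "a * b > 2 * t * (l + h)"
  shows "h * (a * b - 2 * t * (l + h)) < a^2 - 4 * (l * h) * t \<or> a * b - 2 * t * (l + h) < l * (b^2 - 4 * t)"
proof (rule ccontr)
  assume "\<not> ?thesis"
  then have n: "h * (a * b - 2 * t * (l + h)) \<ge> a^2 - 4 * (l * h) * t" "a * b - 2 * t * (l + h) \<ge> l * (b^2 - 4 * t)" by auto
  define X where "X = h * (a * b - 2 * t * (h - l))"
  have Xe: "X = h * (a * b - 2 * t * (l + h)) + 4 * (l * h) * t" by (simp add: X_def algebra_simps)
  have Xa: "X \<ge> a^2" using n(1) Xe by simp
  have "h * (a * b - 2 * t * (l + h)) \<ge> h * (l * (b^2 - 4 * t))" using n(2) pos by (intro mult_left_mono) auto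
  then have Xb: "X \<ge> l * h * b^2" using Xe by (simp add: algebra_simps)
  have X: "X > 0" using Xa pos by (smt (verit) zero_less_power)
  have "(X - a^2) * (X - l * h * b^2) \<ge> 0" using Xa Xb by simp
  moreover have "X * ((a - l * b) * (h * b - a) - t * (h - l)^2) < 0" using X res by (simp add: mult_pos_neg)
  moreover have "(X - a^2) * (X - l * h * b^2) - X * ((a - l * b) * (h * b - a) - t * (h - l)^2)
     = h * t * (h - l)^2 * (2 * t * (l + h) - a * b)"
    unfolding X_def by algebra
  moreover have "h * t * (h - l)^2 * (2 * t * (l + h) - a * b) < 0" using pos large by (simp add: mult_pos_neg)
  ultimately show False by linarith
qed

text \<open>The values \<open>Z(0)\<close> and \<open>Z(\<infinity>)\<close> give the ratio of \<open>q\<close> to \<open>s = p + r\<close> and a quadratic equation for \<open>s\<close>,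
  which has a unique positive root; the middle coefficients give \<open>k\<close> and \<open>g = x y\<close>. The last equation
  \<open>main\<close>, reduced modulo the equation for \<open>s\<close>, loses its dependence on \<open>s\<close> and becomes the hypothesis
  \<open>root\<close> (in the form \<open>quad\<close>). As the left-hand side of \<open>main\<close> is positive, so are \<open>k\<close> and \<open>g\<close>.\<close>

lemma arm_LC_parameters:
  fixes a b h l t r :: real
  assumes pos: "0 < l" "l < h" "0 < a" "0 < b" "0 < t" "0 < r"
    and root: "(b * (a - l * b) - t * (h - l)) * r^2 + ((a - l * b) * (h * b - a) - t * (h - l)^2 + 2 * l * t * (h - l)) * r
      + l * (a * (h * b - a) - t * h * (h - l)) = 0"
  shows "\<exists>p q k g. 0 < p \<and> 0 < q \<and> 0 < k \<and> 0 < g \<and>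
    p * q + p * r + q * r = h * (p + r) \<and> p * (q + r) = l * (p + q + r) \<and>
    k * b = g + q * (p + r) \<and> k * a = g * (q + r) + p * q * r \<and> g * (p + r) * (p + q + r) = k^2 * t"
proof -
  define d n e where "d = h - l" and "n = l + r" and "e = h - r"
  have d: "d > 0" and n: "n > 0" using pos by (simp_all add: d_def n_def)
  define s where "s = (n * e + sqrt ((n * e)^2 + 4 * d * n * r^2)) / (2 * d)"
  have dr: "4 * d * n * r^2 > 0" using d n pos by simp
  have "n * e + sqrt ((n * e)^2 + 4 * d * n * r^2) > 0"
  proof -
    have "(n * e)^2 < (n * e)^2 + 4 * d * n * r^2" using dr by simp
    then have "\<bar>n * e\<bar> < sqrt ((n * e)^2 + 4 * d * n * r^2)" by (intro real_less_rsqrt) simp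
    then show ?thesis by linarith
  qed
  then have s: "s > 0" using d by (simp add: s_def)
  have "2 * d * s - n * e = sqrt ((n * e)^2 + 4 * d * n * r^2)" using d by (simp add: s_def)
  then have "(2 * d * s - n * e)^2 = (n * e)^2 + 4 * d * n * r^2" using dr by (simp add: add_nonneg_nonneg)
  then have "4 * d * (d * s^2) = 4 * d * (n * (e * s + r^2))" by (simp add: power2_eq_square algebra_simps)
  then have ds: "d * s^2 = n * (e * s + r^2)" using d by simp
  define q p where "q = d * s / n" and "p = s - r"
  have q: "q > 0" using d s n by (simp add: q_def)
  have nq: "n * q = d * s" using n by (simp add: q_def)
  have qs: "q * s = e * s + r^2"
  proof -
    have "n * (q * s) = (n * q) * s" by simp
    also have "\<dots> = d * s^2" unfolding nq by (simp add: power2_eq_square)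
    finally have "n * (q * s) = n * (e * s + r^2)" unfolding ds .
    then show ?thesis using n by simp
  qed
  have p: "p > 0"
  proof (rule ccontr)
    assume "\<not> p > 0"
    then have sr: "s \<le> r" by (simp add: p_def)
    have "d * r < h * n" using pos by (simp add: d_def n_def algebra_simps add_pos_pos)
    then have "d * r * s^2 < h * n * s^2" using s by simp
    moreover have "d * r * s^2 = r * (n * (e * s + r^2))" using ds by (simp add: mult_ac)
    moreover have "r * (n * (e * s + r^2)) - h * n * s^2 = n * ((r - s) * (h * s + r^2))"
      unfolding e_def by algebra
    moreover have "n * ((r - s) * (h * s + r^2)) \<ge> 0"
      using n sr s pos by (intro mult_nonneg_nonneg add_nonneg_nonneg) auto
    ultimately show False by linarith
  qed
  define A C Y where "A = a - r * b" and "C = h * b - a" and "Y = e * s + 2 * r^2"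
  have AC: "A + C = e * b" by (simp add: A_def C_def e_def algebra_simps)
  have quad: "d * b^2 * r^2 + A * C * n = t * d * ((h + r) * n - 4 * l * r)"
  proof -
    have "d * b^2 * r^2 + A * C * n - t * d * ((h + r) * n - 4 * l * r) = 
      (b * (a - l * b) - t * (h - l)) * r^2 + ((a - l * b) * (h * b - a) - t * (h - l)^2 + 2 * l * t * (h - l)) * r
      + l * (a * (h * b - a) - t * h * (h - l))"
      unfolding A_def C_def d_def n_def by algebra
    then show ?thesis using root by simp
  qed
  have Y: "Y = q * s + r^2" unfolding Y_def qs by simp
  have main: "q * Y^2 * t = s * (q + s) * (r^2 * b + s * A) * (q * b - A)"
  proof -
    have Y2: "n * Y^2 = s^2 * (n * e^2 + 4 * d * r^2)"
    proof -
      have "n * Y^2 = n * e^2 * s^2 + 4 * r^2 * (n * (e * s + r^2))" unfolding Y_def by algebra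
      then show ?thesis unfolding ds[symmetric] by (simp add: algebra_simps)
    qed
    have f: "n * e^2 + 4 * d * r^2 = (h + r) * ((h + r) * n - 4 * l * r)"
      unfolding n_def e_def d_def by algebra
    have lhs: "n * (d * Y^2 * t) = (h + r) * s^2 * (d * b^2 * r^2 + A * C * n)"
    proof -
      have "n * (d * Y^2 * t) = d * t * (n * Y^2)" by simp
      also have "\<dots> = (h + r) * s^2 * (t * d * ((h + r) * n - 4 * l * r))" unfolding Y2 f by simp
      finally show ?thesis unfolding quad .
    qed
    have g1: "n * (q + s) = (h + r) * s"
    proof -
      have "n * (q + s) = n * q + n * s" by (simp add: distrib_left)
      also have "\<dots> = (h + r) * s" unfolding nq by (simp add: d_def n_def algebra_simps)
      finally show ?thesis .
    qed
    have g2: "s * (q * b - A) = r^2 * b + s * C"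
    proof -
      have "s * (q * b - A) = (q * s) * b - s * A" by (simp add: algebra_simps)
      also have "\<dots> = r^2 * b + s * (e * b - A)" unfolding qs by (simp add: algebra_simps)
      also have "e * b - A = C" using AC by simp
      finally show ?thesis .
    qed
    have g3: "n * ((r^2 * b + s * A) * (r^2 * b + s * C)) = s^2 * (d * b^2 * r^2 + A * C * n)"
    proof -
      have "(r^2 * b + s * A) * (r^2 * b + s * C) = b^2 * r^4 + r^2 * b * s * (A + C) + s^2 * (A * C)"
        by (simp add: algebra_simps power2_eq_square power4_eq_xxxx)
      also have "\<dots> = b^2 * r^2 * (e * s + r^2) + s^2 * (A * C)" unfolding AC by (simp add: algebra_simps power2_eq_square power4_eq_xxxx)
      finally have "n * ((r^2 * b + s * A) * (r^2 * b + s * C)) = b^2 * r^2 * (n * (e * s + r^2)) + s^2 * (A * C * n)"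
        by (simp add: algebra_simps)
      then show ?thesis unfolding ds[symmetric] by (simp add: algebra_simps)
    qed
    have "n^2 * (q * Y^2 * t) = s * (n * (d * Y^2 * t))" using nq by (simp add: power2_eq_square)
    also have "\<dots> = s * (h + r) * (n * ((r^2 * b + s * A) * (r^2 * b + s * C)))" unfolding lhs g3 by (simp add: mult_ac)
    also have "\<dots> = s * (h + r) * n * (r^2 * b + s * A) * (s * (q * b - A))" unfolding g2 by (simp add: mult_ac)
    also have "\<dots> = n * s * ((h + r) * s) * (r^2 * b + s * A) * (q * b - A)" by (simp add: mult_ac)
    also have "\<dots> = n^2 * (s * (q + s) * (r^2 * b + s * A) * (q * b - A))" unfolding g1[symmetric] by (simp add: mult_ac power2_eq_square)
    finally show ?thesis using n by simp
  qed
  have Ypos: "Y > 0" unfolding Y using q s pos by (simp add: add_pos_pos)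
  have "q * Y^2 * t > 0" using q Ypos pos by simp
  then have "(s * (q + s)) * ((r^2 * b + s * A) * (q * b - A)) > 0" unfolding main by (simp add: mult_ac)
  then have pr: "(r^2 * b + s * A) * (q * b - A) > 0" by (rule zero_less_mult_pos) (use s q in simp)
  have E: "q * b - A > 0" and N: "r^2 * b + s * A > 0"
  proof -
    have "\<not> (r^2 * b + s * A < 0 \<and> q * b - A < 0)"
    proof
      assume neg: "r^2 * b + s * A < 0 \<and> q * b - A < 0"
      have "r^2 * b > 0" "q * b > 0" using pos q by simp_all
      then have "A > 0" using neg by linarith
      then have "s * A > 0" using s by simp
      then show False using neg \<open>r^2 * b > 0\<close> by linarith
    qed
    then show "q * b - A > 0" "r^2 * b + s * A > 0" using pr by (auto simp: zero_less_mult_iff)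
  qed
  define k where "k = q * Y / (q * b - A)"
  define g where "g = k * b - q * s"
  have k: "k > 0" using q Ypos E by (simp add: k_def)
  have kE: "k * (q * b - A) = q * Y" using E by (simp add: k_def)
  have gE: "g * (q * b - A) = q * (r^2 * b + s * A)"
  proof -
    have "g * (q * b - A) = (k * (q * b - A)) * b - q * s * (q * b - A)" by (simp add: g_def algebra_simps)
    also have "\<dots> = q * (r^2 * b + s * A)" unfolding kE Y by (simp add: algebra_simps)
    finally show ?thesis .
  qed
  have g: "g > 0"
  proof -
    have "(q * b - A) * g > 0" using gE q N by (simp add: mult.commute)
    then show ?thesis by (rule zero_less_mult_pos) (rule E)
  qed
  have c1: "p * q + p * r + q * r = h * (p + r)"
  proof -
    have "p * q + p * r + q * r = q * s + s * r - r^2" by (simp add: p_def algebra_simps power2_eq_square)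
    then show ?thesis unfolding qs by (simp add: p_def e_def algebra_simps)
  qed
  have c2: "p * (q + r) = l * (p + q + r)"
  proof -
    have "p * (q + r) = q * s + s * r - r^2 - r * q" by (simp add: p_def algebra_simps power2_eq_square)
    also have "\<dots> = h * s - r * q" unfolding qs by (simp add: e_def algebra_simps)
    also have "\<dots> = l * (p + q + r)" using nq unfolding n_def d_def p_def by (simp add: algebra_simps)
    finally show ?thesis .
  qed
  have c3: "k * b = g + q * (p + r)" by (simp add: g_def p_def)
  have c4: "k * a = g * (q + r) + p * q * r"
  proof -
    have "k * A = q * (g - r^2)"
    proof -
      have "k * A = q * (k * b) - k * (q * b - A)" by (simp add: algebra_simps)
      also have "\<dots> = q * (g - r^2)" unfolding kE Y by (simp add: g_def algebra_simps)
      finally show ?thesis .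
    qed
    then have "k * a = q * (g - r^2) + r * (k * b)" by (simp add: A_def algebra_simps)
    then show ?thesis unfolding c3 by (simp add: algebra_simps power2_eq_square)
  qed
  have c5: "g * (p + r) * (p + q + r) = k^2 * t"
  proof -
    have "(q * b - A)^2 * (g * (p + r) * (p + q + r)) = (g * (q * b - A)) * (s * (q + s) * (q * b - A))"
      by (simp add: p_def power2_eq_square algebra_simps)
    also have "\<dots> = q * (s * (q + s) * (r^2 * b + s * A) * (q * b - A))" unfolding gE by (simp add: mult_ac)
    also have "\<dots> = (k * (q * b - A))^2 * t" unfolding main[symmetric] kE by (simp add: power2_eq_square mult_ac)
    also have "\<dots> = (q * b - A)^2 * (k^2 * t)" by (simp add: power_mult_distrib)
    finally show ?thesis using E by simp
  qed
  show ?thesis using p q k g c1 c2 c3 c4 c5 by (intro exI[of _ p] exI[of _ q] exI[of _ k] exI[of _ g]) simp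
qed

text \<open>The discriminant of the equation for \<open>r\<close> is the product of the two nonpositive quantities \<open>\<R>\<close> and
  \<open>opp_disc\<close> (both divided by \<open>t\<close>), and the signs of the coefficients make the roots positive.\<close>

lemma arm_LC_solvable:
  fixes a b h l t :: real
  assumes pos: "0 < l" "l < h" "0 < a" "0 < b" "0 < t"
    and res: "(a - l * b) * (h * b - a) - t * (h - l)^2 < 0"
    and disc: "(a - l * b) * (h * b - a) - t * (h - l)^2 - 4 * l * (a * b - 2 * t * (h - l)) \<le> 0"
    and Db: "b * (a - l * b) - t * (h - l) < 0" and Ea: "a * (h * b - a) - t * h * (h - l) < 0"
    and tr: "(a - l * b) * (h * b - a) - t * (h - l)^2 + 2 * l * t * (h - l) > 0"
  shows "\<exists>r p q k g. 0 < r \<and> 0 < p \<and> 0 < q \<and> 0 < k \<and> 0 < g \<and>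
    p * q + p * r + q * r = h * (p + r) \<and> p * (q + r) = l * (p + q + r) \<and>
    k * b = g + q * (p + r) \<and> k * a = g * (q + r) + p * q * r \<and> g * (p + r) * (p + q + r) = k^2 * t"
proof -
  define D E T where "D = b * (a - l * b) - t * (h - l)" and "E = a * (h * b - a) - t * h * (h - l)"
    and "T = (a - l * b) * (h * b - a) - t * (h - l)^2 + 2 * l * t * (h - l)"
  have DET: "D < 0" "E < 0" "T > 0" using Db Ea tr by (simp_all add: D_def E_def T_def)
  have "T^2 - 4 * D * (l * E) = ((a - l * b) * (h * b - a) - t * (h - l)^2)
     * ((a - l * b) * (h * b - a) - t * (h - l)^2 - 4 * l * (a * b - 2 * t * (h - l)))"
    unfolding D_def E_def T_def by algebra
  also have "\<dots> \<ge> 0" using res disc by (simp add: mult_nonpos_nonpos)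
  finally have q: "T^2 - 4 * D * (l * E) \<ge> 0" .
  define r where "r = (T + sqrt (T^2 - 4 * D * (l * E))) / (- 2 * D)"
  have "T + sqrt (T^2 - 4 * D * (l * E)) > 0" using DET q by (simp add: add_pos_nonneg)
  then have r: "r > 0" unfolding r_def by (rule divide_pos_pos) (use DET in simp)
  have "- 2 * D * r = T + sqrt (T^2 - 4 * D * (l * E))" using DET by (simp add: r_def)
  then have "- 2 * D * r - T = sqrt (T^2 - 4 * D * (l * E))" by simp
  then have "(- 2 * D * r - T)^2 = T^2 - 4 * D * (l * E)" using q by simp
  then have "4 * D * (D * r^2 + T * r + l * E) = 0" by algebra
  then have "D * r^2 + T * r + l * E = 0" using DET by simp
  then show ?thesis using arm_LC_parameters[OF pos r] r unfolding D_def E_def T_def by blast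
qed

section \<open>From element values to realizations\<close>

lemma reduced_form:
  assumes "pos_coeffs Z" "\<B> Z < 0"
  obtains l h t where "0 < l" "l < h" "0 < t" "a\<^sub>0 Z = l * b\<^sub>0 Z" "a\<^sub>2 Z = h * b\<^sub>2 Z" "t = b\<^sub>0 Z * b\<^sub>2 Z"
    "\<R> Z = t * ((a\<^sub>1 Z - l * b\<^sub>1 Z) * (h * b\<^sub>1 Z - a\<^sub>1 Z) - t * (h - l)^2)"
    "opp_disc Z = t * ((a\<^sub>1 Z - l * b\<^sub>1 Z) * (h * b\<^sub>1 Z - a\<^sub>1 Z) - t * (h - l)^2 - 4 * l * (a\<^sub>1 Z * b\<^sub>1 Z - 2 * t * (h - l)))"
    "arm_disc Z = t * ((a\<^sub>1 Z - l * b\<^sub>1 Z) * (h * b\<^sub>1 Z - a\<^sub>1 Z) - t * (h - l)^2 - 4 * l * h * t)"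
    "arm_LC_linear_coeff Z = t * ((a\<^sub>1 Z - l * b\<^sub>1 Z) * (h * b\<^sub>1 Z - a\<^sub>1 Z) - t * (h - l)^2 + 2 * l * t * (h - l))"
    "\<D>\<^sub>b Z = b\<^sub>0 Z * (b\<^sub>1 Z * (a\<^sub>1 Z - l * b\<^sub>1 Z) - t * (h - l))"
    "\<E>\<^sub>a Z = b\<^sub>2 Z * (a\<^sub>1 Z * (h * b\<^sub>1 Z - a\<^sub>1 Z) - t * h * (h - l))"
    "\<Gamma>\<^sub>a Z = t * (a\<^sub>1 Z * b\<^sub>1 Z * (l + h) - l * h * (b\<^sub>1 Z)^2 - t * (l + h)^2)"
    "\<Gamma>\<^sub>b Z = t * (a\<^sub>1 Z * b\<^sub>1 Z * (l + h) - (a\<^sub>1 Z)^2 - t * (l + h)^2)"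
proof -
  have pos: "a\<^sub>0 Z > 0" "b\<^sub>2 Z > 0" "b\<^sub>0 Z > 0" using assms by (simp_all add: pos_coeffs_def)
  define l h t where "l = a\<^sub>0 Z / b\<^sub>0 Z" and "h = a\<^sub>2 Z / b\<^sub>2 Z" and "t = b\<^sub>0 Z * b\<^sub>2 Z"
  have e: "a\<^sub>0 Z = l * b\<^sub>0 Z" "a\<^sub>2 Z = h * b\<^sub>2 Z" using pos by (simp_all add: l_def h_def)
  have "l < h" using assms(2) pos by (simp add: l_def h_def \<B>_def field_simps)
  moreover have "0 < l" "0 < t" using pos by (simp_all add: l_def t_def)
  ultimately show thesis
    by (intro that[OF _ _ _ e t_def])
      (simp_all add: biquad_invariants opp_disc_def arm_disc_def arm_LC_linear_coeff_def \<Gamma>\<^sub>a_def \<Gamma>\<^sub>b_def e t_def algebra_simps power2_eq_square)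
qed

lemma opp_LL_sufficient:
  assumes Z: "pos_coeffs Z" "\<B> Z < 0" and "\<R> Z > 0" "opp_disc Z \<ge> 0"
  shows "opp_LL Z"
proof -
  have b0: "b\<^sub>0 Z > 0" and ab: "a\<^sub>1 Z > 0" "b\<^sub>1 Z > 0" using Z by (simp_all add: pos_coeffs_def)
  obtain l h t where lht: "0 < l" "l < h" "0 < t" "a\<^sub>0 Z = l * b\<^sub>0 Z" "a\<^sub>2 Z = h * b\<^sub>2 Z" "t = b\<^sub>0 Z * b\<^sub>2 Z"
    and R: "\<R> Z = t * ((a\<^sub>1 Z - l * b\<^sub>1 Z) * (h * b\<^sub>1 Z - a\<^sub>1 Z) - t * (h - l)^2)"
    and Q: "opp_disc Z = t * ((a\<^sub>1 Z - l * b\<^sub>1 Z) * (h * b\<^sub>1 Z - a\<^sub>1 Z) - t * (h - l)^2 - 4 * l * (a\<^sub>1 Z * b\<^sub>1 Z - 2 * t * (h - l)))"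
    by (rule reduced_form[OF Z])
  have R': "(a\<^sub>1 Z - l * b\<^sub>1 Z) * (h * b\<^sub>1 Z - a\<^sub>1 Z) - t * (h - l)^2 > 0"
    using assms(3) lht(3) unfolding R by (rule zero_less_mult_pos)
  have Q': "(a\<^sub>1 Z - l * b\<^sub>1 Z) * (h * b\<^sub>1 Z - a\<^sub>1 Z) - t * (h - l)^2 - 4 * l * (a\<^sub>1 Z * b\<^sub>1 Z - 2 * t * (h - l)) \<ge> 0"
    using assms(4) lht(3) unfolding Q by (simp only: zero_le_mult_iff) auto
  obtain p q r X Y where s: "0 < p" "0 < q" "0 < r" "0 < X" "0 < Y" "p + q + r = h"
    "p * q * r = l * (p * q + q * r + r * p)" "X + Y = (p * q + q * r + r * p) * b\<^sub>1 Z"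
    "q * X + p * Y = (p * q + q * r + r * p) * a\<^sub>1 Z" "X * Y = (p * q + q * r + r * p) * t * (r + p) * (r + q)"
    using opp_LL_solvable[OF lht(1,2) ab lht(3) R' Q'] by (elim exE conjE) (rule that)
  define K where "K = p * q + q * r + r * p"
  have K: "K > 0" using s by (simp add: K_def add_pos_pos)
  note s' = s(7-10)[folded K_def]
  define x y k where "x = X / (b\<^sub>0 Z * (r + p))" and "y = Y / (b\<^sub>0 Z * (r + q))" and "k = K / b\<^sub>0 Z"
  have pos: "x > 0" "y > 0" "k > 0" using s b0 K by (simp_all add: x_def y_def k_def)
  have xr: "x * (r + p) = X / b\<^sub>0 Z" "y * (r + q) = Y / b\<^sub>0 Z" using s(1-3) b0 by (simp_all add: x_def y_def)
  have nz: "r + p \<noteq> 0" "r + q \<noteq> 0" using s(1-3) by simp_all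
  have xy: "x * y = k * b\<^sub>2 Z"
  proof -
    have "x * y = X * Y / ((b\<^sub>0 Z)^2 * (r + p) * (r + q))" by (simp add: x_def y_def power2_eq_square)
    also have "\<dots> = k * b\<^sub>2 Z" unfolding s'(4) lht(6) k_def using nz b0 by (simp add: power2_eq_square)
    finally show ?thesis .
  qed
  have k0: "k * b\<^sub>0 Z = K" using b0 by (simp add: k_def)
  have c: "k * a\<^sub>2 Z = x * y * (p + q + r)" "k * a\<^sub>0 Z = p * q * r"
    unfolding xy lht(4,5) s(6) s'(1) using k0 by (simp_all add: mult_ac)
  have c1: "k * b\<^sub>1 Z = x * (r + p) + y * (r + q)"
    unfolding xr k_def using s'(2) by (simp flip: add_divide_distrib)
  have c2: "k * a\<^sub>1 Z = x * q * (r + p) + y * p * (r + q)"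
  proof -
    have "x * q * (r + p) + y * p * (r + q) = q * (x * (r + p)) + p * (y * (r + q))" by (simp add: mult_ac)
    also have "\<dots> = (q * X + p * Y) / b\<^sub>0 Z" unfolding xr by (simp add: add_divide_distrib)
    finally show ?thesis unfolding s'(3) k_def by simp
  qed
  have "proportional Z (x * y * (p + q + r)) (x * q * (r + p) + y * p * (r + q)) (p * q * r) (x * y) (x * (r + p) + y * (r + q)) (p * q + q * r + r * p)"
    unfolding proportional_def
    by (intro exI[of _ k] conjI pos c c1 c2 xy[symmetric]) (simp only: k0 K_def)
  then show ?thesis unfolding opp_LL_def using pos s(1-3) by blast
qed

lemma arm_LL_sufficient:
  assumes Z: "pos_coeffs Z" "\<B> Z < 0" and "arm_disc Z \<ge> 0"
  shows "arm_LL Z"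
proof -
  have b0: "b\<^sub>0 Z > 0" and ab: "a\<^sub>1 Z > 0" "b\<^sub>1 Z > 0" using Z by (simp_all add: pos_coeffs_def)
  obtain l h t where lht: "0 < l" "l < h" "0 < t" "a\<^sub>0 Z = l * b\<^sub>0 Z" "a\<^sub>2 Z = h * b\<^sub>2 Z" "t = b\<^sub>0 Z * b\<^sub>2 Z"
    and Q: "arm_disc Z = t * ((a\<^sub>1 Z - l * b\<^sub>1 Z) * (h * b\<^sub>1 Z - a\<^sub>1 Z) - t * (h - l)^2 - 4 * l * h * t)"
    by (rule reduced_form[OF Z])
  have "(a\<^sub>1 Z - l * b\<^sub>1 Z) * (h * b\<^sub>1 Z - a\<^sub>1 Z) - t * (h - l)^2 - 4 * l * h * t \<ge> 0"
    using assms(3) lht(3) unfolding Q by (simp only: zero_le_mult_iff) auto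
  then have Q': "(a\<^sub>1 Z - l * b\<^sub>1 Z) * (h * b\<^sub>1 Z - a\<^sub>1 Z) - t * (h - l)^2 \<ge> 4 * l * h * t" by simp
  obtain p q r X Y where s: "0 < p" "0 < q" "0 < r" "0 < X" "0 < Y" "q + r = h"
    "p * r = l * (p + r)" "q * (p + r) * b\<^sub>1 Z = Y * (p + q + r) + X * (p + r)"
    "q * (p + r) * a\<^sub>1 Z = Y * p * (q + r) + X * (p * q + p * r + q * r)" "X * Y = q * (p + r) * t"
    using arm_LL_solvable[OF lht(1,2) ab lht(3) Q'] by (elim exE conjE) (rule that)
  define x y k where "x = X / b\<^sub>0 Z" and "y = Y / b\<^sub>0 Z" and "k = q * (p + r) / b\<^sub>0 Z"
  have pos: "x > 0" "y > 0" "k > 0" using s b0 by (simp_all add: x_def y_def k_def)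
  have xy: "x * y = k * b\<^sub>2 Z"
  proof -
    have "x * y = X * Y / (b\<^sub>0 Z)^2" by (simp add: x_def y_def power2_eq_square)
    also have "\<dots> = k * b\<^sub>2 Z" unfolding s(10) lht(6) k_def using b0 by (simp add: power2_eq_square)
    finally show ?thesis .
  qed
  have k0: "k * b\<^sub>0 Z = q * (p + r)" using b0 by (simp add: k_def)
  have c: "k * a\<^sub>2 Z = x * y * (q + r)" unfolding xy lht(5) s(6) by simp
  have c0: "k * a\<^sub>0 Z = p * q * r"
  proof -
    have "k * a\<^sub>0 Z = q * (l * (p + r))" unfolding lht(4) using k0 by (simp add: mult_ac)
    then show ?thesis unfolding s(7)[symmetric] by (simp add: mult_ac)
  qed
  have c1: "k * b\<^sub>1 Z = y * (p + q + r) + x * (p + r)"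
    using s(8) unfolding k_def x_def y_def by (simp add: add_divide_distrib)
  have c2: "k * a\<^sub>1 Z = y * p * (q + r) + x * (p * q + p * r + q * r)"
    using s(9) unfolding k_def x_def y_def by (simp add: add_divide_distrib)
  have "proportional Z (x * y * (q + r)) (y * p * (q + r) + x * (p * q + p * r + q * r)) (p * q * r)
     (x * y) (y * (p + q + r) + x * (p + r)) (q * (p + r))"
    unfolding proportional_def
    by (intro exI[of _ k] conjI pos c c0 c1 c2 xy[symmetric] k0)
  then show ?thesis unfolding arm_LL_def using pos s(1-3) by blast
qed

lemma opp_LC_of_parameters:
  assumes Z: "pos_coeffs Z" and lh: "0 < l" "0 < h" "a\<^sub>0 Z = l * b\<^sub>0 Z" "a\<^sub>2 Z = h * b\<^sub>2 Z"
    and ex: "\<exists>r k g. 0 < r \<and> 0 < k \<and> 0 < g \<and> k * b\<^sub>1 Z = g + l * h + h * r + r * l \<and> k * a\<^sub>1 Z = g * (l + h + r) + l * h * r \<and>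
    g * (r + l) * (r + h) = k^2 * (b\<^sub>0 Z * b\<^sub>2 Z)"
  shows "opp_LC Z"
proof -
  have b: "b\<^sub>0 Z > 0" "b\<^sub>2 Z > 0" using Z by (simp_all add: pos_coeffs_def)
  obtain r k g where s: "0 < r" "0 < k" "0 < g" "k * b\<^sub>1 Z = g + l * h + h * r + r * l" "k * a\<^sub>1 Z = g * (l + h + r) + l * h * r"
    "g * (r + l) * (r + h) = k^2 * (b\<^sub>0 Z * b\<^sub>2 Z)" using ex by (elim exE conjE) (rule that)
  define x y where "x = k * b\<^sub>2 Z / (r + l)" and "y = k * b\<^sub>0 Z / (r + h)"
  have pos: "x > 0" "y > 0" using s b lh by (simp_all add: x_def y_def)
  have xr: "k * b\<^sub>2 Z = x * (r + l)" "k * b\<^sub>0 Z = y * (r + h)" using s lh by (simp_all add: x_def y_def)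
  have xy: "x * y = g"
  proof -
    have "(r + l) * (r + h) * (x * y) = (x * (r + l)) * (y * (r + h))" by (simp add: mult_ac)
    also have "\<dots> = (r + l) * (r + h) * g" unfolding xr[symmetric] using s(6) by (simp add: mult_ac power2_eq_square)
    finally show ?thesis using s lh by simp
  qed
  have c: "k * a\<^sub>2 Z = x * h * (r + l)" "k * a\<^sub>0 Z = y * l * (r + h)"
    unfolding lh(3,4) using xr by (simp_all add: mult_ac)
  have "proportional Z (x * h * (r + l)) (x * y * (l + h + r) + l * h * r) (y * l * (r + h))
      (x * (r + l)) (x * y + l * h + h * r + r * l) (y * (r + h))"
    unfolding proportional_def xy by (intro exI[of _ k] conjI s c xr)
  then show ?thesis unfolding opp_LC_def using pos s(1) lh by blast
qed

lemma ser_LC_of_root: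
  assumes Z: "pos_coeffs Z" and lh: "0 < l" "l < h" "a\<^sub>0 Z = l * b\<^sub>0 Z" "a\<^sub>2 Z = h * b\<^sub>2 Z" "t = b\<^sub>0 Z * b\<^sub>2 Z"
    and root: "\<exists>c>0. c < 1 / h \<and> (4 * (l * h) * t - (a\<^sub>1 Z)^2) * c^2 + 2 * (a\<^sub>1 Z * b\<^sub>1 Z - 2 * t * (l + h)) * c
       = (a\<^sub>1 Z * b\<^sub>1 Z * (l + h) - (a\<^sub>1 Z)^2 - t * (l + h)^2) / (l * h)"
  shows "ser_LC Z"
proof -
  have b: "b\<^sub>0 Z > 0" "b\<^sub>2 Z > 0" "a\<^sub>1 Z > 0" "b\<^sub>1 Z > 0" using Z by (simp_all add: pos_coeffs_def)
  have t: "t > 0" using b lh by simp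
  obtain c where c: "0 < c" "c < 1 / h" "(4 * (l * h) * t - (a\<^sub>1 Z)^2) * c^2 + 2 * (a\<^sub>1 Z * b\<^sub>1 Z - 2 * t * (l + h)) * c
       = (a\<^sub>1 Z * b\<^sub>1 Z * (l + h) - (a\<^sub>1 Z)^2 - t * (l + h)^2) / (l * h)" using root by (elim exE conjE) (rule that)
  obtain p q r k g where s: "0 < p" "0 < q" "0 < r" "0 < k" "0 < g"
    "h * (r + q) = p * q + q * r + r * p" "l * (r + p) = p * q + q * r + r * p"
    "k * a\<^sub>1 Z = g * (p + q)" "k * b\<^sub>1 Z = p * q + q * r + r * p + g" "g * (p * q + q * r + r * p)^2 = k^2 * (l * h * t)"
    using ser_LC_parameters[OF lh(1,2) b(3,4) t c] by (elim exE conjE) (rule that)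
  define S where "S = p * q + q * r + r * p"
  have S: "S > 0" using s by (simp add: S_def add_pos_pos)
  note s' = s(6,7,9,10)[folded S_def]
  define x y where "x = k * a\<^sub>2 Z / S" and "y = k * a\<^sub>0 Z / S"
  have pos: "x > 0" "y > 0" using s b lh S by (simp_all add: x_def y_def)
  have xS: "k * a\<^sub>2 Z = x * S" "k * a\<^sub>0 Z = y * S" using S by (simp_all add: x_def y_def)
  have xy: "x * y = g"
  proof -
    have "S^2 * (x * y) = (x * S) * (y * S)" by (simp add: mult_ac power2_eq_square)
    also have "\<dots> = S^2 * g" unfolding xS[symmetric] lh(3,4) using s'(4) lh(5) by (simp add: mult_ac power2_eq_square)
    finally show ?thesis using S by simp
  qed
  have c2: "k * b\<^sub>2 Z = x * (r + q)"
  proof -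
    have "S * (x * (r + q)) = k * a\<^sub>2 Z * (r + q)" using xS by (simp add: mult_ac)
    also have "\<dots> = k * b\<^sub>2 Z * (h * (r + q))" unfolding lh(4) by (simp add: mult_ac)
    finally show ?thesis unfolding s'(1) using S by simp
  qed
  have c0: "k * b\<^sub>0 Z = y * (r + p)"
  proof -
    have "S * (y * (r + p)) = k * a\<^sub>0 Z * (r + p)" using xS by (simp add: mult_ac)
    also have "\<dots> = k * b\<^sub>0 Z * (l * (r + p))" unfolding lh(3) by (simp add: mult_ac)
    finally show ?thesis unfolding s'(2) using S by simp
  qed
  have c1: "k * b\<^sub>1 Z = g + p * q + q * r + r * p" using s(9) by simp
  have "proportional Z (x * (p * q + q * r + r * p)) (x * y * (p + q)) (y * (p * q + q * r + r * p)) (x * (r + q)) (x * y + p * q + q * r + r * p) (y * (r + p))"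
    unfolding proportional_def xy
    by (intro exI[of _ k] conjI s xS[unfolded S_def] c0 c1 c2)
  then show ?thesis unfolding ser_LC_def using pos s(1-3) by blast
qed

lemma arm_LC_sufficient:
  assumes Z: "pos_coeffs Z" "\<B> Z < 0" and "\<R> Z < 0" "opp_disc Z \<le> 0" "\<D>\<^sub>b Z < 0" "\<E>\<^sub>a Z < 0" "arm_LC_linear_coeff Z > 0"
  shows "arm_LC Z"
proof -
  have b: "b\<^sub>0 Z > 0" "b\<^sub>2 Z > 0" and ab: "a\<^sub>1 Z > 0" "b\<^sub>1 Z > 0" using Z by (simp_all add: pos_coeffs_def)
  obtain l h t where lht: "0 < l" "l < h" "0 < t" "a\<^sub>0 Z = l * b\<^sub>0 Z" "a\<^sub>2 Z = h * b\<^sub>2 Z" "t = b\<^sub>0 Z * b\<^sub>2 Z"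
    and R: "\<R> Z = t * ((a\<^sub>1 Z - l * b\<^sub>1 Z) * (h * b\<^sub>1 Z - a\<^sub>1 Z) - t * (h - l)^2)"
    and Q: "opp_disc Z = t * ((a\<^sub>1 Z - l * b\<^sub>1 Z) * (h * b\<^sub>1 Z - a\<^sub>1 Z) - t * (h - l)^2 - 4 * l * (a\<^sub>1 Z * b\<^sub>1 Z - 2 * t * (h - l)))"
    and T: "arm_LC_linear_coeff Z = t * ((a\<^sub>1 Z - l * b\<^sub>1 Z) * (h * b\<^sub>1 Z - a\<^sub>1 Z) - t * (h - l)^2 + 2 * l * t * (h - l))"
    and D: "\<D>\<^sub>b Z = b\<^sub>0 Z * (b\<^sub>1 Z * (a\<^sub>1 Z - l * b\<^sub>1 Z) - t * (h - l))"
    and E: "\<E>\<^sub>a Z = b\<^sub>2 Z * (a\<^sub>1 Z * (h * b\<^sub>1 Z - a\<^sub>1 Z) - t * h * (h - l))"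
    by (rule reduced_form[OF Z])
  have neg: "v < 0" if "u * v < 0" "0 < u" for u v :: real using that by (auto simp: mult_less_0_iff)
  have npos: "v \<le> 0" if "u * v \<le> 0" "0 < u" for u v :: real using that by (auto simp: mult_le_0_iff)
  obtain p q r k g where s: "0 < r" "0 < p" "0 < q" "0 < k" "0 < g"
    "p * q + p * r + q * r = h * (p + r)" "p * (q + r) = l * (p + q + r)"
    "k * b\<^sub>1 Z = g + q * (p + r)" "k * a\<^sub>1 Z = g * (q + r) + p * q * r" "g * (p + r) * (p + q + r) = k^2 * t"
    using arm_LC_solvable[OF lht(1,2) ab lht(3) neg[OF assms(3)[unfolded R] lht(3)] npos[OF assms(4)[unfolded Q] lht(3)]
      neg[OF assms(5)[unfolded D] b(1)] neg[OF assms(6)[unfolded E] b(2)] zero_less_mult_pos[OF assms(7)[unfolded T] lht(3)]]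
    by (elim exE conjE) (rule that)
  define x y where "x = k * b\<^sub>2 Z / (p + r)" and "y = k * b\<^sub>0 Z / (p + q + r)"
  have pos: "x > 0" "y > 0" using s b by (simp_all add: x_def y_def)
  have xr: "k * b\<^sub>2 Z = x * (p + r)" "k * b\<^sub>0 Z = y * (p + q + r)" using s(1-3) by (simp_all add: x_def y_def)
  have xy: "x * y = g"
  proof -
    have "(p + r) * (p + q + r) * (x * y) = (x * (p + r)) * (y * (p + q + r))" by (simp only: mult_ac)
    also have "\<dots> = (p + r) * (p + q + r) * g" unfolding xr[symmetric] using s(10) lht(6) by (simp add: mult_ac power2_eq_square)
    finally show ?thesis using s(1-3) by simp
  qed
  have c2: "k * a\<^sub>2 Z = x * (p * q + p * r + q * r)" unfolding s(6) lht(5) using xr(1) by (simp only: mult_ac)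
  have c0: "k * a\<^sub>0 Z = y * p * (q + r)"
  proof -
    have "y * p * (q + r) = y * (l * (p + q + r))" using s(7) by (simp only: mult.assoc)
    also have "\<dots> = l * (k * b\<^sub>0 Z)" unfolding xr(2) by (simp only: mult_ac)
    also have "\<dots> = k * a\<^sub>0 Z" unfolding lht(4) by simp
    finally show ?thesis by simp
  qed
  have "proportional Z (x * (p * q + p * r + q * r)) (x * y * (q + r) + p * q * r) (y * p * (q + r))
     (x * (p + r)) (x * y + q * (p + r)) (y * (p + q + r))"
    unfolding proportional_def xy by (intro exI[of _ k] conjI s c2 c0 xr)
  then show ?thesis unfolding arm_LC_def using pos s(1-3) by blast
qed

lemma dual_inv_invariants:
  "\<B> (dual_inv Z) = \<B> Z" "\<D>\<^sub>b (dual_inv Z) = \<E>\<^sub>a Z" "\<E>\<^sub>a (dual_inv Z) = \<D>\<^sub>b Z"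
  "\<Gamma>\<^sub>a (dual_inv Z) = \<Gamma>\<^sub>b Z" "\<Gamma>\<^sub>b (dual_inv Z) = \<Gamma>\<^sub>a Z"
  by (simp_all add: \<Gamma>\<^sub>a_def \<Gamma>\<^sub>b_def) (simp_all add: biquad_invariants dual_inv_def algebra_simps)

lemma ser_LC_sufficient_signs:
  assumes Z: "pos_coeffs Z" "\<B> Z < 0" and "\<Gamma>\<^sub>b Z < 0" "\<E>\<^sub>a Z > 0"
  shows "ser_LC Z"
proof -
  have b: "b\<^sub>2 Z > 0" and ab: "a\<^sub>1 Z > 0" "b\<^sub>1 Z > 0" using Z by (simp_all add: pos_coeffs_def)
  obtain l h t where lht: "0 < l" "l < h" "0 < t" "a\<^sub>0 Z = l * b\<^sub>0 Z" "a\<^sub>2 Z = h * b\<^sub>2 Z" "t = b\<^sub>0 Z * b\<^sub>2 Z"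
    and E: "\<E>\<^sub>a Z = b\<^sub>2 Z * (a\<^sub>1 Z * (h * b\<^sub>1 Z - a\<^sub>1 Z) - t * h * (h - l))"
    and G: "\<Gamma>\<^sub>b Z = t * (a\<^sub>1 Z * b\<^sub>1 Z * (l + h) - (a\<^sub>1 Z)^2 - t * (l + h)^2)"
    by (rule reduced_form[OF Z])
  have neg: "v < 0" if "u * v < 0" "0 < u" for u v :: real using that by (auto simp: mult_less_0_iff)
  show ?thesis
    by (rule ser_LC_of_root[OF Z(1) lht(1,2,4,5,6)
        ser_LC_opposite_signs[OF lht(1,2) ab lht(3) neg[OF assms(3)[unfolded G] lht(3)] zero_less_mult_pos[OF assms(4)[unfolded E] b]]])
qed

lemma ser_LC_sufficient_vertex:
  assumes Z: "pos_coeffs Z" "\<B> Z < 0" and "\<R> Z < 0" "\<Gamma>\<^sub>b Z > 0"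
    and large: "a\<^sub>1 Z * b\<^sub>1 Z > 2 * (a\<^sub>0 Z * b\<^sub>2 Z + a\<^sub>2 Z * b\<^sub>0 Z)"
    and vertex: "a\<^sub>2 Z * (a\<^sub>1 Z * b\<^sub>1 Z - 2 * (a\<^sub>0 Z * b\<^sub>2 Z + a\<^sub>2 Z * b\<^sub>0 Z)) < b\<^sub>2 Z * ((a\<^sub>1 Z)^2 - 4 * a\<^sub>0 Z * a\<^sub>2 Z)"
  shows "ser_LC Z"
proof -
  have b: "b\<^sub>2 Z > 0" and ab: "a\<^sub>1 Z > 0" "b\<^sub>1 Z > 0" using Z by (simp_all add: pos_coeffs_def)
  obtain l h t where lht: "0 < l" "l < h" "0 < t" "a\<^sub>0 Z = l * b\<^sub>0 Z" "a\<^sub>2 Z = h * b\<^sub>2 Z" "t = b\<^sub>0 Z * b\<^sub>2 Z"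
    and R: "\<R> Z = t * ((a\<^sub>1 Z - l * b\<^sub>1 Z) * (h * b\<^sub>1 Z - a\<^sub>1 Z) - t * (h - l)^2)"
    and G: "\<Gamma>\<^sub>b Z = t * (a\<^sub>1 Z * b\<^sub>1 Z * (l + h) - (a\<^sub>1 Z)^2 - t * (l + h)^2)"
    by (rule reduced_form[OF Z])
  have neg: "v < 0" if "u * v < 0" "0 < u" for u v :: real using that by (auto simp: mult_less_0_iff)
  have L: "a\<^sub>1 Z * b\<^sub>1 Z > 2 * t * (l + h)" using large unfolding lht(4-6) by (simp add: algebra_simps)
  have "b\<^sub>2 Z * (h * (a\<^sub>1 Z * b\<^sub>1 Z - 2 * t * (l + h))) < b\<^sub>2 Z * ((a\<^sub>1 Z)^2 - 4 * (l * h) * t)"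
    using vertex unfolding lht(4-6) by (simp add: algebra_simps)
  then have V: "h * (a\<^sub>1 Z * b\<^sub>1 Z - 2 * t * (l + h)) < (a\<^sub>1 Z)^2 - 4 * (l * h) * t"
    using b by (simp only: mult_less_cancel_left_pos)
  show ?thesis
    by (rule ser_LC_of_root[OF Z(1) lht(1,2,4,5,6)
        ser_LC_both_positive[OF lht(1,2) ab lht(3) neg[OF assms(3)[unfolded R] lht(3)] zero_less_mult_pos[OF assms(4)[unfolded G] lht(3)] L V]])
qed

text \<open>If \<open>\<Gamma>\<^sub>a\<close> and \<open>\<Gamma>\<^sub>b\<close> have opposite signs, the opposite-arm bridge works. If both are negative, the
  series bridge works when \<open>\<E>\<^sub>a > 0\<close> and its dual when \<open>\<D>\<^sub>b > 0\<close>. If both are positive, the size of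
  \<open>a\<^sub>1 b\<^sub>1\<close> decides between the opposite-arm bridge and the series bridge or its dual.\<close>

lemma regular_sufficient:
  assumes Z: "pos_coeffs Z" "\<B> Z < 0" and R: "\<R> Z < 0" and G: "\<Gamma>\<^sub>a Z * \<Gamma>\<^sub>b Z \<noteq> 0"
    and reg: "\<D>\<^sub>b Z > 0 \<or> \<E>\<^sub>a Z > 0"
  shows "opp_LC Z \<or> ser_LC Z \<or> ser_LC (dual_inv Z)"
proof -
  have b: "b\<^sub>0 Z > 0" "b\<^sub>2 Z > 0" and ab: "a\<^sub>1 Z > 0" "b\<^sub>1 Z > 0" using Z by (simp_all add: pos_coeffs_def)
  have Zd: "pos_coeffs (dual_inv Z)" "\<B> (dual_inv Z) < 0" using Z by (simp_all add: dual_inv_invariants)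
  obtain l h t where lht: "0 < l" "l < h" "0 < t" "a\<^sub>0 Z = l * b\<^sub>0 Z" "a\<^sub>2 Z = h * b\<^sub>2 Z" "t = b\<^sub>0 Z * b\<^sub>2 Z"
    and Re: "\<R> Z = t * ((a\<^sub>1 Z - l * b\<^sub>1 Z) * (h * b\<^sub>1 Z - a\<^sub>1 Z) - t * (h - l)^2)"
    and Ga: "\<Gamma>\<^sub>a Z = t * (a\<^sub>1 Z * b\<^sub>1 Z * (l + h) - l * h * (b\<^sub>1 Z)^2 - t * (l + h)^2)"
    and Gb: "\<Gamma>\<^sub>b Z = t * (a\<^sub>1 Z * b\<^sub>1 Z * (l + h) - (a\<^sub>1 Z)^2 - t * (l + h)^2)"
    by (rule reduced_form[OF Z])
  have h: "0 < h" using lht by simp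
  have neg: "v < 0" if "u * v < 0" "0 < u" for u v :: real using that by (auto simp: mult_less_0_iff)
  consider "\<Gamma>\<^sub>a Z * \<Gamma>\<^sub>b Z < 0" | "\<Gamma>\<^sub>a Z < 0" "\<Gamma>\<^sub>b Z < 0" | "\<Gamma>\<^sub>a Z > 0" "\<Gamma>\<^sub>b Z > 0"
    using G by (metis mult_eq_0_iff linorder_neqE_linordered_idom mult_pos_neg mult_neg_pos)
  then show ?thesis
  proof cases
    case 1
    define u v where "u = a\<^sub>1 Z * b\<^sub>1 Z * (l + h) - l * h * (b\<^sub>1 Z)^2 - t * (l + h)^2" and "v = a\<^sub>1 Z * b\<^sub>1 Z * (l + h) - (a\<^sub>1 Z)^2 - t * (l + h)^2"
    have "(t * u) * (t * v) < 0" using 1 unfolding Ga Gb u_def v_def .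
    then have "(t * t) * (u * v) < 0" by (simp only: mult_ac)
    then have "u * v < 0" by (rule neg) (use lht(3) in simp)
    then show ?thesis
      using opp_LC_of_parameters[OF Z(1) lht(1) h lht(4,5) opp_LC_opposite_signs[OF lht(1) h ab lht(3), unfolded lht(6)]]
      unfolding u_def v_def lht(6) by blast
  next
    case 2
    then show ?thesis using ser_LC_sufficient_signs[OF Z] ser_LC_sufficient_signs[OF Zd] reg unfolding dual_inv_invariants by blast
  next
    case 3
    note R' = neg[OF R[unfolded Re] lht(3)]
    show ?thesis
    proof (cases "a\<^sub>1 Z * b\<^sub>1 Z \<le> 2 * t * (l + h)")
      case True
      note par = opp_LC_both_positive[OF lht(1) h ab lht(3) R' zero_less_mult_pos[OF 3(1)[unfolded Ga] lht(3)]
          zero_less_mult_pos[OF 3(2)[unfolded Gb] lht(3)] True]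
      show ?thesis using opp_LC_of_parameters[OF Z(1) lht(1) h lht(4,5) par[unfolded lht(6)]] by blast
    next
      case False
      then have L: "a\<^sub>1 Z * b\<^sub>1 Z > 2 * t * (l + h)" by simp
      have L': "a\<^sub>1 Z * b\<^sub>1 Z > 2 * (a\<^sub>0 Z * b\<^sub>2 Z + a\<^sub>2 Z * b\<^sub>0 Z)" using L unfolding lht(4-6) by (simp add: algebra_simps)
      consider "h * (a\<^sub>1 Z * b\<^sub>1 Z - 2 * t * (l + h)) < (a\<^sub>1 Z)^2 - 4 * (l * h) * t"
        | "a\<^sub>1 Z * b\<^sub>1 Z - 2 * t * (l + h) < l * ((b\<^sub>1 Z)^2 - 4 * t)"
        using vertex_alternative[OF lht(1,2) ab lht(3) R' L] by blast
      then show ?thesis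
      proof cases
        case 1
        then have "b\<^sub>2 Z * (h * (a\<^sub>1 Z * b\<^sub>1 Z - 2 * t * (l + h))) < b\<^sub>2 Z * ((a\<^sub>1 Z)^2 - 4 * (l * h) * t)"
          using b by (simp only: mult_less_cancel_left_pos)
        then have "a\<^sub>2 Z * (a\<^sub>1 Z * b\<^sub>1 Z - 2 * (a\<^sub>0 Z * b\<^sub>2 Z + a\<^sub>2 Z * b\<^sub>0 Z)) < b\<^sub>2 Z * ((a\<^sub>1 Z)^2 - 4 * a\<^sub>0 Z * a\<^sub>2 Z)"
          unfolding lht(4-6) by (simp add: algebra_simps)
        then show ?thesis using ser_LC_sufficient_vertex[OF Z R 3(2) L'] by blast
      next
        case 2
        then have "b\<^sub>0 Z * (a\<^sub>1 Z * b\<^sub>1 Z - 2 * t * (l + h)) < b\<^sub>0 Z * (l * ((b\<^sub>1 Z)^2 - 4 * t))"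
          using b by (simp only: mult_less_cancel_left_pos)
        then have "b\<^sub>0 Z * (a\<^sub>1 Z * b\<^sub>1 Z - 2 * (a\<^sub>0 Z * b\<^sub>2 Z + a\<^sub>2 Z * b\<^sub>0 Z)) < a\<^sub>0 Z * ((b\<^sub>1 Z)^2 - 4 * b\<^sub>0 Z * b\<^sub>2 Z)"
          unfolding lht(4-6) by (simp add: algebra_simps)
        then show ?thesis using ser_LC_sufficient_vertex[OF Zd] R 3(1) L'
          by (simp add: dual_inv_invariants) (simp add: dual_inv_def mult_ac add.commute)
      qed
    qed
  qed
qed

section \<open>The criterion\<close>

text \<open>For \<open>\<B> < 0\<close> the forms with \<open>freq_inv\<close> drop out: each of them would make \<open>\<B>\<close> positive.\<close>

lemma bridge_realizable_neg_B:
  assumes Z: "pos_coeffs Z" "\<B> Z < 0" and R: "\<R> Z \<noteq> 0" and G: "\<Gamma>\<^sub>a Z * \<Gamma>\<^sub>b Z \<noteq> 0" and DE: "\<D>\<^sub>b Z * \<E>\<^sub>a Z \<noteq> 0"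
  shows "bridge_realizable Z \<longleftrightarrow> (\<R> Z > 0 \<and> (opp_disc Z \<ge> 0 \<or> arm_disc Z \<ge> 0)) \<or>
    (\<R> Z < 0 \<and> (\<D>\<^sub>b Z > 0 \<or> \<E>\<^sub>a Z > 0 \<or> (opp_disc Z \<le> 0 \<and> arm_LC_linear_coeff Z > 0)))" (is "_ \<longleftrightarrow> ?R")
proof -
  have inv: "\<B> (freq_inv Z) = - \<B> Z" by (simp add: \<B>_def freq_inv_def)
  show ?thesis
  proof
    assume "bridge_realizable Z"
    then consider "opp_LL Z" | "opp_LL (freq_inv Z)" | "arm_LL Z" | "arm_LL (freq_inv Z)" | "opp_LC Z" | "ser_LC Z"
      | "ser_LC (dual_inv Z)" | "arm_LC Z" | "arm_LC (freq_inv Z)"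
      unfolding bridge_realizable_iff[OF Z(1) R] by blast
    then show ?R
    proof cases
      case 1 then show ?R using opp_LL_necessary[of Z] R by auto
    next
      case 2 then show ?R using opp_LL_necessary(1) Z(2) inv by fastforce
    next
      case 3 then show ?R using arm_LL_necessary[of Z] R by auto
    next
      case 4 then show ?R using arm_LL_necessary(1) Z(2) inv by fastforce
    next
      case 5 then show ?R using opp_LC_necessary[of Z] R Z(2) by auto
    next
      case 6 then show ?R using ser_LC_necessary[of Z] R Z(2) by auto
    next
      case 7 then show ?R using ser_LC_necessary[of "dual_inv Z"] R Z(2) by (auto simp: dual_inv_invariants)
    next
      case 8
      have "\<D>\<^sub>b Z \<noteq> 0" "\<E>\<^sub>a Z \<noteq> 0" using DE by auto
      then show ?R using arm_LC_necessary[OF 8] R by (auto simp: not_less order_less_le)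
    next
      case 9 then show ?R using arm_LC_necessary(1) Z(2) inv by fastforce
    qed
  next
    assume rhs: ?R
    have DE0: "\<D>\<^sub>b Z \<noteq> 0" "\<E>\<^sub>a Z \<noteq> 0" using DE by auto
    show "bridge_realizable Z"
    proof (cases "\<R> Z > 0")
      case True
      then show ?thesis unfolding bridge_realizable_iff[OF Z(1) R]
        using rhs opp_LL_sufficient[OF Z] arm_LL_sufficient[OF Z] by auto
    next
      case False
      then have Rn: "\<R> Z < 0" using R by simp
      show ?thesis
      proof (cases "\<D>\<^sub>b Z > 0 \<or> \<E>\<^sub>a Z > 0")
        case True
        then show ?thesis unfolding bridge_realizable_iff[OF Z(1) R] using regular_sufficient[OF Z Rn G] by blast
      next
        case False
        then have "\<D>\<^sub>b Z < 0" "\<E>\<^sub>a Z < 0" using DE0 by auto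
        then show ?thesis unfolding bridge_realizable_iff[OF Z(1) R] using arm_LC_sufficient[OF Z Rn] rhs Rn by auto
      qed
    qed
  qed
qed

text \<open>The conditions of the theorem as a predicate, so that their invariance under frequency inversion can
  be stated.\<close>

definition bridge_condition :: "biquadratic \<Rightarrow> bool" where
  "bridge_condition Z \<longleftrightarrow>
    (\<R> Z > 0 \<and>
      (\<R> Z - 4 * a\<^sub>0 Z * b\<^sub>2 Z * (a\<^sub>1 Z * b\<^sub>1 Z + 2 * \<B> Z) \<ge> 0 \<or>
       \<R> Z - 4 * a\<^sub>2 Z * b\<^sub>0 Z * (a\<^sub>1 Z * b\<^sub>1 Z - 2 * \<B> Z) \<ge> 0 \<or>
       \<R> Z - 4 * a\<^sub>0 Z * a\<^sub>2 Z * b\<^sub>0 Z * b\<^sub>2 Z \<ge> 0)) \<or>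
    (\<R> Z < 0 \<and>
      (regular (biquad_fun Z) \<or>
       (\<B> Z < 0 \<and>
        \<R> Z - 4 * a\<^sub>0 Z * b\<^sub>2 Z * (a\<^sub>1 Z * b\<^sub>1 Z + 2 * \<B> Z) \<le> 0 \<and>
        \<not> same_sign3 (\<D>\<^sub>b Z) (\<E>\<^sub>a Z) (\<R> Z - 2 * a\<^sub>0 Z * b\<^sub>2 Z * \<B> Z) \<and>
        (\<R> Z - 2 * a\<^sub>0 Z * b\<^sub>2 Z * \<B> Z = 0 \<longrightarrow> \<D>\<^sub>b Z * \<E>\<^sub>a Z < 0)) \<or>
       (\<B> Z > 0 \<and>
        \<R> Z - 4 * a\<^sub>2 Z * b\<^sub>0 Z * (a\<^sub>1 Z * b\<^sub>1 Z - 2 * \<B> Z) \<le> 0 \<and>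
        \<not> same_sign3 (\<D>\<^sub>a Z) (\<E>\<^sub>b Z) (\<R> Z + 2 * a\<^sub>2 Z * b\<^sub>0 Z * \<B> Z) \<and>
        (\<R> Z + 2 * a\<^sub>2 Z * b\<^sub>0 Z * \<B> Z = 0 \<longrightarrow> \<D>\<^sub>a Z * \<E>\<^sub>b Z < 0))))"

text \<open>When \<open>\<B> < 0\<close>, the second discriminant is at most the first. A function that is not regular has
  \<open>\<D>\<^sub>b < 0\<close> and \<open>\<E>\<^sub>a < 0\<close>, and then the sign condition of the theorem says that \<open>\<R> - 2 a\<^sub>0 b\<^sub>2 \<B>\<close> is
  positive; a regular function is admitted anyway.\<close>

lemma bridge_condition_neg_B:
  assumes Z: "pos_coeffs Z" "\<B> Z < 0" and DE: "\<D>\<^sub>b Z * \<E>\<^sub>a Z \<noteq> 0"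
  shows "bridge_condition Z \<longleftrightarrow> (\<R> Z > 0 \<and> (opp_disc Z \<ge> 0 \<or> arm_disc Z \<ge> 0)) \<or>
    (\<R> Z < 0 \<and> (\<D>\<^sub>b Z > 0 \<or> \<E>\<^sub>a Z > 0 \<or> (opp_disc Z \<le> 0 \<and> arm_LC_linear_coeff Z > 0)))"
proof -
  define Q2 where "Q2 = \<R> Z - 4 * a\<^sub>2 Z * b\<^sub>0 Z * (a\<^sub>1 Z * b\<^sub>1 Z - 2 * \<B> Z)"
  have pos: "a\<^sub>2 Z > 0" "a\<^sub>1 Z > 0" "a\<^sub>0 Z > 0" "b\<^sub>2 Z > 0" "b\<^sub>1 Z > 0" "b\<^sub>0 Z > 0"
    using Z by (auto simp: pos_coeffs_def)
  have "opp_disc Z = Q2 + (- \<B> Z) * (4 * a\<^sub>1 Z * b\<^sub>1 Z + 8 * (a\<^sub>0 Z * b\<^sub>2 Z + a\<^sub>2 Z * b\<^sub>0 Z))"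
    unfolding opp_disc_def Q2_def \<B>_def by algebra
  moreover have "(- \<B> Z) * (4 * a\<^sub>1 Z * b\<^sub>1 Z + 8 * (a\<^sub>0 Z * b\<^sub>2 Z + a\<^sub>2 Z * b\<^sub>0 Z)) > 0"
    using pos Z(2) by (intro mult_pos_pos add_pos_pos) auto
  ultimately have Q2: "Q2 \<ge> 0 \<Longrightarrow> opp_disc Z \<ge> 0" by linarith
  have DE0: "\<D>\<^sub>b Z \<noteq> 0" "\<E>\<^sub>a Z \<noteq> 0" using DE by auto
  have reg: "regular (biquad_fun Z) \<longleftrightarrow> \<D>\<^sub>b Z > 0 \<or> \<E>\<^sub>a Z > 0"
    using regular_biquad_iff[OF Z(1)] Z(2) DE0 by auto
  have ii: "\<not> same_sign3 (\<D>\<^sub>b Z) (\<E>\<^sub>a Z) (arm_LC_linear_coeff Z) \<and> (arm_LC_linear_coeff Z = 0 \<longrightarrow> \<D>\<^sub>b Z * \<E>\<^sub>a Z < 0) \<longleftrightarrow> arm_LC_linear_coeff Z > 0"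
    if "\<not> (\<D>\<^sub>b Z > 0 \<or> \<E>\<^sub>a Z > 0)"
  proof -
    have "\<D>\<^sub>b Z < 0" "\<E>\<^sub>a Z < 0" using that DE0 by auto
    then show ?thesis
      by (cases "arm_LC_linear_coeff Z" "0::real" rule: linorder_cases)
        (simp_all add: same_sign3_def mult_neg_neg not_less less_imp_le)
  qed
  show ?thesis
    unfolding bridge_condition_def reg Q2_def[symmetric] opp_disc_def[symmetric] arm_disc_def[symmetric] arm_LC_linear_coeff_def[symmetric]
    using Q2 ii Z(2) by (metis less_asym)
qed

lemma freq_inv_invariants:
  "\<B> (freq_inv Z) = - \<B> Z" "\<D>\<^sub>b (freq_inv Z) = \<E>\<^sub>b Z" "\<E>\<^sub>a (freq_inv Z) = \<D>\<^sub>a Z"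
  "\<D>\<^sub>a (freq_inv Z) = \<E>\<^sub>a Z" "\<E>\<^sub>b (freq_inv Z) = \<D>\<^sub>b Z"
  "\<Gamma>\<^sub>a (freq_inv Z) = \<Gamma>\<^sub>a Z" "\<Gamma>\<^sub>b (freq_inv Z) = \<Gamma>\<^sub>b Z"
  by (simp_all add: \<Gamma>\<^sub>a_def \<Gamma>\<^sub>b_def) (simp_all add: biquad_invariants freq_inv_def algebra_simps)

text \<open>Frequency inversion exchanges the two cases \<open>\<B> < 0\<close> and \<open>\<B> > 0\<close> of the condition.\<close>

lemma bridge_condition_freq_inv:
  assumes Z: "pos_coeffs Z"
  shows "bridge_condition (freq_inv Z) \<longleftrightarrow> bridge_condition Z"
proof -
  have c: "a\<^sub>0 (freq_inv Z) = a\<^sub>2 Z" "a\<^sub>1 (freq_inv Z) = a\<^sub>1 Z" "a\<^sub>2 (freq_inv Z) = a\<^sub>0 Z"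
    "b\<^sub>0 (freq_inv Z) = b\<^sub>2 Z" "b\<^sub>1 (freq_inv Z) = b\<^sub>1 Z" "b\<^sub>2 (freq_inv Z) = b\<^sub>0 Z" by (simp_all add: freq_inv_def)
  have reg: "regular (biquad_fun (freq_inv Z)) \<longleftrightarrow> regular (biquad_fun Z)"
    using regular_biquad_iff[OF Z] regular_biquad_iff[of "freq_inv Z"] Z by (auto simp: freq_inv_invariants)
  have s: "same_sign3 y x z \<longleftrightarrow> same_sign3 x y z" for x y z by (auto simp: same_sign3_def)
  have m: "4 * a\<^sub>2 Z * a\<^sub>0 Z * b\<^sub>2 Z * b\<^sub>0 Z = 4 * a\<^sub>0 Z * a\<^sub>2 Z * b\<^sub>0 Z * b\<^sub>2 Z" by simp
  show ?thesis
    unfolding bridge_condition_def reg freq_inv_invariants R_freq_inv c m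
      s[of "\<E>\<^sub>b Z" "\<D>\<^sub>a Z"] s[of "\<E>\<^sub>a Z" "\<D>\<^sub>b Z"] mult.commute[of "\<E>\<^sub>b Z" "\<D>\<^sub>a Z"] mult.commute[of "\<E>\<^sub>a Z" "\<D>\<^sub>b Z"]
    by (auto simp: algebra_simps)
qed

theorem theorem7:
  fixes Z :: biquadratic
  assumes "Z \<in> \<Z>\<^sub>b"
  shows "realizable_two_reactive_bridge (biquad_fun Z) \<longleftrightarrow>
    (\<R> Z > 0 \<and>
      (\<R> Z - 4 * a\<^sub>0 Z * b\<^sub>2 Z * (a\<^sub>1 Z * b\<^sub>1 Z + 2 * \<B> Z) \<ge> 0 \<or>
       \<R> Z - 4 * a\<^sub>2 Z * b\<^sub>0 Z * (a\<^sub>1 Z * b\<^sub>1 Z - 2 * \<B> Z) \<ge> 0 \<or>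
       \<R> Z - 4 * a\<^sub>0 Z * a\<^sub>2 Z * b\<^sub>0 Z * b\<^sub>2 Z \<ge> 0)) \<or>
    (\<R> Z < 0 \<and>
      (regular (biquad_fun Z) \<or>
       (\<B> Z < 0 \<and>
        \<R> Z - 4 * a\<^sub>0 Z * b\<^sub>2 Z * (a\<^sub>1 Z * b\<^sub>1 Z + 2 * \<B> Z) \<le> 0 \<and>
        \<not> same_sign3 (\<D>\<^sub>b Z) (\<E>\<^sub>a Z) (\<R> Z - 2 * a\<^sub>0 Z * b\<^sub>2 Z * \<B> Z) \<and>
        (\<R> Z - 2 * a\<^sub>0 Z * b\<^sub>2 Z * \<B> Z = 0 \<longrightarrow> \<D>\<^sub>b Z * \<E>\<^sub>a Z < 0)) \<or>
       (\<B> Z > 0 \<and>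
        \<R> Z - 4 * a\<^sub>2 Z * b\<^sub>0 Z * (a\<^sub>1 Z * b\<^sub>1 Z - 2 * \<B> Z) \<le> 0 \<and>
        \<not> same_sign3 (\<D>\<^sub>a Z) (\<E>\<^sub>b Z) (\<R> Z + 2 * a\<^sub>2 Z * b\<^sub>0 Z * \<B> Z) \<and>
        (\<R> Z + 2 * a\<^sub>2 Z * b\<^sub>0 Z * \<B> Z = 0 \<longrightarrow> \<D>\<^sub>a Z * \<E>\<^sub>b Z < 0))))"
proof -
  have neg: "bridge_realizable W \<longleftrightarrow> bridge_condition W"
    if "pos_coeffs W" "\<B> W < 0" "\<R> W \<noteq> 0" "\<Gamma>\<^sub>a W * \<Gamma>\<^sub>b W \<noteq> 0" "\<D>\<^sub>b W * \<E>\<^sub>a W \<noteq> 0" for W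
    using bridge_realizable_neg_B[OF that] bridge_condition_neg_B[OF that(1,2,5)] by blast
  have Z: "pos_coeffs Z" "\<R> Z \<noteq> 0" "\<B> Z \<noteq> 0" "\<Gamma>\<^sub>a Z * \<Gamma>\<^sub>b Z \<noteq> 0"
    "\<B> Z > 0 \<Longrightarrow> \<D>\<^sub>a Z * \<E>\<^sub>b Z \<noteq> 0" "\<B> Z < 0 \<Longrightarrow> \<D>\<^sub>b Z * \<E>\<^sub>a Z \<noteq> 0"
    using assms by (auto simp: \<Z>\<^sub>b_def pos_coeffs_def)
  have "bridge_realizable Z \<longleftrightarrow> bridge_condition Z"
  proof (cases "\<B> Z < 0")
    case True
    then show ?thesis using neg Z by blast
  next
    case False
    then have "\<B> Z > 0" using Z(3) by simp
    then have "bridge_realizable (freq_inv Z) \<longleftrightarrow> bridge_condition (freq_inv Z)"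
      using Z by (intro neg) (simp_all add: freq_inv_invariants)
    then show ?thesis using bridge_realizable_freq_inv bridge_condition_freq_inv[OF Z(1)] by blast
  qed
  then show ?thesis unfolding realizable_two_reactive_bridge_iff bridge_condition_def .
qed

end
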